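(* Let $A$ be a regular ring containing a field $k$ with $1/2\in k$, $\dim A=d$, and let $P$ be a projective $A$-module of rank $n$ with $2n\geq d+2$. Let $\mathbf{e}_0=\zeta_0(0,0,0)$ and $\mathbf{e}_1=\zeta_0(0,0,1)$ in $\pi_0(\widetilde Q(P))$. Then: (1) the addition $+$ on $\pi_0(\widetilde Q(P))$ is commutative and associative, and $\mathbf{e}_1$ is an additive identity, so $\pi_0(\widetilde Q(P))$ is an abelian monoid; (2) for every $x\in\pi_0(\widetilde Q(P))$, $x+\widetilde\Gamma(x)=\mathbf{e}_0$; (3) if $\mathbf{e}_0=\mathbf{e}_1$, then $\pi_0(\widetilde Q(P))$ is an abelian group under $+$; in particular this holds if $P\cong Q\oplus A$ for some projective $A$-module $Q$.
   Context: All rings are commutative. $P^*=\mathrm{Hom}_A(P,A)$ and $P[T]=P\otimes_AA[T]$. Let $\widetilde{Q}(P)=\{(f,p,s)\in P^*\oplus P\oplus A: f(p)+s(s-1)=0\}$, and define $\widetilde Q(P[T])$ likewise. $\pi_0(\widetilde Q(P))$ is the quotient of $\widetilde Q(P)$ by the equivalence relation generated by $H(0)\sim H(1)$ for $H(T)\in\widetilde Q(P[T])$; $\zeta_0$ is the quotient map. A local $P$-orientation is a pair $(I,\omega)$, $I\subseteq A$ an ideal and $\omega:P\to I/I^2$ surjective; $\mathcal{LO}(P)$ is their set. Define $\eta(f,p,s)=(f(P)+As,\omega)$ with $\omega$ induced by $f$. $\zeta:\mathcal{LO}(P)\to\pi_0(\widetilde Q(P))$ sends $(I,\omega)$ to $\zeta_0(u)$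 for any $u$ with $\eta(u)=(I,\omega)$; this is well defined. For $I+J=A$, $\omega_I\star\omega_J:P\to IJ/(IJ)^2$ is the unique surjection inducing $\omega_I$ and $\omega_J$. The map $\Gamma(f,p,s)=(f,p,1-s)$ on $\widetilde Q(P)$ induces a well-defined involution $\widetilde\Gamma$ of $\pi_0(\widetilde Q(P))$. Addition: for $x,y\in\pi_0(\widetilde Q(P))$ one can choose $(K,\omega_K),(I,\omega_I)\in\mathcal{LO}(P)$ with $x=\zeta(K,\omega_K)$, $y=\zeta(I,\omega_I)$, $I+K=A$ and $\operatorname{height}K\geq n$. One defines $x+y=\zeta(KI,\omega_K\star\omega_I)$; this does not depend on the choices. *)

theory Defs
  imports "HOL-Computational_Algebra.Polynomial"
begin

definition is_ideal :: "'b::comm_ring_1 set \<Rightarrow> bool" where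
  "is_ideal I \<longleftrightarrow> 0 \<in> I \<and> (\<forall>x\<in>I. \<forall>y\<in>I. x + y \<in> I) \<and> (\<forall>a. \<forall>x\<in>I. a * x \<in> I)"

definition ideal_gen :: "'b::comm_ring_1 set \<Rightarrow> 'b set" where
  "ideal_gen S = \<Inter>{I. is_ideal I \<and> S \<subseteq> I}"

definition ideal_prod :: "'b::comm_ring_1 set \<Rightarrow> 'b set \<Rightarrow> 'b set" where
  "ideal_prod I J = ideal_gen {a * b | a b. a \<in> I \<and> b \<in> J}"

definition prime_ideal :: "'b::comm_ring_1 set \<Rightarrow> bool" where
  "prime_ideal p \<longleftrightarrow> is_ideal p \<and> (1::'b) \<notin> p \<and> (\<forall>a b. a * b \<in> p \<longrightarrow> a \<in> p \<or> b \<in> p)"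

definition noetherian :: "'b::comm_ring_1 itself \<Rightarrow> bool" where
  "noetherian _ \<longleftrightarrow> (\<forall>I::'b set. is_ideal I \<longrightarrow> (\<exists>F. finite F \<and> I = ideal_gen F))"

definition prime_chain :: "'b::comm_ring_1 set list \<Rightarrow> bool" where
  "prime_chain c \<longleftrightarrow> c \<noteq> [] \<and> (\<forall>p\<in>set c. prime_ideal p) \<and> sorted_wrt (\<subset>) c"

definition krull_dim_eq :: "'b::comm_ring_1 itself \<Rightarrow> nat \<Rightarrow> bool" where
  "krull_dim_eq _ d \<longleftrightarrow> (\<exists>c::'b set list. prime_chain c \<and> length c = d + 1)
       \<and> (\<forall>c::'b set list. prime_chain c \<longrightarrow> length c \<le> d + 1)"

definition prime_height_eq :: "'b::comm_ring_1 set \<Rightarrow> nat \<Rightarrow> bool" where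
  "prime_height_eq p h \<longleftrightarrow> (\<exists>c. prime_chain c \<and> last c = p \<and> length c = h + 1)
       \<and> (\<forall>c. prime_chain c \<and> last c = p \<longrightarrow> length c \<le> h + 1)"

text \<open>height K \<ge> n: every prime containing K has height at least n (the unit ideal has height \<infinity>).\<close>
definition height_ge :: "'b::comm_ring_1 set \<Rightarrow> nat \<Rightarrow> bool" where
  "height_ge K n \<longleftrightarrow> (\<forall>p. prime_ideal p \<and> K \<subseteq> p \<longrightarrow>
       (\<exists>c. prime_chain c \<and> last c = p \<and> length c = n + 1))"

text \<open>Regular ring: Noetherian, and every localization A_p is a regular local ring, i.e. its maximal
  ideal pA_p is generated by dim A_p = height p elements (written out without forming A_p;
  denominators of the generators can be cleared).\<close>
definition regular_ring :: "'b::comm_ring_1 itself \<Rightarrow> bool" where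
  "regular_ring T \<longleftrightarrow> noetherian T \<and>
     (\<forall>p::'b set. prime_ideal p \<longrightarrow> (\<exists>h. prime_height_eq p h \<and>
        (\<exists>x::nat \<Rightarrow> 'b. (\<forall>i<h. x i \<in> p) \<and>
            (\<forall>y\<in>p. \<exists>t. t \<notin> p \<and> t * y \<in> ideal_gen (x ` {..<h})))))"

definition contains_field_half :: "'b::comm_ring_1 itself \<Rightarrow> bool" where
  "contains_field_half _ \<longleftrightarrow> (\<exists>K::'b set. (0::'b) \<noteq> 1 \<and> 0 \<in> K \<and> 1 \<in> K \<and>
      (\<forall>x\<in>K. \<forall>y\<in>K. x + y \<in> K \<and> x - y \<in> K \<and> x * y \<in> K) \<and>
      (\<forall>x\<in>K. x \<noteq> 0 \<longrightarrow> (\<exists>y\<in>K. x * y = 1)) \<and>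
      (\<exists>y\<in>K. 2 * y = 1))"

section \<open>Finitely generated projective modules as images of idempotent matrices\<close>

type_synonym 'b vec = "nat \<Rightarrow> 'b"
type_synonym 'b mat = "nat \<Rightarrow> nat \<Rightarrow> 'b"

definition idempotent_mat :: "nat \<Rightarrow> 'b::comm_ring_1 mat \<Rightarrow> bool" where
  "idempotent_mat m e \<longleftrightarrow> (\<forall>i<m. \<forall>j<m. (\<Sum>k<m. e i k * e k j) = e i j)"

text \<open>The module P = image of e in R^m (vectors supported on indices < m).\<close>
definition Pmod :: "nat \<Rightarrow> 'b::comm_ring_1 mat \<Rightarrow> 'b vec set" where
  "Pmod m e = {v. (\<forall>i\<ge>m. v i = 0) \<and> (\<forall>i<m. (\<Sum>j<m. e i j * v j) = v i)}"

definition vadd :: "'b::comm_ring_1 vec \<Rightarrow> 'b vec \<Rightarrow> 'b vec" where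
  "vadd v w = (\<lambda>i. v i + w i)"

definition vsmult :: "'b::comm_ring_1 \<Rightarrow> 'b vec \<Rightarrow> 'b vec" where
  "vsmult c v = (\<lambda>i. c * v i)"

definition dual :: "nat \<Rightarrow> 'b::comm_ring_1 mat \<Rightarrow> ('b vec \<Rightarrow> 'b) set" where
  "dual m e = {f. (\<forall>v\<in>Pmod m e. \<forall>w\<in>Pmod m e. f (vadd v w) = f v + f w) \<and>
                  (\<forall>c. \<forall>v\<in>Pmod m e. f (vsmult c v) = c * f v) \<and>
                  (\<forall>v. v \<notin> Pmod m e \<longrightarrow> f v = 0)}"

text \<open>P is a projective module of constant rank n: for every prime p, P_p is free of rank n
  over A_p (written out without forming localizations).\<close>
definition proj_rank :: "nat \<Rightarrow> 'b::comm_ring_1 mat \<Rightarrow> nat \<Rightarrow> bool" where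
  "proj_rank m e n \<longleftrightarrow> (\<forall>p::'b set. prime_ideal p \<longrightarrow>
     (\<exists>q :: nat \<Rightarrow> 'b vec. (\<forall>i<n. q i \<in> Pmod m e) \<and>
        (\<forall>x\<in>Pmod m e. \<exists>t a. t \<notin> p \<and> vsmult t x = (\<lambda>j. \<Sum>i<n. a i * q i j)) \<and>
        (\<forall>a u. u \<notin> p \<and> (\<forall>j. u * (\<Sum>i<n. a i * q i j) = 0) \<longrightarrow>
               (\<forall>i<n. \<exists>t. t \<notin> p \<and> t * a i = 0))))"

text \<open>The extension P[T] = P \<otimes> A[T] is the image of the same matrix over A[T].\<close>
definition polymat :: "'b::comm_ring_1 mat \<Rightarrow> 'b poly mat" where
  "polymat e = (\<lambda>i j. [:e i j:])"

type_synonym 'b triple = "('b vec \<Rightarrow> 'b) \<times> 'b vec \<times> 'b"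

definition Qt :: "nat \<Rightarrow> 'b::comm_ring_1 mat \<Rightarrow> 'b triple set" where
  "Qt m e = {(f, p, s). f \<in> dual m e \<and> p \<in> Pmod m e \<and> f p + s * (s - 1) = 0}"

definition ev_triple :: "nat \<Rightarrow> 'b::comm_ring_1 mat \<Rightarrow> 'b \<Rightarrow> 'b poly triple \<Rightarrow> 'b triple" where
  "ev_triple m e t H = (case H of (f, p, s) \<Rightarrow>
      ((\<lambda>v. if v \<in> Pmod m e then poly (f (\<lambda>i. [:v i:])) t else 0),
       (\<lambda>i. poly (p i) t), poly s t))"

definition htp_step :: "nat \<Rightarrow> 'b::comm_ring_1 mat \<Rightarrow> ('b triple \<times> 'b triple) set" where
  "htp_step m e = {(ev_triple m e 0 H, ev_triple m e 1 H) | H. H \<in> Qt m (polymat e)}"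

definition htp_rel :: "nat \<Rightarrow> 'b::comm_ring_1 mat \<Rightarrow> ('b triple \<times> 'b triple) set" where
  "htp_rel m e = (htp_step m e \<union> (htp_step m e)\<inverse>)\<^sup>*"

definition pi0 :: "nat \<Rightarrow> 'b::comm_ring_1 mat \<Rightarrow> 'b triple set set" where
  "pi0 m e = Qt m e // htp_rel m e"

definition zeta0 :: "nat \<Rightarrow> 'b::comm_ring_1 mat \<Rightarrow> 'b triple \<Rightarrow> 'b triple set" where
  "zeta0 m e u = htp_rel m e `` {u}"

definition coset2 :: "'b::comm_ring_1 set \<Rightarrow> 'b \<Rightarrow> 'b set" where
  "coset2 I x = {x + y | y. y \<in> ideal_prod I I}"

text \<open>A local P-orientation (I, \<omega>): \<omega> : P \<rightarrow> I/I^2 a surjective A-linear map; \<omega> v is the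
  coset (of I^2) assigned to v, and \<omega> v = {} for v outside P.\<close>
definition LO :: "nat \<Rightarrow> 'b::comm_ring_1 mat \<Rightarrow> ('b set \<times> ('b vec \<Rightarrow> 'b set)) set" where
  "LO m e = {(I, \<omega>). is_ideal I \<and> (\<forall>v. v \<notin> Pmod m e \<longrightarrow> \<omega> v = {}) \<and>
     (\<exists>w. (\<forall>v\<in>Pmod m e. w v \<in> I \<and> \<omega> v = coset2 I (w v)) \<and>
          (\<forall>v\<in>Pmod m e. \<forall>v'\<in>Pmod m e. w (vadd v v') - w v - w v' \<in> ideal_prod I I) \<and>
          (\<forall>c. \<forall>v\<in>Pmod m e. w (vsmult c v) - c * w v \<in> ideal_prod I I) \<and>
          (\<forall>a\<in>I. \<exists>v\<in>Pmod m e. a - w v \<in> ideal_prod I I))}"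

definition eta :: "nat \<Rightarrow> 'b::comm_ring_1 mat \<Rightarrow> 'b triple \<Rightarrow> 'b set \<times> ('b vec \<Rightarrow> 'b set)" where
  "eta m e u = (case u of (f, p, s) \<Rightarrow>
      (let I = {f q + a * s | q a. q \<in> Pmod m e}
       in (I, (\<lambda>v. if v \<in> Pmod m e then coset2 I (f v) else {}))))"

definition zeta :: "nat \<Rightarrow> 'b::comm_ring_1 mat \<Rightarrow> 'b set \<times> ('b vec \<Rightarrow> 'b set) \<Rightarrow> 'b triple set" where
  "zeta m e Iw = zeta0 m e (SOME u. u \<in> Qt m e \<and> eta m e u = Iw)"

text \<open>\<omega>_I \<star> \<omega>_J: the unique surjection P \<rightarrow> IJ/(IJ)^2 inducing \<omega>_I and \<omega>_J.\<close>
definition star :: "nat \<Rightarrow> 'b::comm_ring_1 mat \<Rightarrow> 'b set \<Rightarrow> ('b vec \<Rightarrow> 'b set) \<Rightarrow> 'b set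
     \<Rightarrow> ('b vec \<Rightarrow> 'b set) \<Rightarrow> ('b vec \<Rightarrow> 'b set)" where
  "star m e I \<omega>I J \<omega>J = (THE \<omega>. (ideal_prod I J, \<omega>) \<in> LO m e \<and>
       (\<forall>v\<in>Pmod m e. \<omega> v \<subseteq> \<omega>I v \<and> \<omega> v \<subseteq> \<omega>J v))"

definition pplus :: "nat \<Rightarrow> 'b::comm_ring_1 mat \<Rightarrow> nat \<Rightarrow> 'b triple set \<Rightarrow> 'b triple set \<Rightarrow> 'b triple set" where
  "pplus m e n x y = (SOME z. \<exists>K \<omega>K I \<omega>I. (K, \<omega>K) \<in> LO m e \<and> (I, \<omega>I) \<in> LO m e \<and>
       x = zeta m e (K, \<omega>K) \<and> y = zeta m e (I, \<omega>I) \<and>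
       {a + b | a b. a \<in> I \<and> b \<in> K} = UNIV \<and> height_ge K n \<and>
       z = zeta m e (ideal_prod K I, star m e K \<omega>K I \<omega>I))"

definition Gam :: "'b::comm_ring_1 triple \<Rightarrow> 'b triple" where
  "Gam u = (case u of (f, p, s) \<Rightarrow> (f, p, 1 - s))"

definition Gam_t :: "nat \<Rightarrow> 'b::comm_ring_1 mat \<Rightarrow> 'b triple set \<Rightarrow> 'b triple set" where
  "Gam_t m e x = zeta0 m e (Gam (SOME u. u \<in> x))"

definition e0 :: "nat \<Rightarrow> 'b::comm_ring_1 mat \<Rightarrow> 'b triple set" where
  "e0 m e = zeta0 m e ((\<lambda>_. 0), (\<lambda>_. 0), 0)"

definition e1 :: "nat \<Rightarrow> 'b::comm_ring_1 mat \<Rightarrow> 'b triple set" where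
  "e1 m e = zeta0 m e ((\<lambda>_. 0), (\<lambda>_. 0), 1)"

text \<open>P \<cong> Q \<oplus> A for a (f.g.) projective Q = image of an idempotent m'\<times>m' matrix e';
  Q \<oplus> A is the image of diag(e', 1).\<close>
definition diag_one :: "nat \<Rightarrow> 'b::comm_ring_1 mat \<Rightarrow> 'b mat" where
  "diag_one m' e' = (\<lambda>i j. if i < m' \<and> j < m' then e' i j else if i = m' \<and> j = m' then 1 else 0)"

definition has_free_summand :: "nat \<Rightarrow> 'b::comm_ring_1 mat \<Rightarrow> bool" where
  "has_free_summand m e \<longleftrightarrow> (\<exists>m' e' \<phi>. idempotent_mat m' e' \<and>
      bij_betw \<phi> (Pmod m e) (Pmod (Suc m') (diag_one m' e')) \<and>
      (\<forall>v\<in>Pmod m e. \<forall>w\<in>Pmod m e. \<phi> (vadd v w) = vadd (\<phi> v) (\<phi> w)) \<and>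
      (\<forall>c. \<forall>v\<in>Pmod m e. \<phi> (vsmult c v) = vsmult c (\<phi> v)))"

end

theory Submission
  imports Defs
begin

text \<open>A functional on \<open>P\<close> is written as a row vector, and every point of the quadric can be moved by
  Eichler transvections, which act on homotopies as well. By a basic element argument a transvection
  makes the ideal \<open>I(u) = f(P) + As\<close> of a point \<open>u = (f,p,s)\<close> of height at least \<open>n\<close> and comaximal
  with a given ideal \<open>J\<close> of height at least \<open>n\<close>. The same argument over \<open>A[T]\<close>, with multiples of
  \<open>T(T - 1)\<close>, makes the ideal of a homotopy comaximal with \<open>J[T]\<close> without changing its ends; here
  \<open>2n \<ge> d + 2\<close> is needed, since \<open>A/J[T]\<close> has dimension at most \<open>d - n + 1\<close>. The Chinese remainder
  theorem and Nakayama's lemma over \<open>A[T]\<close> then turn a homotopy between \<open>u\<close> and \<open>u'\<close> into one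
  between \<open>u \<star> v\<close> and \<open>u' \<star> v\<close>, so the sum is independent of all choices; the monoid laws are read
  off from representatives with pairwise comaximal ideals.\<close>

section \<open>Ideals of Noetherian rings\<close>

text \<open>The numbers balance as follows. A chain of primes that starts at a prime over an ideal
  \<open>J\<close> of height at least n has at most d + 1 - n members. A functional on
  \<open>P\<close> has n local coordinates, and each coordinate in general position improves such a
  bound by one, so no prime is left when d + 1 - n \<le> n. Over A[T] the variable may add one, and
  d + 2 - n \<le> n is the hypothesis. The ideal of a point involves \<open>s\<close> as well as
  \<open>f\<close>, so \<open>f\<close> cannot simply be replaced by a general functional. A
  transvection changes both, but at a prime containing the new ideal its effect reduces to the
  condition that f + (1 - s)^2 g maps \<open>P\<close> into the prime, which is the shape a general
  choice of g can handle. Points of one class are joined by a chain of homotopies whose inner ends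
  have uncontrolled ideals. Therefore a statement about a chain has to be proved for all transvected
  copies of its end at once.\<close>

lemma ideal_zero: "is_ideal I \<Longrightarrow> 0 \<in> I"
  by (simp add: is_ideal_def)

lemma ideal_add: "is_ideal I \<Longrightarrow> x \<in> I \<Longrightarrow> y \<in> I \<Longrightarrow> x + y \<in> I"
  by (simp add: is_ideal_def)

lemma ideal_mult: "is_ideal I \<Longrightarrow> x \<in> I \<Longrightarrow> a * x \<in> I"
  by (simp add: is_ideal_def)

lemma ideal_mult_right: "is_ideal I \<Longrightarrow> x \<in> I \<Longrightarrow> x * a \<in> I"
  by (metis ideal_mult mult.commute)

lemma ideal_uminus: "is_ideal I \<Longrightarrow> x \<in> I \<Longrightarrow> - x \<in> I"
  using ideal_mult[of I x "-1"] by simp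

lemma ideal_diff: "is_ideal I \<Longrightarrow> x \<in> I \<Longrightarrow> y \<in> I \<Longrightarrow> x - y \<in> I"
  using ideal_add[of I x "- y"] ideal_uminus[of I y] by simp

lemma ideal_sum: "is_ideal I \<Longrightarrow> (\<And>i. i \<in> S \<Longrightarrow> f i \<in> I) \<Longrightarrow> sum f S \<in> I"
  by (induction S rule: infinite_finite_induct) (auto simp: ideal_zero ideal_add)

lemma is_ideal_UNIV: "is_ideal UNIV"
  by (simp add: is_ideal_def)

lemma is_ideal_gen: "is_ideal (ideal_gen S)"
  by (auto simp: is_ideal_def ideal_gen_def)

lemma ideal_gen_superset: "S \<subseteq> ideal_gen S"
  by (auto simp: ideal_gen_def)

lemma ideal_gen_least: "is_ideal I \<Longrightarrow> S \<subseteq> I \<Longrightarrow> ideal_gen S \<subseteq> I"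
  by (auto simp: ideal_gen_def)

lemma ideal_gen_mono: "S \<subseteq> S' \<Longrightarrow> ideal_gen S \<subseteq> ideal_gen S'"
  by (meson ideal_gen_least ideal_gen_superset is_ideal_gen order_trans)

lemma is_ideal_prod: "is_ideal (ideal_prod I J)"
  by (simp add: ideal_prod_def is_ideal_gen)

lemma ideal_prodI: "a \<in> I \<Longrightarrow> b \<in> J \<Longrightarrow> a * b \<in> ideal_prod I J"
  unfolding ideal_prod_def using ideal_gen_superset by fastforce

lemma ideal_prod_least:
  "is_ideal K \<Longrightarrow> (\<And>a b. a \<in> I \<Longrightarrow> b \<in> J \<Longrightarrow> a * b \<in> K) \<Longrightarrow> ideal_prod I J \<subseteq> K"
  unfolding ideal_prod_def by (rule ideal_gen_least) auto

lemma ideal_prod_commute: "ideal_prod I J = ideal_prod J I"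
  by (metis ideal_prodI ideal_prod_least is_ideal_prod mult.commute subset_antisym)

lemma ideal_prod_mono: "I \<subseteq> I' \<Longrightarrow> J \<subseteq> J' \<Longrightarrow> ideal_prod I J \<subseteq> ideal_prod I' J'"
  by (rule ideal_prod_least[OF is_ideal_prod]) (auto intro: ideal_prodI)

lemma ideal_prod_subset_left: "is_ideal I \<Longrightarrow> ideal_prod I J \<subseteq> I"
  by (rule ideal_prod_least) (auto intro: ideal_mult_right)

lemma ideal_prod_subset_right: "is_ideal J \<Longrightarrow> ideal_prod I J \<subseteq> J"
  by (rule ideal_prod_least) (auto intro: ideal_mult)

lemma ideal_prod_UNIV: "is_ideal I \<Longrightarrow> ideal_prod I UNIV = I"
  using ideal_prodI[of _ I 1 UNIV] ideal_prod_subset_left[of I UNIV] by auto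

lemma is_ideal_vimage_mult: "is_ideal K \<Longrightarrow> is_ideal {x. x * y \<in> K}"
  by (auto simp: is_ideal_def distrib_right mult.assoc)

lemma ideal_prod_assoc: "ideal_prod (ideal_prod I J) K = ideal_prod I (ideal_prod J K)"
proof -
  have 1: "ideal_prod (ideal_prod I J) K \<subseteq> ideal_prod I (ideal_prod J K)" for I J K :: "'b::comm_ring_1 set"
  proof (rule ideal_prod_least[OF is_ideal_prod])
    fix a b assume a: "a \<in> ideal_prod I J" and b: "b \<in> K"
    have "ideal_prod I J \<subseteq> {x. x * b \<in> ideal_prod I (ideal_prod J K)}"
      by (rule ideal_prod_least[OF is_ideal_vimage_mult[OF is_ideal_prod]])
         (use b in \<open>auto simp: mult.assoc intro!: ideal_prodI\<close>)
    with a show "a * b \<in> ideal_prod I (ideal_prod J K)" by auto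
  qed
  show ?thesis
    using 1[of I J K] 1[of K J I] by (simp add: ideal_prod_commute subset_antisym)
qed

definition comax :: "'b::comm_ring_1 set \<Rightarrow> 'b set \<Rightarrow> bool" where
  "comax I J \<longleftrightarrow> (\<exists>a\<in>I. \<exists>b\<in>J. a + b = 1)"

lemma comax_commute: "comax I J \<longleftrightarrow> comax J I"
  unfolding comax_def by (metis add.commute)

lemma comax_iff_sum:
  assumes "is_ideal I" "is_ideal J"
  shows "{a + b | a b. a \<in> I \<and> b \<in> J} = UNIV \<longleftrightarrow> comax I J"
proof
  assume "{a + b | a b. a \<in> I \<and> b \<in> J} = UNIV"
  then have "1 \<in> {a + b | a b. a \<in> I \<and> b \<in> J}" by simp
  then show "comax I J" unfolding comax_def by force
next
  assume "comax I J"
  then obtain a b where ab: "a \<in> I" "b \<in> J" "a + b = 1" unfolding comax_def by auto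
  have "x \<in> {a + b | a b. a \<in> I \<and> b \<in> J}" for x
  proof -
    have "x = x * a + x * b" using ab by (metis distrib_left mult.right_neutral)
    with ab assms ideal_mult show ?thesis by blast
  qed
  then show "{a + b | a b. a \<in> I \<and> b \<in> J} = UNIV" by auto
qed

lemma comax_prod:
  assumes "is_ideal I" "comax I J" "comax I K"
  shows "comax I (ideal_prod J K)"
proof -
  obtain a b where ab: "a \<in> I" "b \<in> J" "a + b = 1" using assms unfolding comax_def by auto
  obtain c d where cd: "c \<in> I" "d \<in> K" "c + d = 1" using assms unfolding comax_def by auto
  have "1 = (a + b) * (c + d)" by (simp add: ab cd)
  also have "\<dots> = (a * c + a * d + b * c) + b * d" by (simp add: algebra_simps)
  finally have "(a * c + a * d + b * c) + b * d = 1" ..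
  moreover have "a * c + a * d + b * c \<in> I"
    using ab cd assms by (intro ideal_add) (auto intro: ideal_mult ideal_mult_right)
  ultimately show ?thesis unfolding comax_def using ideal_prodI[OF ab(2) cd(2)] by blast
qed

lemma comax_squares:
  assumes "is_ideal I" "is_ideal J" "comax I J"
  shows "comax (ideal_prod I I) (ideal_prod J J)"
  using assms by (meson comax_commute comax_prod is_ideal_prod)

lemma inter_subset_prod:
  assumes "is_ideal I" "is_ideal J" "comax I J" "x \<in> I" "x \<in> J"
  shows "x \<in> ideal_prod I J"
proof -
  obtain a b where ab: "a \<in> I" "b \<in> J" "a + b = 1" using assms unfolding comax_def by auto
  have "x = a * x + x * b" using ab by (metis distrib_left mult.commute mult.right_neutral)
  then show ?thesis
    using ab assms by (metis ideal_add ideal_prodI is_ideal_prod)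
qed

lemma prod_square_square:
  assumes x: "x \<in> ideal_prod I I" and y: "y \<in> ideal_prod J J"
  shows "x * y \<in> ideal_prod (ideal_prod I J) (ideal_prod I J)"
proof -
  let ?K = "ideal_prod (ideal_prod I J) (ideal_prod I J)"
  have 1: "a * b * y \<in> ?K" if "a \<in> I" "b \<in> I" for a b
  proof -
    have "ideal_prod J J \<subseteq> {z. z * (a * b) \<in> ?K}"
    proof (rule ideal_prod_least[OF is_ideal_vimage_mult[OF is_ideal_prod]])
      fix c d assume "c \<in> J" "d \<in> J"
      then have "(a * c) * (b * d) \<in> ?K" using that by (auto intro!: ideal_prodI)
      then show "c * d \<in> {z. z * (a * b) \<in> ?K}" by (simp add: ac_simps)
    qed
    with y show ?thesis by (auto simp: ac_simps)
  qed
  have "ideal_prod I I \<subseteq> {z. z * y \<in> ?K}"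
    by (rule ideal_prod_least[OF is_ideal_vimage_mult[OF is_ideal_prod]]) (use 1 in auto)
  with x show ?thesis by auto
qed

text \<open>Writing \<open>1 = a + b\<close> with \<open>a\<close> in the square of \<open>I\<close>
  and \<open>b\<close> in the square of \<open>J\<close> gives \<open>x = a * x + x * b\<close>.
  This is the uniqueness half of the Chinese remainder theorem for orientations: congruence modulo
  the square of the product is tested on the two factors.\<close>

lemma inter_squares:
  assumes "is_ideal I" "is_ideal J" "comax I J" "x \<in> ideal_prod I I" "x \<in> ideal_prod J J"
  shows "x \<in> ideal_prod (ideal_prod I J) (ideal_prod I J)"
proof -
  obtain a b where ab: "a \<in> ideal_prod I I" "b \<in> ideal_prod J J" "a + b = 1"
    using comax_squares[OF assms(1-3)] unfolding comax_def by auto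
  have "x = a * x + x * b" using ab by (metis distrib_left mult.commute mult.right_neutral)
  then show ?thesis
    using ab assms by (metis ideal_add prod_square_square is_ideal_prod)
qed

section \<open>Primes over an ideal of a Noetherian ring\<close>

lemma prime_ideal_is_ideal: "prime_ideal p \<Longrightarrow> is_ideal p"
  by (simp add: prime_ideal_def)

lemma prime_ideal_one: "prime_ideal p \<Longrightarrow> 1 \<notin> p"
  by (simp add: prime_ideal_def)

lemma prime_ideal_mult_iff: "prime_ideal p \<Longrightarrow> a * b \<in> p \<longleftrightarrow> a \<in> p \<or> b \<in> p"
  by (auto simp: prime_ideal_def intro: ideal_mult ideal_mult_right)

lemma prime_ideal_power_iff: "prime_ideal p \<Longrightarrow> a ^ k \<in> p \<longleftrightarrow> k > 0 \<and> a \<in> p"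
  by (induction k) (auto simp: prime_ideal_mult_iff prime_ideal_one)

lemma prime_ideal_prod_iff:
  "finite S \<Longrightarrow> prime_ideal p \<Longrightarrow> prod f S \<in> p \<longleftrightarrow> (\<exists>i\<in>S. f i \<in> p)"
  by (induction S rule: finite_induct) (auto simp: prime_ideal_mult_iff prime_ideal_one)

lemma prime_ideal_prod_subset:
  assumes "prime_ideal p" "ideal_prod I J \<subseteq> p"
  shows "I \<subseteq> p \<or> J \<subseteq> p"
proof (rule ccontr)
  assume "\<not> ?thesis"
  then obtain a b where "a \<in> I" "b \<in> J" "a \<notin> p" "b \<notin> p" by blast
  then show False using assms ideal_prodI prime_ideal_mult_iff by blast
qed

definition adjoin :: "'b::comm_ring_1 set \<Rightarrow> 'b \<Rightarrow> 'b set" where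
  "adjoin J a = {j + x * a | j x. j \<in> J}"

lemma is_ideal_adjoin: assumes "is_ideal J" shows "is_ideal (adjoin J a)"
  unfolding is_ideal_def
proof (intro conjI allI ballI)
  show "0 \<in> adjoin J a"
    using ideal_zero[OF assms] by (auto simp: adjoin_def intro!: exI[of _ 0])
next
  fix x y assume "x \<in> adjoin J a" "y \<in> adjoin J a"
  then obtain j x' k y' where "x = j + x' * a" "y = k + y' * a" "j \<in> J" "k \<in> J"
    by (auto simp: adjoin_def)
  then have "x + y = (j + k) + (x' + y') * a" "j + k \<in> J"
    using assms by (auto simp: algebra_simps ideal_add)
  then show "x + y \<in> adjoin J a" unfolding adjoin_def by blast
next
  fix c x assume "x \<in> adjoin J a"
  then obtain j x' where "x = j + x' * a" "j \<in> J" by (auto simp: adjoin_def)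
  then have "c * x = c * j + (c * x') * a" "c * j \<in> J"
    using assms by (auto simp: algebra_simps ideal_mult)
  then show "c * x \<in> adjoin J a" unfolding adjoin_def by blast
qed

lemma adjoin_superset: "J \<subseteq> adjoin J a"
  by (force simp: adjoin_def intro: exI[of _ 0])

lemma adjoin_mem: "is_ideal J \<Longrightarrow> a \<in> adjoin J a"
  unfolding adjoin_def using ideal_zero[of J] by (force intro: exI[of _ 0] exI[of _ 1])

lemma adjoin_least: "is_ideal K \<Longrightarrow> J \<subseteq> K \<Longrightarrow> a \<in> K \<Longrightarrow> adjoin J a \<subseteq> K"
  by (auto simp: adjoin_def intro!: ideal_add ideal_mult)

lemma adjoin_psubset: "is_ideal J \<Longrightarrow> a \<notin> J \<Longrightarrow> J \<subset> adjoin J a"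
  using adjoin_superset adjoin_mem by blast

lemma chain_Union_ideal:
  fixes f :: "nat \<Rightarrow> 'b::comm_ring_1 set"
  assumes "\<And>i. is_ideal (f i)" and "\<And>i. f i \<subseteq> f (Suc i)"
  shows "is_ideal (\<Union>i. f i)"
  unfolding is_ideal_def
proof (intro conjI allI ballI)
  show "0 \<in> (\<Union>i. f i)" using assms(1) ideal_zero by auto
next
  fix x y assume "x \<in> (\<Union>i. f i)" "y \<in> (\<Union>i. f i)"
  then obtain i j where "x \<in> f i" "y \<in> f j" by auto
  moreover have "f i \<subseteq> f (max i j)" "f j \<subseteq> f (max i j)"
    by (simp_all add: lift_Suc_mono_le[of f, OF assms(2)])
  ultimately have "x + y \<in> f (max i j)" by (intro ideal_add assms(1)) auto
  then show "x + y \<in> (\<Union>i. f i)" by blast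
next
  fix c x assume "x \<in> (\<Union>i. f i)"
  then show "c * x \<in> (\<Union>i. f i)" using ideal_mult[OF assms(1)] by auto
qed

lemma noetherian_chain_stable:
  fixes f :: "nat \<Rightarrow> 'b::comm_ring_1 set"
  assumes "noetherian TYPE('b)" "\<And>i. is_ideal (f i)" and mono: "\<And>i. f i \<subseteq> f (Suc i)"
  shows "\<exists>N. (\<Union>i. f i) = f N"
proof -
  have "is_ideal (\<Union>i. f i)" using assms(2,3) by (rule chain_Union_ideal)
  then obtain F where F: "finite F" "(\<Union>i. f i) = ideal_gen F"
    using assms(1) unfolding noetherian_def by meson
  have "F \<subseteq> (\<Union>i. f i)" using F ideal_gen_superset by blast
  with F(1) have "\<exists>N. F \<subseteq> f N"
  proof (induction F rule: finite_induct)
    case (insert x F)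
    then obtain N i where "F \<subseteq> f N" "x \<in> f i" by auto
    moreover have "f i \<subseteq> f (max i N)" "f N \<subseteq> f (max i N)"
      by (simp_all add: lift_Suc_mono_le[of f, OF mono])
    ultimately show ?case by blast
  qed auto
  then obtain N where "F \<subseteq> f N" ..
  then have "(\<Union>i. f i) \<subseteq> f N" unfolding F(2) by (rule ideal_gen_least[OF assms(2)])
  then show ?thesis by blast
qed

text \<open>The ascending chain condition makes reverse inclusion well-founded. Induction from
  larger to smaller ideals then produces primes without Zorn's lemma.\<close>

lemma noetherian_induct [consumes 2, case_names step]:
  fixes J :: "'b::comm_ring_1 set"
  assumes N: "noetherian TYPE('b)" and J: "is_ideal J"
    and step: "\<And>J. is_ideal J \<Longrightarrow> (\<And>J'. is_ideal J' \<Longrightarrow> J \<subset> J' \<Longrightarrow> P J') \<Longrightarrow> P J"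
  shows "P J"
proof -
  let ?r = "{(I', I). is_ideal I \<and> is_ideal I' \<and> I \<subset> (I' :: 'b set)}"
  have "wf ?r"
    unfolding wf_iff_no_infinite_down_chain
  proof
    assume "\<exists>f. \<forall>i. (f (Suc i), f i) \<in> ?r"
    then obtain f where "\<forall>i. (f (Suc i), f i) \<in> ?r" by blast
    then have f: "\<And>i. is_ideal (f i)" "\<And>i. f i \<subset> f (Suc i)" by simp_all
    then obtain n where "(\<Union>i. f i) = f n"
      using noetherian_chain_stable[OF N, of f] by blast
    then show False using f(2)[of n] by blast
  qed
  then show ?thesis using J
    by (induction J rule: wf_induct_rule) (use step in auto)
qed

lemma not_prime_split:
  assumes "is_ideal J" "1 \<notin> J" "\<not> prime_ideal J"
  obtains a b where "a * b \<in> J" "a \<notin> J" "b \<notin> J"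
  using assms unfolding prime_ideal_def by blast

text \<open>If \<open>a * b \<in> J\<close>, the product of \<open>J + Aa\<close> and
  \<open>J + Ab\<close> lies in \<open>J\<close>. So they are not both the unit ideal, and a proper
  one is handled by induction.\<close>

lemma prime_ideal_above:
  fixes J :: "'b::comm_ring_1 set"
  assumes "noetherian TYPE('b)" "is_ideal J" "1 \<notin> J"
  shows "\<exists>p. prime_ideal p \<and> J \<subseteq> p"
  using assms
proof (induction J rule: noetherian_induct)
  case (step J)
  show ?case
  proof (cases "prime_ideal J")
    case False
    then obtain a b where ab: "a * b \<in> J" "a \<notin> J" "b \<notin> J" using step not_prime_split by blast
    have "1 \<notin> adjoin J a \<or> 1 \<notin> adjoin J b"
    proof (rule ccontr)
      assume "\<not> ?thesis"
      then obtain j x k y where *: "1 = j + x * a" "1 = k + y * b" "j \<in> J" "k \<in> J"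
        by (auto simp: adjoin_def)
      have "1 = (j + x * a) * (k + y * b)" using * by simp
      also have "\<dots> = j * (k + y * b) + (x * a) * k + (x * y) * (a * b)" by (simp add: algebra_simps)
      also have "\<dots> \<in> J"
        using * ab step(1) by (intro ideal_add) (auto intro: ideal_mult ideal_mult_right)
      finally show False using step by simp
    qed
    then show ?thesis
      using step.IH[OF is_ideal_adjoin adjoin_psubset, OF step(1) step(1)] step(1) ab adjoin_superset
      by (metis order_trans)
  qed auto
qed

lemma comax_if_no_prime:
  fixes I J :: "'b::comm_ring_1 set"
  assumes "noetherian TYPE('b)" "is_ideal I" "is_ideal J"
    and "\<And>p. prime_ideal p \<Longrightarrow> I \<subseteq> p \<Longrightarrow> J \<subseteq> p \<Longrightarrow> False"
  shows "comax I J"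
proof (rule ccontr)
  assume not: "\<not> comax I J"
  let ?K = "{a + b | a b. a \<in> I \<and> b \<in> J}"
  have "is_ideal ?K"
    unfolding is_ideal_def
  proof (intro conjI allI ballI)
    have "0 + 0 \<in> ?K" using assms ideal_zero by blast
    then show "0 \<in> ?K" by simp
  next
    fix x y assume "x \<in> ?K" "y \<in> ?K"
    then obtain a b c d where "x = a + b" "y = c + d" "a \<in> I" "c \<in> I" "b \<in> J" "d \<in> J" by auto
    then have "x + y = (a + c) + (b + d)" "a + c \<in> I" "b + d \<in> J"
      using assms by (auto simp: algebra_simps ideal_add)
    then show "x + y \<in> ?K" by blast
  next
    fix c x assume "x \<in> ?K"
    then obtain a b where "x = a + b" "a \<in> I" "b \<in> J" by auto
    then have "c * x = c * a + c * b" "c * a \<in> I" "c * b \<in> J"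
      using assms by (auto simp: distrib_left ideal_mult)
    then show "c * x \<in> ?K" by blast
  qed
  moreover have "1 \<notin> ?K" using not unfolding comax_def by auto
  ultimately obtain p where "prime_ideal p" "?K \<subseteq> p" using prime_ideal_above assms by blast
  moreover have "I \<subseteq> ?K" "J \<subseteq> ?K"
    using assms(2,3)[THEN ideal_zero] by force+
  ultimately show False using assms(4)[of p] by blast
qed

text \<open>If \<open>a * b \<in> J\<close>, a prime over \<open>J\<close> contains
  \<open>J + Aa\<close> or \<open>J + Ab\<close>, so the families of these two larger ideals
  together serve \<open>J\<close>. The family stands in for the set of minimal primes but may be
  larger.\<close>

lemma finite_primes_below:
  fixes J :: "'b::comm_ring_1 set"
  assumes "noetherian TYPE('b)" "is_ideal J"
  shows "\<exists>PP. finite PP \<and> (\<forall>p\<in>PP. prime_ideal p \<and> J \<subseteq> p) \<and>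
              (\<forall>p. prime_ideal p \<and> J \<subseteq> p \<longrightarrow> (\<exists>q\<in>PP. q \<subseteq> p))"
  using assms
proof (induction J rule: noetherian_induct)
  case (step J)
  consider "prime_ideal J" | "1 \<in> J" | "\<not> prime_ideal J" "1 \<notin> J" by blast
  then show ?case
  proof cases
    case 1
    then show ?thesis by (intro exI[of _ "{J}"]) auto
  next
    case 2
    then have "\<not> (prime_ideal p \<and> J \<subseteq> p)" for p using prime_ideal_one by blast
    then show ?thesis by (intro exI[of _ "{}"]) simp
  next
    case 3
    then obtain a b where ab: "a * b \<in> J" "a \<notin> J" "b \<notin> J" using not_prime_split[OF step(1) 3(2,1)] by metis
    have IH: "\<exists>PP. finite PP \<and> (\<forall>p\<in>PP. prime_ideal p \<and> adjoin J c \<subseteq> p) \<and>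
              (\<forall>p. prime_ideal p \<and> adjoin J c \<subseteq> p \<longrightarrow> (\<exists>q\<in>PP. q \<subseteq> p))" if "c \<notin> J" for c
      by (rule step.IH[OF is_ideal_adjoin[OF step(1)] adjoin_psubset[OF step(1) that]])
    obtain PA where PA: "finite PA" "\<forall>p\<in>PA. prime_ideal p \<and> adjoin J a \<subseteq> p"
      "\<forall>p. prime_ideal p \<and> adjoin J a \<subseteq> p \<longrightarrow> (\<exists>q\<in>PA. q \<subseteq> p)"
      using IH[OF ab(2)] by auto
    obtain PB where PB: "finite PB" "\<forall>p\<in>PB. prime_ideal p \<and> adjoin J b \<subseteq> p"
      "\<forall>p. prime_ideal p \<and> adjoin J b \<subseteq> p \<longrightarrow> (\<exists>q\<in>PB. q \<subseteq> p)"
      using IH[OF ab(3)] by auto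
    have "\<exists>q\<in>PA \<union> PB. q \<subseteq> p" if p: "prime_ideal p" "J \<subseteq> p" for p
    proof -
      have "a \<in> p \<or> b \<in> p" using p ab prime_ideal_mult_iff by blast
      then have "adjoin J a \<subseteq> p \<or> adjoin J b \<subseteq> p"
        using adjoin_least[OF prime_ideal_is_ideal[OF p(1)] p(2)] by blast
      then have "(\<exists>q\<in>PA. q \<subseteq> p) \<or> (\<exists>q\<in>PB. q \<subseteq> p)"
        using PA(3)[rule_format, of p] PB(3)[rule_format, of p] p(1) by argo
      then show ?thesis by (simp add: bex_Un)
    qed
    moreover have "\<forall>p\<in>PA \<union> PB. prime_ideal p \<and> J \<subseteq> p"
      using PA(2) PB(2) adjoin_superset[of J a] adjoin_superset[of J b] by (meson UnE order_trans)
    ultimately show ?thesis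
      using PA(1) PB(1) by (intro exI[of _ "PA \<union> PB"]) simp
  qed
qed

section \<open>The Hilbert basis theorem\<close>

lemma is_ideal_lead:
  assumes "is_ideal (I :: 'b::comm_ring_1 poly set)"
  shows "is_ideal {coeff f n | f. f \<in> I \<and> degree f \<le> n}"
  unfolding is_ideal_def
proof (intro conjI allI ballI)
  show "0 \<in> {coeff f n | f. f \<in> I \<and> degree f \<le> n}"
    using ideal_zero[OF assms] by (auto intro!: exI[of _ 0])
next
  fix x y assume "x \<in> {coeff f n | f. f \<in> I \<and> degree f \<le> n}" "y \<in> {coeff f n | f. f \<in> I \<and> degree f \<le> n}"
  then obtain f g where "x = coeff f n" "y = coeff g n" "f \<in> I" "g \<in> I" "degree f \<le> n" "degree g \<le> n"
    by auto
  then show "x + y \<in> {coeff f n | f. f \<in> I \<and> degree f \<le> n}"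
    using assms by (auto intro!: exI[of _ "f + g"] simp: ideal_add degree_add_le)
next
  fix c x assume "x \<in> {coeff f n | f. f \<in> I \<and> degree f \<le> n}"
  then obtain f where "x = coeff f n" "f \<in> I" "degree f \<le> n" by auto
  then show "c * x \<in> {coeff f n | f. f \<in> I \<and> degree f \<le> n}"
    using ideal_mult[OF assms, of f "[:c:]"]
    by (auto intro!: exI[of _ "smult c f"] intro: order_trans[OF degree_smult_le])
qed

text \<open>An ideal inside \<open>I\<close> with the same leading coefficients in every degree
  equals \<open>I\<close>. The ideals \<open>L I n\<close> increase with \<open>n\<close> and are
  constant from some \<open>M\<close> on, so finitely many polynomials for the degrees up to
  \<open>M\<close> suffice.\<close>

lemma hilbert_basis:
  assumes N: "noetherian TYPE('b::comm_ring_1)"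
  shows "noetherian TYPE('b poly)"
  unfolding noetherian_def
proof (intro allI impI)
  fix I :: "'b poly set" assume I: "is_ideal I"
  define L where "L I n = {coeff f n | f. f \<in> I \<and> degree f \<le> n}" for I :: "'b poly set" and n
  have shift: "L I n \<subseteq> L I (n + k)" if "is_ideal I" for I n k
  proof
    fix x assume "x \<in> L I n"
    then obtain f where f: "x = coeff f n" "f \<in> I" "degree f \<le> n" unfolding L_def by auto
    have "degree (monom 1 k * f) \<le> n + k"
      using degree_mult_le[of "monom (1::'b) k" f] degree_monom_le[of "1::'b" k] f by linarith
    moreover have "coeff (monom 1 k * f) (n + k) = x" using f by (simp add: coeff_monom_mult)
    moreover have "monom 1 k * f \<in> I" using that f ideal_mult by blast
    ultimately show "x \<in> L I (n + k)" unfolding L_def by blast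
  qed
  have Lid: "is_ideal (L I n)" if "is_ideal I" for I n unfolding L_def using is_ideal_lead[OF that] .
  obtain M where M: "(\<Union>n. L I n) = L I M"
    using noetherian_chain_stable[OF N, of "L I"] Lid[OF I] shift[OF I, of _ 1] by auto
  have "\<exists>G. finite G \<and> G \<subseteq> {f \<in> I. degree f \<le> n} \<and> L I n = ideal_gen ((\<lambda>f. coeff f n) ` G)" for n
  proof -
    obtain F where F: "finite F" "L I n = ideal_gen F"
      using N Lid[OF I] unfolding noetherian_def by blast
    then have "F \<subseteq> (\<lambda>f. coeff f n) ` {f \<in> I. degree f \<le> n}"
      using ideal_gen_superset unfolding L_def by blast
    from finite_subset_image[OF F(1) this] show ?thesis using F(2) by auto
  qed
  then obtain G where G: "\<And>n. finite (G n)" "\<And>n. G n \<subseteq> {f \<in> I. degree f \<le> n}"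
    "\<And>n. L I n = ideal_gen ((\<lambda>f. coeff f n) ` G n)" by metis
  define GG where "GG = (\<Union>n\<le>M. G n)"
  have GI: "ideal_gen GG \<subseteq> I"
    by (rule ideal_gen_least[OF I]) (use G(2) in \<open>auto simp: GG_def\<close>)
  have small: "L I n \<subseteq> L (ideal_gen GG) n" if "n \<le> M" for n
    unfolding G(3)
  proof (rule ideal_gen_least[OF Lid[OF is_ideal_gen]], rule image_subsetI)
    fix g assume "g \<in> G n"
    then show "coeff g n \<in> L (ideal_gen GG) n"
      using ideal_gen_superset[of GG] G(2)[of n] that unfolding L_def GG_def by blast
  qed
  have all: "L I n \<subseteq> L (ideal_gen GG) n" for n
  proof (cases "n \<le> M")
    case False
    have "L I n \<subseteq> L I M" using M by blast
    also have "\<dots> \<subseteq> L (ideal_gen GG) M" using small by simp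
    also have "\<dots> \<subseteq> L (ideal_gen GG) (M + (n - M))" by (rule shift[OF is_ideal_gen])
    finally show ?thesis using False by simp
  qed (rule small)
  have "f \<in> ideal_gen GG" if "f \<in> I" for f
    using that
  proof (induction "degree f" arbitrary: f rule: less_induct)
    case less
    have "coeff f (degree f) \<in> L I (degree f)" unfolding L_def using less by blast
    then obtain g where g: "coeff f (degree f) = coeff g (degree f)" "g \<in> ideal_gen GG" "degree g \<le> degree f"
      using all unfolding L_def by blast
    show ?case
    proof (cases "f - g = 0")
      case False
      have "degree (f - g) \<le> degree f" using g(3) by (simp add: degree_diff_le)
      moreover have "coeff (f - g) (degree f) = 0" using g by simp
      ultimately have "degree (f - g) < degree f \<or> degree f = 0"
        using False by (metis le_neq_implies_less leading_coeff_0_iff)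
      moreover have "degree f \<noteq> 0"
      proof
        assume 0: "degree f = 0"
        then have "degree (f - g) = 0" using \<open>degree (f - g) \<le> degree f\<close> by simp
        then have "coeff (f - g) (degree (f - g)) = 0" using \<open>coeff (f - g) (degree f) = 0\<close> 0 by simp
        then show False using False by (simp only: leading_coeff_0_iff)
      qed
      ultimately have "f - g \<in> ideal_gen GG"
        using less GI g I by (meson ideal_diff subsetD)
      then have "(f - g) + g \<in> ideal_gen GG" using g is_ideal_gen ideal_add by blast
      then show ?thesis by simp
    qed (use g in simp)
  qed
  then have "I = ideal_gen GG" using GI by blast
  moreover have "finite GG" unfolding GG_def using G(1) by simp
  ultimately show "\<exists>F. finite F \<and> I = ideal_gen F" by blast
qed

section \<open>General position and dimension functions\<close>

text \<open>Induction removes a minimal member \<open>p\<close> of \<open>E\<close>. No other member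
  lies inside \<open>p\<close>, so some \<open>w\<close> lies in all the others but not in
  \<open>p\<close>, and replacing \<open>c\<close> by \<open>c + w\<close> repairs \<open>p\<close>
  without disturbing them.\<close>

lemma generic_avoid:
  fixes E :: "'b::comm_ring_1 set set"
  assumes "finite E" "\<And>p. p \<in> E \<Longrightarrow> prime_ideal p \<and> a \<notin> p"
  shows "\<exists>c. \<forall>p\<in>E. y + a * c \<notin> p"
  using assms
proof (induction "card E" arbitrary: E rule: less_induct)
  case less
  show ?case
  proof (cases "E = {}")
    case False
    obtain p where p: "p \<in> E" "\<And>q. q \<in> E \<Longrightarrow> q \<subseteq> p \<Longrightarrow> q = p"
      using finite_has_minimal[OF less.prems(1) False] by metis
    let ?E = "E - {p}"
    have "card ?E < card E" using p less.prems(1) by (meson card_Diff1_less)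
    then obtain c where c: "\<forall>q\<in>?E. y + a * c \<notin> q"
      using less.hyps[of ?E] less.prems by auto
    show ?thesis
    proof (cases "y + a * c \<in> p")
      case True
      have "\<exists>z. z \<in> q \<and> z \<notin> p" if "q \<in> ?E" for q
        using p(2)[of q] that by auto
      then obtain z where z: "\<And>q. q \<in> ?E \<Longrightarrow> z q \<in> q \<and> z q \<notin> p" by metis
      define w where "w = prod z ?E"
      have fin: "finite ?E" using less.prems by simp
      have wp: "w \<notin> p"
        using less.prems(2)[OF p(1)] z fin unfolding w_def by (simp add: prime_ideal_prod_iff)
      have wq: "w \<in> q" if "q \<in> ?E" for q
      proof -
        have "prime_ideal q" using less.prems(2) that by simp
        then have "w \<in> q \<longleftrightarrow> (\<exists>i\<in>?E. z i \<in> q)"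
          unfolding w_def by (rule prime_ideal_prod_iff[OF fin])
        then show ?thesis using z[OF that] that by auto
      qed
      have "y + a * (c + w) \<notin> q" if "q \<in> E" for q
      proof (cases "q = p")
        case q: True
        have pp: "prime_ideal p" "is_ideal p" "a \<notin> p"
          using less.prems(2)[OF p(1)] prime_ideal_is_ideal by auto
        show ?thesis
        proof
          assume "y + a * (c + w) \<in> q"
          then have "(y + a * (c + w)) - (y + a * c) \<in> p" using True q pp ideal_diff by blast
          then have "a * w \<in> p" by (simp add: algebra_simps)
          then show False using pp wp prime_ideal_mult_iff by blast
        qed
      next
        case q: False
        then have q': "q \<in> ?E" using that by simp
        then have I: "is_ideal q" using less.prems(2)[OF that] prime_ideal_is_ideal by auto
        show ?thesis
        proof
          assume "y + a * (c + w) \<in> q"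
          moreover have "a * w \<in> q" using wq[OF q'] I ideal_mult by blast
          ultimately have "(y + a * (c + w)) - a * w \<in> q" using I ideal_diff by blast
          then show False using c q' by (simp add: algebra_simps)
        qed
      qed
      then show ?thesis by blast
    next
      case False
      then have "\<forall>q\<in>E. y + a * c \<notin> q" using c by auto
      then show ?thesis ..
    qed
  qed auto
qed

text \<open>One step of general position in abstract form: where the bound \<open>R i\<close> holds
  on the primes over \<open>J\<close> away from \<open>a\<close>, the better bound
  \<open>R (Suc i)\<close> fails only finitely often, which is what prime avoidance can cope
  with.\<close>

definition fin_exc :: "(nat \<Rightarrow> 'b::comm_ring_1 set \<Rightarrow> bool) \<Rightarrow> bool" where
  "fin_exc R \<longleftrightarrow> (\<forall>i J a. is_ideal J \<and> (\<forall>p. prime_ideal p \<and> J \<subseteq> p \<and> a \<notin> p \<longrightarrow> R i p) \<longrightarrow>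
     finite {p. prime_ideal p \<and> J \<subseteq> p \<and> a \<notin> p \<and> \<not> R (Suc i) p})"

text \<open>Finitely many primes over the first \<open>i\<close> entries violate
  \<open>R (Suc i)\<close>, and the next coefficient is chosen so that entry \<open>i\<close> avoids
  them all.\<close>

lemma generic_sequence:
  fixes R :: "nat \<Rightarrow> 'b::comm_ring_1 set \<Rightarrow> bool"
  assumes R: "fin_exc R" and R0: "\<And>p. prime_ideal p \<Longrightarrow> a \<notin> p \<Longrightarrow> R 0 p"
  shows "\<exists>c. \<forall>p. prime_ideal p \<and> a \<notin> p \<and> (\<forall>j<i. y j + a * c j \<in> p) \<longrightarrow> R i p"
proof (induction i)
  case 0
  then show ?case using R0 by auto
next
  case (Suc i)
  then obtain c where c: "\<And>p. prime_ideal p \<Longrightarrow> a \<notin> p \<Longrightarrow> (\<forall>j<i. y j + a * c j \<in> p) \<Longrightarrow> R i p"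
    by blast
  define J where "J = ideal_gen ((\<lambda>j. y j + a * c j) ` {..<i})"
  have J: "J \<subseteq> p \<longleftrightarrow> (\<forall>j<i. y j + a * c j \<in> p)" if "is_ideal p" for p
  proof
    assume "J \<subseteq> p"
    then show "\<forall>j<i. y j + a * c j \<in> p"
      using ideal_gen_superset[of "(\<lambda>j. y j + a * c j) ` {..<i}"] unfolding J_def by auto
  next
    assume "\<forall>j<i. y j + a * c j \<in> p"
    then show "J \<subseteq> p" unfolding J_def by (intro ideal_gen_least[OF that]) auto
  qed
  let ?E = "{p. prime_ideal p \<and> J \<subseteq> p \<and> a \<notin> p \<and> \<not> R (Suc i) p}"
  have "is_ideal J" unfolding J_def by (rule is_ideal_gen)
  moreover have "\<forall>p. prime_ideal p \<and> J \<subseteq> p \<and> a \<notin> p \<longrightarrow> R i p"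
    using c J prime_ideal_is_ideal by metis
  ultimately have fin: "finite ?E" using R[unfolded fin_exc_def] by simp
  have "\<exists>d. \<forall>p\<in>?E. y i + a * d \<notin> p" by (rule generic_avoid[OF fin]) simp
  then obtain d where d: "\<forall>p\<in>?E. y i + a * d \<notin> p" ..
  show ?case
  proof (intro exI[of _ "c(i := d)"] allI impI, elim conjE)
    fix p assume p: "prime_ideal p" "a \<notin> p" "\<forall>j<Suc i. y j + a * (c(i := d)) j \<in> p"
    then have "y i + a * d \<in> p" by auto
    moreover have "\<forall>j<i. y j + a * c j \<in> p"
    proof (intro allI impI)
      fix j assume "j < i"
      then show "y j + a * c j \<in> p" using p(3)[rule_format, of j] by simp
    qed
    then have "J \<subseteq> p" using J p prime_ideal_is_ideal by metis
    ultimately show "R (Suc i) p" using d p(1,2) by (metis (mono_tags, lifting) mem_Collect_eq)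
  qed
qed

text \<open>Lets a single general choice control height and comaximality together.\<close>

lemma fin_exc_conj:
  assumes "fin_exc R" "fin_exc S"
  shows "fin_exc (\<lambda>i p. R i p \<and> S i p)"
  unfolding fin_exc_def
proof (intro allI impI, elim conjE)
  fix i J a
  assume *: "is_ideal J" "\<forall>p. prime_ideal p \<and> J \<subseteq> p \<and> a \<notin> p \<longrightarrow> R i p \<and> S i p"
  let ?E = "\<lambda>R. {p. prime_ideal p \<and> J \<subseteq> p \<and> a \<notin> p \<and> \<not> R (Suc i) p}"
  have "finite (?E R)" "finite (?E S)"
    using assms * unfolding fin_exc_def by meson+
  moreover have "?E (\<lambda>i p. R i p \<and> S i p) = ?E R \<union> ?E S" by auto
  ultimately show "finite (?E (\<lambda>i p. R i p \<and> S i p))" by simp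
qed

section \<open>Heights and chains above a prime\<close>

definition chain_height_ge :: "nat \<Rightarrow> 'b::comm_ring_1 set \<Rightarrow> bool" where
  "chain_height_ge i p \<longleftrightarrow> (\<exists>c. prime_chain c \<and> last c = p \<and> length c = i + 1)"

lemma chain_height_ge_0: "prime_ideal p \<Longrightarrow> chain_height_ge 0 p"
  unfolding chain_height_ge_def prime_chain_def by (intro exI[of _ "[p]"]) simp

lemma sorted_psubset_last:
  "sorted_wrt (\<subset>) c \<Longrightarrow> q \<in> set c \<Longrightarrow> q \<subseteq> last c"
  by (induction c) auto

lemma chain_height_ge_Suc:
  assumes "chain_height_ge i p" "prime_ideal q" "p \<subset> q"
  shows "chain_height_ge (Suc i) q"
proof -
  obtain c where c: "prime_chain c" "last c = p" "length c = i + 1"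
    using assms(1) unfolding chain_height_ge_def by auto
  then have "prime_chain (c @ [q])"
    using assms sorted_psubset_last[of c] unfolding prime_chain_def
    by (auto simp: sorted_wrt_append)
  then show ?thesis
    unfolding chain_height_ge_def using c by (intro exI[of _ "c @ [q]"]) simp
qed

text \<open>A prime over \<open>J\<close> outside the family of \<open>finite_primes_below\<close>
  lies strictly above a member of it, where the bound \<open>i\<close> already holds; extending the
  chain by one gives \<open>Suc i\<close>.\<close>

lemma fin_exc_height:
  assumes "noetherian TYPE('b::comm_ring_1)"
  shows "fin_exc (chain_height_ge :: nat \<Rightarrow> 'b set \<Rightarrow> bool)"
  unfolding fin_exc_def
proof (intro allI impI, elim conjE)
  fix i a and J :: "'b set"
  assume J: "is_ideal J" and *: "\<forall>p. prime_ideal p \<and> J \<subseteq> p \<and> a \<notin> p \<longrightarrow> chain_height_ge i p"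
  obtain PP where PP: "finite PP" "\<And>p. p \<in> PP \<Longrightarrow> prime_ideal p \<and> J \<subseteq> p"
    "\<And>p. prime_ideal p \<Longrightarrow> J \<subseteq> p \<Longrightarrow> \<exists>q\<in>PP. q \<subseteq> p"
    using finite_primes_below[OF assms J] by metis
  have "{p. prime_ideal p \<and> J \<subseteq> p \<and> a \<notin> p \<and> \<not> chain_height_ge (Suc i) p} \<subseteq> PP"
  proof (intro subsetI, elim CollectE conjE)
    fix p assume p: "prime_ideal p" "J \<subseteq> p" "a \<notin> p" "\<not> chain_height_ge (Suc i) p"
    obtain q where q: "q \<in> PP" "q \<subseteq> p" using PP(3)[OF p(1,2)] by auto
    then have "chain_height_ge i q" using PP(2)[OF q(1)] p(3) * by (metis subsetD)
    then have "q = p" using p q chain_height_ge_Suc by (metis psubsetI)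
    then show "p \<in> PP" using q by simp
  qed
  then show "finite {p. prime_ideal p \<and> J \<subseteq> p \<and> a \<notin> p \<and> \<not> chain_height_ge (Suc i) p}"
    using PP(1) finite_subset by blast
qed

definition chain_bound :: "'b::comm_ring_1 itself \<Rightarrow> nat \<Rightarrow> bool" where
  "chain_bound _ N \<longleftrightarrow> (\<forall>c::'b set list. prime_chain c \<longrightarrow> length c \<le> N)"

text \<open>Counts the primes of a longest chain rather than its steps, so that a maximal ideal gets 1.\<close>
definition coht :: "'b::comm_ring_1 set \<Rightarrow> nat" where
  "coht p = Max {length c | c. prime_chain c \<and> hd c = p}"

lemma coht_finite:
  assumes "chain_bound TYPE('b::comm_ring_1) N"
  shows "finite {length c | c. prime_chain c \<and> hd c = (p::'b set)}"
  by (rule finite_subset[of _ "{..N}"]) (use assms in \<open>auto simp: chain_bound_def\<close>)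

lemma coht_ge:
  assumes "chain_bound TYPE('b::comm_ring_1) N" "prime_chain c" "hd c = (p::'b set)"
  shows "length c \<le> coht p"
  unfolding coht_def by (rule Max_ge[OF coht_finite[OF assms(1)]]) (use assms in blast)

lemma coht_attained:
  assumes "chain_bound TYPE('b::comm_ring_1) N" "prime_ideal (p::'b set)"
  obtains c where "prime_chain c" "hd c = p" "length c = coht p"
proof -
  have "prime_chain [p]" using assms by (simp add: prime_chain_def)
  then have "{length c | c. prime_chain c \<and> hd c = p} \<noteq> {}"
    by (metis (mono_tags, lifting) empty_iff list.sel(1) mem_Collect_eq)
  from Max_in[OF coht_finite[OF assms(1)] this] show ?thesis
    using that unfolding coht_def by auto
qed

lemma coht_pos:
  assumes "chain_bound TYPE('b::comm_ring_1) N" "prime_ideal (p::'b set)"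
  shows "0 < coht p"
  using coht_attained[OF assms] unfolding prime_chain_def by (metis length_greater_0_conv)

lemma coht_strict:
  assumes "chain_bound TYPE('b::comm_ring_1) N" "prime_ideal (p::'b set)" "prime_ideal q" "p \<subset> q"
  shows "coht q < coht p"
proof -
  obtain c where c: "prime_chain c" "hd c = q" "length c = coht q" using coht_attained assms by metis
  have "p \<subset> x" if "x \<in> set c" for x
    using c that assms(4) unfolding prime_chain_def by (cases c) auto
  then have "prime_chain (p # c)" using c assms(2) unfolding prime_chain_def by auto
  from coht_ge[OF assms(1) this] show ?thesis using c by simp
qed

text \<open>Gluing a chain that ends in \<open>p\<close> to one that starts in \<open>p\<close>
  counts \<open>p\<close> once, so the result has (n + 1) + (coht p - 1) members.\<close>

lemma coht_height_bound:
  assumes "chain_bound TYPE('b::comm_ring_1) N" "prime_ideal (p::'b set)" "chain_height_ge n p"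
  shows "coht p + n \<le> N"
proof -
  obtain c where c: "prime_chain c" "last c = p" "length c = n + 1"
    using assms(3) unfolding chain_height_ge_def by auto
  obtain c' where c': "prime_chain c'" "hd c' = p" "length c' = coht p"
    using coht_attained assms by metis
  then obtain c'' where c'': "c' = p # c''" unfolding prime_chain_def by (cases c') auto
  have "x \<subseteq> p" if "x \<in> set c" for x
    using sorted_psubset_last[of c x] c that unfolding prime_chain_def by auto
  moreover have "p \<subset> y" if "y \<in> set c''" for y
    using c' c'' that unfolding prime_chain_def by auto
  ultimately have "x \<subset> y" if "x \<in> set c" "y \<in> set c''" for x y
    using that by (meson subset_psubset_trans)
  then have "prime_chain (c @ c'')"
    using c c' c'' unfolding prime_chain_def by (auto simp: sorted_wrt_append)
  then have "length (c @ c'') \<le> N" using assms(1) unfolding chain_bound_def by blast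
  then show ?thesis using c c' c'' by simp
qed

text \<open>Below an exceptional \<open>p\<close> take \<open>q\<close> in the finite family of
  primes over \<open>J + K\<close>. Then \<open>l q + i \<le> n\<close>, while
  \<open>l p + Suc i \<le> n\<close> fails, hence \<open>l q \<le> l p\<close>, and
  \<open>crit\<close> leaves finitely many such \<open>p\<close>. Stating \<open>crit\<close> with
  finitely many exceptions makes room for \<open>plumstead\<close>.\<close>

lemma fin_exc_rank:
  fixes l :: "'b::comm_ring_1 set \<Rightarrow> nat"
  assumes N: "noetherian TYPE('b)" and K: "is_ideal K"
    and crit: "\<And>p. prime_ideal p \<Longrightarrow> finite {q. prime_ideal q \<and> p \<subseteq> q \<and> l p \<le> l q}"
  shows "fin_exc (\<lambda>i p. K \<subseteq> p \<longrightarrow> l p + i \<le> n)"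
  unfolding fin_exc_def
proof (intro allI impI, elim conjE)
  fix i a and J :: "'b set"
  assume J: "is_ideal J"
    and *: "\<forall>p. prime_ideal p \<and> J \<subseteq> p \<and> a \<notin> p \<longrightarrow> K \<subseteq> p \<longrightarrow> l p + i \<le> n"
  define J' where "J' = ideal_gen (J \<union> K)"
  have J': "is_ideal J'" "J' \<subseteq> p \<longleftrightarrow> J \<subseteq> p \<and> K \<subseteq> p" if "is_ideal p" for p
    unfolding J'_def using ideal_gen_superset[of "J \<union> K"] ideal_gen_least[OF that, of "J \<union> K"]
    by (simp_all add: is_ideal_gen) (meson le_sup_iff order_trans)
  have "is_ideal J'" unfolding J'_def by (rule is_ideal_gen)
  then obtain PP where PP: "finite PP" "\<And>p. p \<in> PP \<Longrightarrow> prime_ideal p \<and> J' \<subseteq> p"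
    "\<And>p. prime_ideal p \<Longrightarrow> J' \<subseteq> p \<Longrightarrow> \<exists>q\<in>PP. q \<subseteq> p"
    using finite_primes_below[OF N] by metis
  let ?E = "{p. prime_ideal p \<and> J \<subseteq> p \<and> a \<notin> p \<and> \<not> (K \<subseteq> p \<longrightarrow> l p + Suc i \<le> n)}"
  have "?E \<subseteq> (\<Union>p\<in>PP. {q. prime_ideal q \<and> p \<subseteq> q \<and> l p \<le> l q})"
  proof (intro subsetI, elim CollectE conjE)
    fix p assume p: "prime_ideal p" "J \<subseteq> p" "a \<notin> p" "\<not> (K \<subseteq> p \<longrightarrow> l p + Suc i \<le> n)"
    then have "J' \<subseteq> p" using J'(2)[OF prime_ideal_is_ideal] by simp
    then obtain q where q: "q \<in> PP" "q \<subseteq> p" using PP(3)[OF p(1)] by auto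
    then have "prime_ideal q" "J \<subseteq> q" "K \<subseteq> q" "a \<notin> q"
      using PP(2)[OF q(1)] J'(2)[OF prime_ideal_is_ideal, of q] p(3) by auto
    then have "l q + i \<le> n" using * by simp
    then have "l q \<le> l p" using p(4) by simp
    then show "p \<in> (\<Union>p\<in>PP. {q. prime_ideal q \<and> p \<subseteq> q \<and> l p \<le> l q})"
      using q p(1) by blast
  qed
  moreover have "finite (\<Union>p\<in>PP. {q. prime_ideal q \<and> p \<subseteq> q \<and> l p \<le> l q})"
    using PP(1,2) crit by simp
  ultimately show "finite ?E" using finite_subset by blast
qed

lemma fin_exc_coht:
  fixes K :: "'b::comm_ring_1 set"
  assumes "noetherian TYPE('b)" "chain_bound TYPE('b) N" "is_ideal K"
  shows "fin_exc (\<lambda>i p. K \<subseteq> p \<longrightarrow> coht p + i \<le> n)"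
proof (rule fin_exc_rank[OF assms(1,3)])
  fix p :: "'b set" assume p: "prime_ideal p"
  have "{q. prime_ideal q \<and> p \<subseteq> q \<and> coht p \<le> coht q} \<subseteq> {p}"
    using coht_strict[OF assms(2) p] by fastforce
  then show "finite {q. prime_ideal q \<and> p \<subseteq> q \<and> coht p \<le> coht q}"
    using finite_subset by blast
qed

section \<open>Plumstead's function on the primes of A[T]\<close>

definition contr :: "'b::comm_ring_1 poly set \<Rightarrow> 'b set" where
  "contr P = {x. [:x:] \<in> P}"

text \<open>For an ideal \<open>P\<close> with contraction \<open>p\<close> this says
  \<open>P = p[T]\<close>; the inclusion of \<open>p[T]\<close> in \<open>P\<close> always
  holds.\<close>

definition is_extended :: "'b::comm_ring_1 poly set \<Rightarrow> bool" where
  "is_extended P \<longleftrightarrow> (\<forall>h\<in>P. \<forall>k. coeff h k \<in> contr P)"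

text \<open>Plumstead's generalised dimension function on \<open>Spec A[T]\<close>. It need not decrease strictly
  along inclusions, but it fails to do so only finitely often above a given prime, and its maximum
  exceeds that of \<open>coht\<close> by at most one. This replaces Krull's height theorem.\<close>
definition plumstead :: "'b::comm_ring_1 poly set \<Rightarrow> nat" where
  "plumstead P = coht (contr P) + (if is_extended P then 1 else 0)"

lemma prime_contr: assumes "prime_ideal P" shows "prime_ideal (contr P)"
proof -
  have I: "is_ideal P" using assms prime_ideal_is_ideal by blast
  have "is_ideal (contr P)"
    unfolding is_ideal_def contr_def
    using ideal_zero[OF I] ideal_add[OF I] ideal_mult[OF I]
    by (auto) (metis add_pCons add_0, metis (no_types, lifting) mult_pCons_left smult_pCons mult_zero_left pCons_0_0 add_0_right smult_0_right)
  moreover have "1 \<notin> contr P" using prime_ideal_one[OF assms] by (simp add: contr_def one_pCons)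
  moreover have "a \<in> contr P \<or> b \<in> contr P" if "a * b \<in> contr P" for a b
  proof -
    have "[:a:] * [:b:] \<in> P" using that by (simp add: contr_def mult.commute)
    then show ?thesis using assms unfolding contr_def prime_ideal_mult_iff[OF assms] by simp
  qed
  ultimately show ?thesis unfolding prime_ideal_def by blast
qed

lemma poly_mem_if_coeffs:
  assumes I: "is_ideal (I :: 'b::comm_ring_1 poly set)" and "\<And>k. [:coeff h k:] \<in> I"
  shows "h \<in> I"
  using assms(2)
proof (induction h)
  case (pCons a h)
  have "h \<in> I" using pCons.IH pCons.prems[of "Suc _"] by simp
  moreover have "[:a:] \<in> I" using pCons.prems[of 0] by simp
  ultimately have "[:a:] + [:0, 1:] * h \<in> I" using I ideal_add ideal_mult by blast
  then show ?case by simp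
qed (use I ideal_zero in simp)

lemma extended_coeff_mem:
  assumes "is_ideal P" "\<And>k. coeff h k \<in> contr P" shows "h \<in> P"
  using poly_mem_if_coeffs[OF assms(1)] assms(2) by (simp add: contr_def)

text \<open>Each reduction step costs one factor \<open>lead_coeff g\<close>, in place of its
  inverse. The bound on \<open>degree q\<close> allows \<open>fibre_dim_one\<close> to apply a
  minimality of degree to the quotient.\<close>

lemma pseudo_division:
  fixes g :: "'b::comm_ring_1 poly"
  assumes g: "degree g > 0"
  shows "\<exists>k q r. smult (lead_coeff g ^ k) f = q * g + r \<and> degree r < degree g \<and>
    degree q \<le> degree f - degree g"
proof (induction "degree f" arbitrary: f rule: less_induct)
  case less
  show ?case
  proof (cases "degree f < degree g")
    case True
    then show ?thesis by (intro exI[of _ 0] exI[of _ f]) auto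
  next
    case False
    define m where "m = degree f - degree g"
    define t where "t = monom (lead_coeff f) m"
    define f1 where "f1 = smult (lead_coeff g) f - t * g"
    have dt: "degree t \<le> m" unfolding t_def by (rule degree_monom_le)
    have "degree (t * g) \<le> degree f"
      using degree_mult_le[of t g] dt False unfolding m_def by linarith
    then have d1: "degree f1 \<le> degree f"
      unfolding f1_def by (intro degree_diff_le) (auto intro: degree_smult_le)
    have "coeff f1 (degree f) = 0"
      unfolding f1_def t_def m_def using False by (simp add: coeff_monom_mult mult.commute[of "lead_coeff g" "lead_coeff f"])
    moreover have f0: "degree f > 0" using False g by simp
    ultimately have "degree f1 < degree f" using d1
      by (metis degree_0 le_neq_implies_less leading_coeff_0_iff)
    then obtain k q r where *: "smult (lead_coeff g ^ k) f1 = q * g + r" "degree r < degree g"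
      "degree q \<le> degree f1 - degree g" using less by blast
    have "smult (lead_coeff g ^ Suc k) f = smult (lead_coeff g ^ k) (f1 + t * g)"
      by (simp add: f1_def power_commutes mult.commute)
    also have "\<dots> = (q + smult (lead_coeff g ^ k) t) * g + r"
      by (simp add: smult_add_right * algebra_simps)
    finally have "smult (lead_coeff g ^ Suc k) f = (q + smult (lead_coeff g ^ k) t) * g + r" .
    moreover have "degree (q + smult (lead_coeff g ^ k) t) \<le> degree f - degree g"
      using *(3) d1 dt degree_smult_le[of "lead_coeff g ^ k" t] unfolding m_def
      by (intro degree_add_le) linarith+
    ultimately show ?thesis using *(2) by blast
  qed
qed

lemma ex_min_degree:
  assumes "h \<in> (S :: 'b::comm_ring_1 poly set)"
  obtains g where "g \<in> S" "\<And>f. degree f < degree g \<Longrightarrow> f \<notin> S"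
  using ex_has_least_nat[of "\<lambda>g. g \<in> S" h degree] assms by (metis linorder_not_less)

lemma truncate_lead:
  fixes f :: "'b::comm_ring_1 poly"
  assumes P: "is_ideal P" and lc: "lead_coeff f \<in> contr P"
    and f: "f \<notin> P"
  obtains h where "degree h < degree f" "f - h \<in> P"
proof -
  have tP: "monom (lead_coeff f) (degree f) \<in> P"
    by (rule extended_coeff_mem[OF P]) (use lc ideal_zero[OF P] in \<open>auto simp: contr_def\<close>)
  have "degree f > 0"
  proof (rule ccontr)
    assume "\<not> ?thesis"
    then have "f = monom (lead_coeff f) (degree f)"
      by (metis degree_eq_zeroE gr0I lead_coeff_pCons(1) monom_0 degree_pCons_0 coeff_pCons_0)
    then show False using tP f by simp
  qed
  let ?h = "f - monom (lead_coeff f) (degree f)"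
  have "degree ?h \<le> degree f" by (intro degree_diff_le) (auto intro: degree_monom_le)
  moreover have "coeff ?h (degree f) = 0" by simp
  ultimately have "degree ?h < degree f" using \<open>degree f > 0\<close>
    by (metis degree_0 le_neq_implies_less leading_coeff_0_iff)
  then show ?thesis using that[of ?h] tP by simp
qed

text \<open>The fibres of \<open>Spec A[T] \<rightarrow> Spec A\<close> are spectra of polynomial rings in one
  variable over fields.\<close>
lemma fibre_dim_one:
  fixes P Q :: "'b::comm_ring_1 poly set"
  assumes P: "prime_ideal P" and Q: "prime_ideal Q" and PQ: "P \<subseteq> Q"
    and contr: "contr P = contr Q" and ext: "\<not> is_extended P"
  shows "P = Q"
proof (rule ccontr)
  assume "P \<noteq> Q"
  then obtain g0 where "g0 \<in> Q - P" using PQ by auto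
  \<comment> \<open>Minimal degree keeps the leading coefficients of \<open>g\<close>, and later of
    \<open>h\<close>, out of \<open>contr P\<close>, so that both can act as divisors in
    pseudo-division.\<close>
  then obtain g where g: "g \<in> Q - P" "\<And>f. degree f < degree g \<Longrightarrow> f \<notin> Q - P"
    using ex_min_degree[of g0 "Q - P"] by metis
  note IP = prime_ideal_is_ideal[OF P] and IQ = prime_ideal_is_ideal[OF Q]
  have lcg: "lead_coeff g \<notin> contr P"
  proof
    assume "lead_coeff g \<in> contr P"
    then obtain h where h: "degree h < degree g" "g - h \<in> P"
      using truncate_lead[OF IP] g(1) by blast
    have "h \<in> Q" using ideal_diff[OF IQ, of g "g - h"] g(1) h(2) PQ by auto
    moreover have "h \<notin> P" using ideal_add[OF IP h(2), of h] g(1) by auto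
    ultimately show False using g(2)[OF h(1)] by simp
  qed
  have dg: "degree g > 0"
  proof (rule ccontr)
    assume "\<not> ?thesis"
    then obtain x where "g = [:x:]" by (metis degree_eq_zeroE gr0I)
    then show False using g(1) contr unfolding contr_def by auto
  qed
  \<comment> \<open>An element of \<open>S\<close> of least degree generates \<open>P\<close> over
    the fraction field of A / contr P.\<close>
  define S where "S = {h \<in> P. \<exists>k. coeff h k \<notin> contr P}"
  obtain h0 where "h0 \<in> S" using ext unfolding is_extended_def S_def by auto
  then obtain h where h: "h \<in> S" "\<And>f. degree f < degree h \<Longrightarrow> f \<notin> S"
    using ex_min_degree[of h0 S] by metis
  have hP: "h \<in> P" using h(1) unfolding S_def by simp
  have lch: "lead_coeff h \<notin> contr P"
  proof
    assume lc: "lead_coeff h \<in> contr P"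
    let ?t = "monom (lead_coeff h) (degree h)"
    have tc: "coeff ?t k \<in> contr P" for k
      using lc ideal_zero[OF prime_ideal_is_ideal[OF prime_contr[OF P]]] by auto
    then have tP: "?t \<in> P" using extended_coeff_mem[OF IP] by blast
    have dh: "degree h > 0"
    proof (rule ccontr)
      assume "\<not> ?thesis"
      then have "coeff h k \<in> contr P" for k
        using lc ideal_zero[OF prime_ideal_is_ideal[OF prime_contr[OF P]]]
        by (cases "k = 0") (auto simp: coeff_eq_0)
      then show False using h(1) unfolding S_def by auto
    qed
    have "degree (h - ?t) \<le> degree h" by (intro degree_diff_le) (auto intro: degree_monom_le)
    moreover have "coeff (h - ?t) (degree h) = 0" by simp
    ultimately have "degree (h - ?t) < degree h" using dh
      by (metis degree_0 le_neq_implies_less leading_coeff_0_iff)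
    moreover have "h - ?t \<in> P" using hP tP IP ideal_diff by blast
    ultimately have "coeff (h - ?t) k \<in> contr P" for k using h(2)[of "h - ?t"] unfolding S_def by auto
    then have "coeff (h - ?t) k + coeff ?t k \<in> contr P" for k
      using tc ideal_add[OF prime_ideal_is_ideal[OF prime_contr[OF P]]] by blast
    then have "coeff h k \<in> contr P" for k by simp
    then show False using h(1) unfolding S_def by auto
  qed
  have pow: "smult (c ^ k) f \<in> P \<longleftrightarrow> f \<in> P" if "c \<notin> contr P" for c k f
  proof -
    have "smult (c ^ k) f = [:c:] ^ k * f" by (induction k) (auto simp: mult.assoc simp flip: smult_smult)
    then show ?thesis
      using that unfolding contr_def by (auto simp: prime_ideal_mult_iff[OF P] prime_ideal_power_iff[OF P])
  qed
  have dh: "degree h > 0"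
  proof (rule ccontr)
    assume "\<not> ?thesis"
    then obtain x where "h = [:x:]" by (metis degree_eq_zeroE gr0I)
    then show False using hP lch unfolding contr_def by auto
  qed
  have le: "degree g \<le> degree h"
  proof (rule ccontr)
    assume lt: "\<not> ?thesis"
    obtain k q r where *: "smult (lead_coeff h ^ k) g = q * h + r" "degree r < degree h"
      using pseudo_division[OF dh, of g] by blast
    have r: "r = smult (lead_coeff h ^ k) g - q * h" using * by simp
    have "smult (lead_coeff h ^ k) g \<in> Q"
      using g(1) ideal_mult[OF IQ, of g "[:lead_coeff h ^ k:]"] by simp
    moreover have "q * h \<in> P" using hP ideal_mult[OF IP] by blast
    ultimately have "r \<in> Q" unfolding r using PQ IQ ideal_diff by blast
    moreover have "r \<notin> P"
    proof
      assume "r \<in> P"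
      then have "smult (lead_coeff h ^ k) g \<in> P" unfolding * using \<open>q * h \<in> P\<close> IP ideal_add by blast
      then show False using pow[OF lch] g(1) by simp
    qed
    ultimately show False using g(2)[of r] * lt by simp
  qed
  \<comment> \<open>Dividing \<open>h\<close> by \<open>g\<close> puts \<open>q\<close> and
    \<open>r\<close> into \<open>P\<close>, both of degree below \<open>degree h\<close>. By the
    choice of \<open>h\<close> their coefficients lie in \<open>contr P\<close>, and then so do
    those of \<open>h\<close>.\<close>
  obtain k q r where *: "smult (lead_coeff g ^ k) h = q * g + r" "degree r < degree g"
    "degree q \<le> degree h - degree g"
    using pseudo_division[OF dg, of h] by blast
  have kh: "smult (lead_coeff g ^ k) h \<in> P" using pow[OF lcg] hP by simp
  have r: "r = smult (lead_coeff g ^ k) h - q * g" using * by simp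
  have "q * g \<in> Q" using g(1) IQ ideal_mult by blast
  then have "r \<in> Q" unfolding r using kh PQ IQ ideal_diff by blast
  then have rP: "r \<in> P" using g(2)[OF *(2)] by simp
  have "q * g = smult (lead_coeff g ^ k) h - r" using * by simp
  then have "q * g \<in> P" using kh rP IP ideal_diff by metis
  then have qP: "q \<in> P" using g(1) by (simp add: prime_ideal_mult_iff[OF P])
  have Ic: "is_ideal (contr P)" using prime_contr[OF P] prime_ideal_is_ideal by blast
  have qc: "coeff q j \<in> contr P" for j
    using h(2)[of q] qP *(3) dg dh unfolding S_def by auto
  have rc: "coeff r j \<in> contr P" for j
    using h(2)[of r] rP *(2) le unfolding S_def by auto
  have "coeff (q * g) j \<in> contr P" for j
    unfolding coeff_mult by (intro ideal_sum[OF Ic]) (use qc Ic ideal_mult_right in blast)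
  then have "coeff (smult (lead_coeff g ^ k) h) j \<in> contr P" for j
    unfolding * coeff_add using rc Ic ideal_add by blast
  then have "coeff h j \<in> contr P" for j
    using lcg by (simp add: prime_ideal_mult_iff[OF prime_contr[OF P]]
      prime_ideal_power_iff[OF prime_contr[OF P]])
  then show False using h(1) unfolding S_def by auto
qed

lemma contr_mono: "P \<subseteq> Q \<Longrightarrow> contr P \<subseteq> contr Q"
  by (auto simp: contr_def)

lemma extended_eqI:
  assumes "is_ideal P" "is_ideal Q" "is_extended P" "is_extended Q" "contr P = contr Q"
  shows "P = Q"
  using assms extended_coeff_mem unfolding is_extended_def by (metis subsetI subset_antisym)

text \<open>Over the same contraction the value drops unless \<open>Q = P\<close>. Over a larger one
  \<open>coht\<close> drops, which is made up only if \<open>Q\<close> is extended and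
  \<open>P\<close> is not. Then \<open>contr Q\<close> contains the ideal \<open>C\<close> of all
  coefficients of \<open>P\<close>, and the exceptional \<open>Q\<close> are extended from the
  finitely many primes \<open>QQ\<close> over \<open>C\<close>.\<close>

lemma plumstead_drop:
  fixes P :: "'b::comm_ring_1 poly set"
  assumes N: "noetherian TYPE('b)" and B: "chain_bound TYPE('b) M" and P: "prime_ideal P"
  shows "finite {Q. prime_ideal Q \<and> P \<subseteq> Q \<and> plumstead P \<le> plumstead Q}"
proof -
  define C where "C = ideal_gen {coeff h k | h k. h \<in> P}"
  have "is_ideal C" unfolding C_def by (rule is_ideal_gen)
  then obtain QQ where QQ: "finite QQ" "\<And>p. p \<in> QQ \<Longrightarrow> prime_ideal p \<and> C \<subseteq> p"
    "\<And>p. prime_ideal p \<Longrightarrow> C \<subseteq> p \<Longrightarrow> \<exists>q\<in>QQ. q \<subseteq> p"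
    using finite_primes_below[OF N] by metis
  define X where "X = {Q. is_ideal Q \<and> is_extended Q \<and> contr Q \<in> QQ}"
  have "inj_on contr X"
    using extended_eqI unfolding X_def inj_on_def by blast
  moreover have "contr ` X \<subseteq> QQ" unfolding X_def by auto
  ultimately have X: "finite X" using QQ(1) by (meson finite_imageD finite_subset)
  have *: "Q \<in> insert P X"
    if Q: "prime_ideal Q" "P \<subseteq> Q" "plumstead P \<le> plumstead Q" for Q
  proof (rule ccontr)
    assume not: "Q \<notin> insert P X"
    note IP = prime_ideal_is_ideal[OF P] and IQ = prime_ideal_is_ideal[OF Q(1)]
    note cP = prime_contr[OF P] and cQ = prime_contr[OF Q(1)]
    show False
    proof (cases "contr P = contr Q")
      case True
      have "is_extended P" using fibre_dim_one[OF P Q(1,2) True] not by auto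
      moreover have "\<not> is_extended Q" using extended_eqI[OF IP IQ] True calculation not by auto
      ultimately show False using Q(3) True unfolding plumstead_def by simp
    next
      case False
      then have ss: "contr P \<subset> contr Q" using contr_mono[OF Q(2)] by auto
      then have lt: "coht (contr Q) < coht (contr P)" using coht_strict[OF B cP cQ] by simp
      then have eQ: "is_extended Q" and eP: "\<not> is_extended P"
        using Q(3) unfolding plumstead_def by (auto split: if_splits)
      have CQ: "C \<subseteq> contr Q"
        unfolding C_def
      proof (rule ideal_gen_least[OF prime_ideal_is_ideal[OF cQ]])
        show "{coeff h k | h k. h \<in> P} \<subseteq> contr Q" using eQ Q(2) unfolding is_extended_def by auto
      qed
      have Csup: "{coeff h k | h k. h \<in> P} \<subseteq> C" unfolding C_def by (rule ideal_gen_superset)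
      have PC: "contr P \<subset> C"
      proof (rule psubsetI)
        show "contr P \<subseteq> C"
        proof
          fix x assume "x \<in> contr P"
          then have "coeff [:x:] 0 \<in> {coeff h k | h k. h \<in> P}" unfolding contr_def by blast
          then show "x \<in> C" using Csup by auto
        qed
        obtain h k where hk: "h \<in> P" "coeff h k \<notin> contr P" using eP unfolding is_extended_def by auto
        then have "coeff h k \<in> C" using Csup by blast
        then show "contr P \<noteq> C" using hk by auto
      qed
      obtain q where q: "q \<in> QQ" "q \<subseteq> contr Q" using QQ(3)[OF cQ CQ] by auto
      then have q': "prime_ideal q" "contr P \<subset> q" using QQ(2)[OF q(1)] PC by auto
      have "q \<noteq> contr Q" using not q eQ IQ unfolding X_def by auto
      \<comment> \<open>With \<open>q\<close> strictly between the two contractions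
        \<open>coht\<close> drops by at least two, which the extra one for an extended
        \<open>Q\<close> cannot make up.\<close>
      then have "q \<subset> contr Q" using q by auto
      then have "coht (contr Q) < coht q" "coht q < coht (contr P)"
        using coht_strict[OF B] q' cP cQ by blast+
      then show False using Q(3) eP unfolding plumstead_def by (simp split: if_splits)
    qed
  qed
  have "{Q. prime_ideal Q \<and> P \<subseteq> Q \<and> plumstead P \<le> plumstead Q} \<subseteq> insert P X"
    by (intro subsetI, elim CollectE conjE, rule *)
  then show ?thesis using X by (meson finite_insert finite_subset)
qed

lemma fin_exc_plumstead:
  fixes K :: "'b::comm_ring_1 poly set"
  assumes "noetherian TYPE('b)" "chain_bound TYPE('b) N" "is_ideal K"
  shows "fin_exc (\<lambda>i p. K \<subseteq> p \<longrightarrow> plumstead p + i \<le> n)"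
  by (rule fin_exc_rank[OF hilbert_basis[OF assms(1)] assms(3) plumstead_drop[OF assms(1,2)]])

section \<open>Vectors and local bases of projective modules\<close>

definition dot :: "nat \<Rightarrow> 'b::comm_ring_1 vec \<Rightarrow> 'b vec \<Rightarrow> 'b" where
  "dot m f v = (\<Sum>i<m. f i * v i)"

lemma dot_add_left: "dot m (\<lambda>i. f i + g i) v = dot m f v + dot m g v"
  by (simp add: dot_def distrib_right sum.distrib)

lemma dot_add_right: "dot m f (\<lambda>i. v i + w i) = dot m f v + dot m f w"
  by (simp add: dot_def distrib_left sum.distrib)

lemma dot_diff_left: "dot m (\<lambda>i. f i - g i) v = dot m f v - dot m g v"
  by (simp add: dot_def left_diff_distrib sum_subtractf)

lemma dot_diff_right: "dot m f (\<lambda>i. v i - w i) = dot m f v - dot m f w"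
  by (simp add: dot_def right_diff_distrib sum_subtractf)

lemma dot_smult_left: "dot m (\<lambda>i. c * f i) v = c * dot m f v"
  by (simp add: dot_def sum_distrib_left mult.assoc)

lemma dot_smult_right: "dot m f (\<lambda>i. c * v i) = c * dot m f v"
  by (simp add: dot_def sum_distrib_left algebra_simps)

lemma dot_zero_left: "dot m (\<lambda>i. 0) v = 0"
  by (simp add: dot_def)

lemma dot_zero_right: "dot m f (\<lambda>i. 0) = 0"
  by (simp add: dot_def)

lemma dot_sum_left: "dot m (\<lambda>k. \<Sum>i\<in>S. f i k) v = (\<Sum>i\<in>S. dot m (f i) v)"
  unfolding dot_def by (simp add: sum_distrib_right sum.swap[of _ S])

lemma dot_sum_right: "dot m f (\<lambda>k. \<Sum>i\<in>S. v i k) = (\<Sum>i\<in>S. dot m f (v i))"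
  unfolding dot_def by (simp add: sum_distrib_left sum.swap[of _ S])

lemmas dot_simps = dot_add_left dot_add_right dot_diff_left dot_diff_right dot_smult_left
  dot_smult_right dot_zero_left dot_zero_right

lemma Pmod_iff: "v \<in> Pmod m e \<longleftrightarrow> (\<forall>i\<ge>m. v i = 0) \<and> (\<forall>i<m. dot m (e i) v = v i)"
  by (simp add: Pmod_def dot_def)

lemma Pmod_zero: "(\<lambda>i. 0) \<in> Pmod m e"
  by (simp add: Pmod_iff dot_simps)

lemma Pmod_add: "v \<in> Pmod m e \<Longrightarrow> w \<in> Pmod m e \<Longrightarrow> (\<lambda>i. v i + w i) \<in> Pmod m e"
  by (simp add: Pmod_iff dot_simps)

lemma Pmod_diff: "v \<in> Pmod m e \<Longrightarrow> w \<in> Pmod m e \<Longrightarrow> (\<lambda>i. v i - w i) \<in> Pmod m e"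
  by (simp add: Pmod_iff dot_simps)

lemma Pmod_smult: "v \<in> Pmod m e \<Longrightarrow> (\<lambda>i. c * v i) \<in> Pmod m e"
  by (simp add: Pmod_iff dot_simps)

lemma Pmod_sum: "(\<And>k. k \<in> S \<Longrightarrow> v k \<in> Pmod m e) \<Longrightarrow> (\<lambda>i. \<Sum>k\<in>S. v k i) \<in> Pmod m e"
  by (simp add: Pmod_iff dot_sum_right)

definition col :: "nat \<Rightarrow> 'b::comm_ring_1 mat \<Rightarrow> nat \<Rightarrow> 'b vec" where
  "col m e k = (\<lambda>i. if i < m then e i k else 0)"

lemma col_in_Pmod: "idempotent_mat m e \<Longrightarrow> k < m \<Longrightarrow> col m e k \<in> Pmod m e"
  by (auto simp: Pmod_iff dot_def col_def idempotent_mat_def)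

lemma Pmod_expand:
  assumes "v \<in> Pmod m e" shows "v = (\<lambda>i. \<Sum>k<m. v k * col m e k i)"
proof
  fix i show "v i = (\<Sum>k<m. v k * col m e k i)"
    using assms by (cases "i < m") (auto simp: Pmod_iff dot_def col_def mult.commute)
qed

text \<open>Stands for a basis over the localisation at \<open>b\<close> and its dual basis, with
  denominators cleared: the pairing is \<open>b\<close> times the identity matrix.\<close>

definition chart :: "nat \<Rightarrow> 'b::comm_ring_1 mat \<Rightarrow> nat \<Rightarrow> 'b \<Rightarrow> (nat \<Rightarrow> 'b vec) \<Rightarrow> (nat \<Rightarrow> 'b vec) \<Rightarrow> bool" where
  "chart m e n b v f \<longleftrightarrow> (\<forall>i<n. v i \<in> Pmod m e) \<and>
     (\<forall>i<n. \<forall>j<n. dot m (f i) (v j) = (if i = j then b else 0))"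

lemma common_denominator:
  assumes p: "prime_ideal p" and S: "finite S" and ex: "\<And>k. k \<in> S \<Longrightarrow> \<exists>t. t \<notin> p \<and> X k t"
    and mono: "\<And>k t c. k \<in> S \<Longrightarrow> X k t \<Longrightarrow> X k (c * t)"
  shows "\<exists>t. t \<notin> p \<and> (\<forall>k\<in>S. X k t)"
proof -
  obtain t where t: "\<And>k. k \<in> S \<Longrightarrow> t k \<notin> p \<and> X k (t k)" using ex by metis
  have "prod t S \<notin> p" using t prime_ideal_prod_iff[OF S p] by auto
  moreover have "X k (prod t S)" if "k \<in> S" for k
    using mono[OF that conjunct2[OF t[OF that]], of "prod t (S - {k})"] S that
    by (simp add: prod.remove mult.commute)
  ultimately show ?thesis by blast
qed

text \<open>The columns generate \<open>P\<close>, so after multiplication by some \<open>t\<close>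
  outside \<open>p\<close> every \<open>v\<close> is a combination of the \<open>q i\<close> with
  coefficients \<open>dot m (g i) v\<close>. For \<open>v = q l\<close> this becomes a relation with
  coefficients \<open>d i l\<close>, and independence of the \<open>q i\<close> at \<open>p\<close>
  kills them after a further factor \<open>T\<close>.\<close>

lemma chart_at_prime:
  fixes e :: "'b::comm_ring_1 mat"
  assumes e: "idempotent_mat m e" and rank: "proj_rank m e n" and p: "prime_ideal p"
  shows "\<exists>b v f. b \<notin> p \<and> chart m e n b v f"
proof -
  obtain q where q0: "\<forall>i<n. q i \<in> Pmod m e"
    "\<forall>x\<in>Pmod m e. \<exists>t a. t \<notin> p \<and> vsmult t x = (\<lambda>j. \<Sum>i<n. a i * q i j)"
    "\<forall>a u. u \<notin> p \<and> (\<forall>j. u * (\<Sum>i<n. a i * q i j) = 0) \<longrightarrow> (\<forall>i<n. \<exists>t. t \<notin> p \<and> t * a i = 0)"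
    using rank[unfolded proj_rank_def, rule_format, OF p] by (elim exE conjE)
  note q = q0(1)[rule_format] q0(2)[rule_format] q0(3)[rule_format, OF conjI, rule_format]
  have "\<exists>t. t \<notin> p \<and> (\<forall>k\<in>{..<m}. \<exists>a. vsmult t (col m e k) = (\<lambda>j. \<Sum>i<n. a i * q i j))"
  proof (rule common_denominator[OF p])
    fix k assume "k \<in> {..<m}"
    then show "\<exists>t. t \<notin> p \<and> (\<exists>a. vsmult t (col m e k) = (\<lambda>j. \<Sum>i<n. a i * q i j))"
      using q(2)[OF col_in_Pmod[OF e]] by auto
  next
    fix k t c assume "\<exists>a. vsmult t (col m e k) = (\<lambda>j. \<Sum>i<n. a i * q i j)"
    then obtain a where a: "vsmult t (col m e k) = (\<lambda>j. \<Sum>i<n. a i * q i j)" ..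
    have "vsmult (c * t) (col m e k) = (\<lambda>j. \<Sum>i<n. (c * a i) * q i j)"
    proof
      fix j
      have "vsmult (c * t) (col m e k) j = c * vsmult t (col m e k) j"
        by (simp add: vsmult_def mult.assoc)
      then show "vsmult (c * t) (col m e k) j = (\<Sum>i<n. (c * a i) * q i j)"
        by (simp add: a sum_distrib_left mult.assoc)
    qed
    then show "\<exists>a. vsmult (c * t) (col m e k) = (\<lambda>j. \<Sum>i<n. a i * q i j)"
      by (rule exI[of _ "\<lambda>i. c * a i"])
  qed simp
  then obtain t where t: "t \<notin> p" "\<forall>k<m. \<exists>a. vsmult t (col m e k) = (\<lambda>j. \<Sum>i<n. a i * q i j)" by auto
  then obtain a where a: "\<And>k. k < m \<Longrightarrow> vsmult t (col m e k) = (\<lambda>j. \<Sum>i<n. a k i * q i j)" by metis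
  define g where "g i k = a k i" for i k
  have exp: "t * v j = (\<Sum>i<n. dot m (g i) v * q i j)" if v: "v \<in> Pmod m e" for v j
  proof -
    have "t * v j = (\<Sum>k<m. v k * vsmult t (col m e k) j)"
      using arg_cong[OF fun_cong[OF Pmod_expand[OF v], of j], of "\<lambda>x. t * x"]
      by (simp add: vsmult_def sum_distrib_left mult.left_commute)
    also have "\<dots> = (\<Sum>k<m. \<Sum>i<n. a k i * v k * q i j)"
      by (intro sum.cong) (auto simp: a sum_distrib_left algebra_simps)
    also have "\<dots> = (\<Sum>i<n. dot m (g i) v * q i j)"
      unfolding dot_def g_def by (subst sum.swap) (simp add: sum_distrib_right)
    finally show ?thesis .
  qed
  define d where "d i l = dot m (g i) (q l) - (if i = l then t else 0)" for i l
  have "\<exists>T. T \<notin> p \<and> (\<forall>z\<in>{..<n} \<times> {..<n}. T * d (fst z) (snd z) = 0)"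
  proof (rule common_denominator[OF p])
    fix z assume z: "z \<in> {..<n} \<times> {..<n}"
    then have l: "fst z < n" "snd z < n" by auto
    have "(\<Sum>i<n. d i (snd z) * q i j) = 0" for j
    proof -
      have "(\<Sum>i<n. d i (snd z) * q i j) = (\<Sum>i<n. dot m (g i) (q (snd z)) * q i j)
          - (\<Sum>i<n. (if i = snd z then t * q i j else 0))"
        unfolding d_def sum_subtractf[symmetric] by (intro sum.cong) (auto simp: left_diff_distrib)
      also have "\<dots> = 0"
        using exp[OF q(1)[OF l(2)], of j] l by simp
      finally show ?thesis .
    qed
    then show "\<exists>T. T \<notin> p \<and> T * d (fst z) (snd z) = 0"
      using q(3)[OF prime_ideal_one[OF p] _ l(1), of "\<lambda>i. d i (snd z)"] by simp
  qed (auto simp: mult.assoc)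
  then obtain T where T: "T \<notin> p" "\<And>i l. i < n \<Longrightarrow> l < n \<Longrightarrow> T * d i l = 0" by auto
  have "chart m e n (T * t) q (\<lambda>i k. T * g i k)"
    unfolding chart_def dot_smult_left using q(1) T(2) by (auto simp: d_def right_diff_distrib)
  moreover have "T * t \<notin> p" using T t p prime_ideal_mult_iff by blast
  ultimately show ?thesis by blast
qed

text \<open>In this form the rank condition passes to A[T], and one can argue by induction over the
  charts.\<close>

definition charts_cover :: "nat \<Rightarrow> 'b::comm_ring_1 mat \<Rightarrow> nat \<Rightarrow> bool" where
  "charts_cover m e n \<longleftrightarrow> (\<exists>F. finite F \<and> (\<forall>b\<in>F. \<exists>v f. chart m e n b v f) \<and>
     (\<forall>p. prime_ideal p \<longrightarrow> (\<exists>b\<in>F. b \<notin> p)))"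

lemma ideal_gen_finite_subset:
  assumes "x \<in> ideal_gen S"
  shows "\<exists>F. finite F \<and> F \<subseteq> S \<and> x \<in> ideal_gen F"
proof -
  let ?I = "{x. \<exists>F. finite F \<and> F \<subseteq> S \<and> x \<in> ideal_gen F}"
  have "is_ideal ?I"
    unfolding is_ideal_def
  proof (intro conjI allI ballI)
    show "0 \<in> ?I" using ideal_zero[OF is_ideal_gen] by blast
  next
    fix x y assume "x \<in> ?I" "y \<in> ?I"
    then obtain F G where FG: "finite F" "F \<subseteq> S" "x \<in> ideal_gen F" "finite G" "G \<subseteq> S" "y \<in> ideal_gen G"
      by auto
    then have "x \<in> ideal_gen (F \<union> G)" "y \<in> ideal_gen (F \<union> G)"
      using ideal_gen_mono[of F "F \<union> G"] ideal_gen_mono[of G "F \<union> G"] by auto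
    then have "x + y \<in> ideal_gen (F \<union> G)" using ideal_add is_ideal_gen by blast
    then show "x + y \<in> ?I" using FG by (intro CollectI exI[of _ "F \<union> G"]) simp
  next
    fix c x assume "x \<in> ?I"
    then show "c * x \<in> ?I" using ideal_mult[OF is_ideal_gen] by blast
  qed
  moreover have "S \<subseteq> ?I"
  proof
    fix s assume "s \<in> S"
    then show "s \<in> ?I" using ideal_gen_superset[of "{s}"] by (intro CollectI exI[of _ "{s}"]) simp
  qed
  ultimately show ?thesis using ideal_gen_least[of ?I S] assms by blast
qed

text \<open>Quasi-compactness of the spectrum: no prime contains all chart denominators, so they
  generate the unit ideal, and finitely many of them already do.\<close>

lemma charts_cover_proj_rank:
  fixes e :: "'b::comm_ring_1 mat"
  assumes N: "noetherian TYPE('b)" and "idempotent_mat m e" "proj_rank m e n"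
  shows "charts_cover m e n"
proof -
  let ?C = "{b. \<exists>v f. chart m e n b v f}"
  have "1 \<in> ideal_gen ?C"
  proof (rule ccontr)
    assume "1 \<notin> ideal_gen ?C"
    then obtain p where p: "prime_ideal p" "ideal_gen ?C \<subseteq> p"
      using prime_ideal_above[OF N is_ideal_gen] by blast
    then obtain b where "b \<notin> p" "b \<in> ?C" using chart_at_prime[OF assms(2,3) p(1)] by blast
    then show False using p(2) ideal_gen_superset[of ?C] by auto
  qed
  then obtain F where F: "finite F" "F \<subseteq> ?C" "1 \<in> ideal_gen F" using ideal_gen_finite_subset by blast
  have "\<exists>b\<in>F. b \<notin> p" if p: "prime_ideal p" for p
  proof (rule ccontr)
    assume "\<not> ?thesis"
    then have "F \<subseteq> p" by auto
    then have "ideal_gen F \<subseteq> p" using ideal_gen_least[OF prime_ideal_is_ideal[OF p]] by simp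
    then show False using F(3) prime_ideal_one[OF p] by auto
  qed
  then show ?thesis unfolding charts_cover_def using F(1,2) by (intro exI[of _ F]) auto
qed

text \<open>Induction over the charts, adding \<open>b * w\<close> for the chart of
  \<open>b\<close>. At primes containing \<open>b\<close> the correction vanishes and the earlier
  result stands. Elsewhere \<open>w\<close> can be given any multiples of \<open>b\<close> as values
  on the local basis, so \<open>generic_sequence\<close> applies to the n values there.\<close>

lemma basic_element:
  fixes e :: "'b::comm_ring_1 mat"
  assumes cover: "charts_cover m e n" and R: "fin_exc R"
    and R0: "\<And>p. prime_ideal p \<Longrightarrow> a \<notin> p \<Longrightarrow> R 0 p"
  shows "\<exists>g. \<forall>p. prime_ideal p \<and> a \<notin> p \<and> (\<forall>v\<in>Pmod m e. dot m f v + a * dot m g v \<in> p) \<longrightarrow> R n p"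
proof -
  obtain F where F: "finite F" "\<And>b. b \<in> F \<Longrightarrow> \<exists>v f. chart m e n b v f"
    "\<And>p. prime_ideal p \<Longrightarrow> \<exists>b\<in>F. b \<notin> p" using cover unfolding charts_cover_def by metis
  have "\<exists>g. \<forall>p. prime_ideal p \<and> a \<notin> p \<and> (\<exists>b\<in>F. b \<notin> p) \<and>
      (\<forall>v\<in>Pmod m e. dot m f v + a * dot m g v \<in> p) \<longrightarrow> R n p"
    using F(1,2)
  proof (induction F rule: finite_induct)
    case (insert b F)
    then obtain g where g: "\<And>p. prime_ideal p \<Longrightarrow> a \<notin> p \<Longrightarrow> \<exists>b\<in>F. b \<notin> p \<Longrightarrow>
      (\<forall>v\<in>Pmod m e. dot m f v + a * dot m g v \<in> p) \<Longrightarrow> R n p" by (metis insertCI)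
    obtain v h where ch: "chart m e n b v h" using insert.prems by blast
    have "R 0 p" if "prime_ideal p" "a * b * b \<notin> p" for p
      using that R0 by (auto simp: prime_ideal_mult_iff)
    \<comment> \<open>In \<open>a * b * b\<close> one factor \<open>b\<close> is the pairing in
      \<open>dot m w (v j) = c j * b\<close>, the other comes from adding \<open>b * w\<close>
      instead of \<open>w\<close>.\<close>
    then obtain c where c: "\<And>p. prime_ideal p \<Longrightarrow> a * b * b \<notin> p \<Longrightarrow>
      (\<forall>j<n. (dot m f (v j) + a * dot m g (v j)) + a * b * b * c j \<in> p) \<Longrightarrow> R n p"
      using generic_sequence[OF R, of "a * b * b" n "\<lambda>j. dot m f (v j) + a * dot m g (v j)"] by metis
    define w where "w k = (\<Sum>i<n. c i * h i k)" for k
    define g' where "g' k = g k + b * w k" for k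
    have g'dot: "dot m g' x = dot m g x + b * dot m w x" for x
      unfolding g'_def by (simp add: dot_simps)
    have wv: "dot m w (v j) = c j * b" if "j < n" for j
    proof -
      have "dot m w (v j) = (\<Sum>i<n. c i * dot m (h i) (v j))"
        unfolding w_def dot_sum_left dot_smult_left ..
      also have "\<dots> = (\<Sum>i<n. if i = j then c j * b else 0)"
        using ch that unfolding chart_def by (intro sum.cong) auto
      finally show ?thesis using that by simp
    qed
    have "R n p" if p: "prime_ideal p" "a \<notin> p" "\<exists>b\<in>insert b F. b \<notin> p"
      "\<forall>v\<in>Pmod m e. dot m f v + a * dot m g' v \<in> p" for p
    proof (cases "b \<in> p")
      case True
      have "dot m f x + a * dot m g x \<in> p" if "x \<in> Pmod m e" for x
      proof -
        have "b * (a * dot m w x) \<in> p" using True p(1) prime_ideal_mult_iff by blast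
        moreover have "dot m f x + a * dot m g' x \<in> p" using p(4) that by blast
        ultimately have "(dot m f x + a * dot m g' x) - b * (a * dot m w x) \<in> p"
          using p(1) prime_ideal_is_ideal ideal_diff by blast
        then show ?thesis by (simp add: g'dot algebra_simps)
      qed
      then show ?thesis using g p(1-3) True by auto
    next
      case False
      have "(dot m f (v j) + a * dot m g (v j)) + a * b * b * c j \<in> p" if "j < n" for j
      proof -
        have "dot m f (v j) + a * dot m g' (v j) \<in> p" using p(4) ch that unfolding chart_def by blast
        then show ?thesis by (simp add: g'dot wv[OF that] algebra_simps)
      qed
      moreover have "a * b * b \<notin> p" using False p(1,2) by (simp add: prime_ideal_mult_iff)
      ultimately show ?thesis using c p(1) by blast
    qed
    then show ?case by blast
  qed auto
  then obtain g where g: "\<forall>p. prime_ideal p \<and> a \<notin> p \<and> (\<exists>b\<in>F. b \<notin> p) \<and>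
      (\<forall>v\<in>Pmod m e. dot m f v + a * dot m g v \<in> p) \<longrightarrow> R n p" ..
  show ?thesis
  proof (intro exI[of _ g] allI impI, elim conjE)
    fix p assume "prime_ideal p" "a \<notin> p" "\<forall>v\<in>Pmod m e. dot m f v + a * dot m g v \<in> p"
    then show "R n p" using g[rule_format, of p] F(3)[of p] by argo
  qed
qed

section \<open>Constant vectors and evaluation over A[T]\<close>

definition cst :: "'b::comm_ring_1 vec \<Rightarrow> 'b poly vec" where
  "cst v = (\<lambda>i. [:v i:])"

definition ev :: "'b::comm_ring_1 \<Rightarrow> 'b poly vec \<Rightarrow> 'b vec" where
  "ev t v = (\<lambda>i. poly (v i) t)"

lemma sum_const_poly: "(\<Sum>i\<in>S. [:f i:]) = [:\<Sum>i\<in>S. f i:]"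
  by (induction S rule: infinite_finite_induct) auto

lemma dot_cst: "dot m (cst f) (cst v) = [:dot m f v:]"
  by (simp add: dot_def cst_def sum_const_poly mult.commute)

lemma dot_ev: "dot m (ev t f) (ev t v) = poly (dot m f v) t"
  by (simp add: dot_def ev_def poly_sum)

lemma ev_cst [simp]: "ev t (cst v) = v"
  by (simp add: ev_def cst_def)

lemma coeff_dot_cst: "coeff (dot m (cst f) v) k = dot m f (\<lambda>i. coeff (v i) k)"
  by (simp add: dot_def cst_def coeff_sum)

lemma polymat_row: "polymat e i = cst (e i)"
  by (simp add: polymat_def cst_def)

lemma Pmod_cst_iff: "cst v \<in> Pmod m (polymat e) \<longleftrightarrow> v \<in> Pmod m e"
  by (simp add: Pmod_iff polymat_row dot_cst) (simp add: cst_def)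

lemma Pmod_ev: assumes "v \<in> Pmod m (polymat e)" shows "ev t v \<in> Pmod m e"
proof -
  have "dot m (e i) (ev t v) = ev t v i" if "i < m" for i
  proof -
    have "dot m (e i) (ev t v) = poly (dot m (cst (e i)) v) t" by (metis dot_ev ev_cst)
    then show ?thesis using assms that by (simp add: Pmod_iff polymat_row ev_def)
  qed
  then show ?thesis using assms by (simp add: Pmod_iff ev_def)
qed

lemma Pmod_coeff:
  assumes "v \<in> Pmod m (polymat e)" shows "(\<lambda>i. coeff (v i) k) \<in> Pmod m e"
  using assms unfolding Pmod_iff polymat_row by (simp flip: coeff_dot_cst)

lemma idempotent_polymat: "idempotent_mat m e \<Longrightarrow> idempotent_mat m (polymat e)"
  by (simp add: idempotent_mat_def polymat_def sum_const_poly mult.commute)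

text \<open>Charts of \<open>P\<close> read as constants cover P[T], because a prime of A[T]
  contracts to a prime of A.\<close>

lemma charts_cover_polymat:
  fixes e :: "'b::comm_ring_1 mat"
  assumes "charts_cover m e n" shows "charts_cover m (polymat e) n"
proof -
  obtain F where F: "finite F" "\<And>b. b \<in> F \<Longrightarrow> \<exists>v f. chart m e n b v f"
    "\<And>p. prime_ideal p \<Longrightarrow> \<exists>b\<in>F. b \<notin> p" using assms unfolding charts_cover_def by metis
  have "\<exists>v f. chart m (polymat e) n [:x:] v f" if x: "x \<in> F" for x
  proof -
    obtain v f where "chart m e n x v f" using F(2)[OF x] by auto
    then have "chart m (polymat e) n [:x:] (\<lambda>i. cst (v i)) (\<lambda>i. cst (f i))"
      unfolding chart_def by (simp add: Pmod_cst_iff dot_cst)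
    then show ?thesis by blast
  qed
  moreover have "\<exists>b\<in>(\<lambda>x. [:x:]) ` F. b \<notin> p" if "prime_ideal p" for p
    using F(3)[OF prime_contr[OF that]] by (auto simp: contr_def)
  ultimately show ?thesis
    unfolding charts_cover_def using F(1) by (intro exI[of _ "(\<lambda>x. [:x:]) ` F"]) simp
qed

section \<open>Points of the quadric and their homotopies\<close>

type_synonym 'b coords = "'b vec \<times> 'b vec \<times> 'b"

text \<open>The first component of a point is any row vector that induces the functional on \<open>P\<close>; it is not
  unique, and \<open>tr\<close> forgets the choice.\<close>
definition QC :: "nat \<Rightarrow> 'b::comm_ring_1 mat \<Rightarrow> 'b coords set" where
  "QC m e = {(f, p, s). p \<in> Pmod m e \<and> dot m f p + s * (s - 1) = 0}"

definition idl :: "nat \<Rightarrow> 'b::comm_ring_1 mat \<Rightarrow> 'b coords \<Rightarrow> 'b set" where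
  "idl m e u = (case u of (f, p, s) \<Rightarrow> {dot m f q + a * s | q a. q \<in> Pmod m e})"

definition lin :: "nat \<Rightarrow> 'b::comm_ring_1 mat \<Rightarrow> 'b vec \<Rightarrow> 'b vec \<Rightarrow> 'b" where
  "lin m e f = (\<lambda>v. if v \<in> Pmod m e then dot m f v else 0)"

definition tr :: "nat \<Rightarrow> 'b::comm_ring_1 mat \<Rightarrow> 'b coords \<Rightarrow> 'b triple" where
  "tr m e u = (case u of (f, p, s) \<Rightarrow> (lin m e f, p, s))"

definition evt :: "'b::comm_ring_1 \<Rightarrow> 'b poly coords \<Rightarrow> 'b coords" where
  "evt t W = (case W of (f, p, s) \<Rightarrow> (ev t f, ev t p, poly s t))"

definition cstt :: "'b::comm_ring_1 coords \<Rightarrow> 'b poly coords" where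
  "cstt u = (case u of (f, p, s) \<Rightarrow> (cst f, cst p, [:s:]))"

lemma is_ideal_idl: "is_ideal (idl m e u)"
proof (cases u)
  case (fields f p s)
  have 1: "x \<in> idl m e u \<longleftrightarrow> (\<exists>q a. q \<in> Pmod m e \<and> x = dot m f q + a * s)" for x
    unfolding idl_def fields by auto
  show ?thesis
    unfolding is_ideal_def
  proof (intro conjI allI ballI)
    show "0 \<in> idl m e u"
      unfolding 1 using Pmod_zero by (intro exI[of _ "\<lambda>i. 0"] exI[of _ 0]) (simp add: dot_simps)
  next
    fix x y assume "x \<in> idl m e u" "y \<in> idl m e u"
    then obtain q a q' a' where "q \<in> Pmod m e" "q' \<in> Pmod m e"
      "x = dot m f q + a * s" "y = dot m f q' + a' * s" unfolding 1 by auto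
    then show "x + y \<in> idl m e u"
      unfolding 1 by (intro exI[of _ "\<lambda>i. q i + q' i"] exI[of _ "a + a'"])
        (simp add: Pmod_add dot_simps algebra_simps)
  next
    fix c x assume "x \<in> idl m e u"
    then obtain q a where "q \<in> Pmod m e" "x = dot m f q + a * s" unfolding 1 by auto
    then show "c * x \<in> idl m e u"
      unfolding 1 by (intro exI[of _ "\<lambda>i. c * q i"] exI[of _ "c * a"])
        (simp add: Pmod_smult dot_simps algebra_simps)
  qed
qed

lemma idl_dot: "v \<in> Pmod m e \<Longrightarrow> dot m f v \<in> idl m e (f, p, s)"
  unfolding idl_def by (auto intro!: exI[of _ v] exI[of _ 0])

lemma idl_scalar: "s \<in> idl m e (f, p, s)"
  unfolding idl_def using Pmod_zero[of m e]
  by (auto intro!: exI[of _ "\<lambda>i. 0"] exI[of _ 1] simp: dot_simps)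

lemma idl_least:
  "is_ideal I \<Longrightarrow> (\<And>v. v \<in> Pmod m e \<Longrightarrow> dot m f v \<in> I) \<Longrightarrow> s \<in> I \<Longrightarrow> idl m e (f, p, s) \<subseteq> I"
  unfolding idl_def by (auto intro!: ideal_add ideal_mult)

lemma lin_in_dual: "lin m e f \<in> dual m e"
  unfolding dual_def lin_def vadd_def vsmult_def
  by (auto simp: Pmod_add Pmod_smult dot_simps)

lemma tr_in_Qt: "u \<in> QC m e \<Longrightarrow> tr m e u \<in> Qt m e"
  unfolding QC_def Qt_def tr_def using lin_in_dual by (auto simp: lin_def)

lemma dual_sum:
  assumes f: "f \<in> dual m e" and "finite S" "\<And>k. k \<in> S \<Longrightarrow> w k \<in> Pmod m e"
  shows "f (\<lambda>i. \<Sum>k\<in>S. c k * w k i) = (\<Sum>k\<in>S. c k * f (w k))"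
  using assms(2,3)
proof (induction S rule: finite_induct)
  case empty
  have "f (vsmult 0 (\<lambda>i. 0)) = 0 * f (\<lambda>i. 0)" using f Pmod_zero unfolding dual_def by blast
  then show ?case by (simp add: vsmult_def)
next
  case (insert k S)
  let ?v = "vsmult (c k) (w k)" and ?w = "\<lambda>i. \<Sum>k\<in>S. c k * w k i"
  have P: "?v \<in> Pmod m e" "?w \<in> Pmod m e" "w k \<in> Pmod m e"
    unfolding vsmult_def using insert.prems by (auto intro!: Pmod_smult Pmod_sum)
  have "f (vadd ?v ?w) = f ?v + f ?w" using f P unfolding dual_def by blast
  moreover have "f ?v = c k * f (w k)" using f P(3) unfolding dual_def by blast
  ultimately show ?case using insert by (simp add: vadd_def vsmult_def)
qed

text \<open>The columns of \<open>e\<close> generate \<open>P\<close>, so the values on them form a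
  row vector that induces \<open>f\<close>.\<close>

lemma dual_eq_lin:
  assumes e: "idempotent_mat m e" and f: "f \<in> dual m e"
  shows "f = lin m e (\<lambda>k. f (col m e k))"
proof
  fix v show "f v = lin m e (\<lambda>k. f (col m e k)) v"
  proof (cases "v \<in> Pmod m e")
    case True
    have "f v = f (\<lambda>i. \<Sum>k<m. v k * col m e k i)" using Pmod_expand[OF True] by simp
    also have "\<dots> = (\<Sum>k<m. v k * f (col m e k))"
      by (rule dual_sum[OF f]) (auto simp: col_in_Pmod[OF e])
    finally show ?thesis using True by (simp add: lin_def dot_def mult.commute)
  next
    case False
    then show ?thesis using f by (simp add: lin_def dual_def)
  qed
qed

lemma Qt_tr:
  assumes e: "idempotent_mat m e" and x: "x \<in> Qt m e"
  obtains u where "u \<in> QC m e" "x = tr m e u"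
proof -
  obtain f p s where x': "x = (f, p, s)" "f \<in> dual m e" "p \<in> Pmod m e" "f p + s * (s - 1) = 0"
    using x unfolding Qt_def by auto
  have f: "f = lin m e (\<lambda>k. f (col m e k))" by (rule dual_eq_lin[OF e x'(2)])
  have "f p = dot m (\<lambda>k. f (col m e k)) p"
    using fun_cong[OF f, of p] x'(3) by (simp add: lin_def)
  then have "((\<lambda>k. f (col m e k)), p, s) \<in> QC m e" using x' by (simp add: QC_def)
  moreover have "x = tr m e ((\<lambda>k. f (col m e k)), p, s)" using x'(1) f by (simp add: tr_def)
  ultimately show ?thesis using that by blast
qed

lemma ev_triple_tr: "ev_triple m e t (tr m (polymat e) W) = tr m e (evt t W)"
proof (cases W)
  case (fields f p s)
  have "(\<lambda>v. if v \<in> Pmod m e then poly (lin m (polymat e) f (\<lambda>i. [:v i:])) t else 0) = lin m e (ev t f)"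
  proof
    fix v
    show "(if v \<in> Pmod m e then poly (lin m (polymat e) f (\<lambda>i. [:v i:])) t else 0) = lin m e (ev t f) v"
      using Pmod_cst_iff[of v m e] dot_ev[of m t f "cst v"] by (simp add: lin_def) (simp add: cst_def)
  qed
  then show ?thesis by (simp add: fields ev_triple_def tr_def evt_def ev_def)
qed

lemma evt_QC: "W \<in> QC m (polymat e) \<Longrightarrow> evt t W \<in> QC m e"
  unfolding QC_def evt_def by (auto simp: Pmod_ev dot_ev simp flip: poly_add poly_mult poly_diff)
    (metis (no_types, opaque_lifting) poly_0 poly_1 poly_add poly_diff poly_mult)

lemma cstt_QC: "u \<in> QC m e \<Longrightarrow> cstt u \<in> QC m (polymat e)"
  unfolding QC_def cstt_def by (auto simp: Pmod_cst_iff dot_cst one_pCons) (simp add: mult.commute)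

lemma evt_cstt [simp]: "evt t (cstt u) = u"
  by (cases u) (simp add: evt_def cstt_def)

text \<open>Elements of A and of \<open>P\<close> lift to constants, so evaluation maps onto the
  ideal of the value and not merely into it.\<close>

lemma idl_evt: "idl m e (evt t W) = (\<lambda>h. poly h t) ` idl m (polymat e) W"
proof (cases W)
  case (fields f p s)
  show ?thesis
  proof (intro subset_antisym subsetI)
    fix x assume "x \<in> idl m e (evt t W)"
    then obtain q a where q: "q \<in> Pmod m e" "x = dot m (ev t f) q + a * poly s t"
      unfolding idl_def evt_def fields by auto
    have "x = poly (dot m f (cst q) + [:a:] * s) t"
      using q(2) dot_ev[of m t f "cst q"] by simp
    moreover have "dot m f (cst q) + [:a:] * s \<in> idl m (polymat e) W"
      unfolding idl_def fields prod.case using q(1) Pmod_cst_iff by blast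
    ultimately show "x \<in> (\<lambda>h. poly h t) ` idl m (polymat e) W" by (rule image_eqI)
  next
    fix x assume "x \<in> (\<lambda>h. poly h t) ` idl m (polymat e) W"
    then obtain q a where q: "q \<in> Pmod m (polymat e)" "x = poly (dot m f q + a * s) t"
      unfolding idl_def fields by auto
    have "x = dot m (ev t f) (ev t q) + poly a t * poly s t" using q by (simp add: dot_ev)
    then show "x \<in> idl m e (evt t W)"
      unfolding idl_def evt_def fields using Pmod_ev[OF q(1)] by auto
  qed
qed

lemma idl_cstt: "c \<in> idl m e u \<Longrightarrow> [:c:] \<in> idl m (polymat e) (cstt u)"
proof (cases u)
  case (fields f p s)
  assume "c \<in> idl m e u"
  then obtain q a where q: "q \<in> Pmod m e" "c = dot m f q + a * s"
    unfolding idl_def fields by auto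
  have "[:c:] = dot m (cst f) (cst q) + [:a:] * [:s:]" using q by (simp add: dot_cst)
  then show ?thesis
    unfolding idl_def cstt_def fields prod.case using q(1) Pmod_cst_iff[of q m e] by blast
qed

lemma htp_rel_refl: "(x, x) \<in> htp_rel m e"
  by (simp add: htp_rel_def)

lemma htp_rel_sym: "(x, y) \<in> htp_rel m e \<Longrightarrow> (y, x) \<in> htp_rel m e"
  unfolding htp_rel_def by (rule symD[OF sym_rtrancl]) (auto simp: sym_def)

lemma htp_rel_trans: "(x, y) \<in> htp_rel m e \<Longrightarrow> (y, z) \<in> htp_rel m e \<Longrightarrow> (x, z) \<in> htp_rel m e"
  unfolding htp_rel_def by (rule rtrancl_trans)

lemma htp_rel_evt:
  "W \<in> QC m (polymat e) \<Longrightarrow> (tr m e (evt 0 W), tr m e (evt 1 W)) \<in> htp_rel m e"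
  using tr_in_Qt[of W m "polymat e"] unfolding htp_rel_def htp_step_def
  by (intro r_into_rtrancl UnI1 CollectI exI[of _ "tr m (polymat e) W"]) (simp add: ev_triple_tr)

section \<open>Nakayama's lemma and points over an orientation\<close>

lemma nakayama_step:
  assumes I: "is_ideal I" and K: "is_ideal K" and NK: "N \<subseteq> K" and g: "g \<in> I"
    and I2: "\<And>a. a \<in> I \<Longrightarrow> \<exists>n\<in>N. a - n \<in> ideal_prod I I"
    and s: "s \<in> I" "\<And>x. x \<in> I \<Longrightarrow> (1 - s) * x \<in> adjoin K g"
  shows "\<exists>s\<in>I. \<forall>x\<in>I. (1 - s) * x \<in> K"
proof -
  \<comment> \<open>\<open>L\<close> is \<open>K + Ig\<close>. Modulo \<open>K\<close> the ideal
    \<open>(1 - s)I\<close> lies in \<open>Ag\<close>, so \<open>1 - s\<close> takes the square of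
    \<open>I\<close> into \<open>L\<close>. Applied to \<open>g - n\<close> this produces
    \<open>y \<in> I\<close> such that \<open>1 - s - y\<close> kills \<open>g\<close> modulo
    \<open>K\<close>.\<close>
  define L where "L = {x. \<exists>y\<in>I. x - y * g \<in> K}"
  have L: "is_ideal L"
    unfolding is_ideal_def
  proof (intro conjI allI ballI)
    show "0 \<in> L" unfolding L_def using ideal_zero[OF I] ideal_zero[OF K] by (intro CollectI bexI[of _ 0]) auto
  next
    fix x y assume "x \<in> L" "y \<in> L"
    then obtain z w where zw: "z \<in> I" "w \<in> I" "x - z * g \<in> K" "y - w * g \<in> K" unfolding L_def by auto
    have "(x - z * g) + (y - w * g) \<in> K" using zw K ideal_add by blast
    then show "x + y \<in> L" unfolding L_def
      using zw I ideal_add by (intro CollectI bexI[of _ "z + w"]) (auto simp: algebra_simps)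
  next
    fix c x assume "x \<in> L"
    then obtain z where z: "z \<in> I" "x - z * g \<in> K" unfolding L_def by auto
    have "c * (x - z * g) \<in> K" "c * z \<in> I" using z K I ideal_mult by blast+
    then show "c * x \<in> L" unfolding L_def
      by (intro CollectI bexI[of _ "c * z"]) (auto simp: algebra_simps)
  qed
  have "ideal_prod I I \<subseteq> {x. x * (1 - s) \<in> L}"
  proof (rule ideal_prod_least[OF is_ideal_vimage_mult[OF L]])
    fix a b assume ab: "a \<in> I" "b \<in> I"
    obtain j x where j: "j \<in> K" "(1 - s) * b = j + x * g" using s(2)[OF ab(2)] unfolding adjoin_def by auto
    have "a * b * (1 - s) = a * ((1 - s) * b)" by (simp add: algebra_simps)
    also have "\<dots> - (a * x) * g = a * j" unfolding j(2) by (simp add: algebra_simps)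
    finally have "a * b * (1 - s) - (a * x) * g \<in> K" using j(1) K ideal_mult by simp
    moreover have "a * x \<in> I" using ab(1) I ideal_mult_right by blast
    ultimately show "a * b \<in> {x. x * (1 - s) \<in> L}" unfolding L_def by blast
  qed
  moreover obtain n where n: "n \<in> N" "g - n \<in> ideal_prod I I" using I2[OF g] by blast
  ultimately obtain y where y: "y \<in> I" "(g - n) * (1 - s) - y * g \<in> K" unfolding L_def by blast
  have "n * (1 - s) \<in> K" using n(1) NK K ideal_mult_right by blast
  then have "((g - n) * (1 - s) - y * g) + n * (1 - s) \<in> K" using y(2) K ideal_add by blast
  then have gK: "(1 - s - y) * g \<in> K" by (simp add: algebra_simps)
  \<comment> \<open>Chosen so that \<open>1 - s' = (1 - s) * (1 - s - y)\<close>: one factor brings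
    \<open>x\<close> into \<open>K + Ag\<close>, the other sends \<open>g\<close> into
    \<open>K\<close>.\<close>
  define s' where "s' = s + (s + y) * (1 - s)"
  have "s' \<in> I" unfolding s'_def using s(1) y(1) I ideal_add ideal_mult_right by blast
  moreover have "(1 - s') * x \<in> K" if xI: "x \<in> I" for x
  proof -
    obtain j z where j: "j \<in> K" "(1 - s) * x = j + z * g" using s(2)[OF xI] unfolding adjoin_def by auto
    have "(1 - s') * x = (1 - s - y) * ((1 - s) * x)" unfolding s'_def by (simp add: algebra_simps)
    also have "\<dots> = (1 - s - y) * j + z * ((1 - s - y) * g)" unfolding j(2) by (simp add: algebra_simps)
    also have "\<dots> \<in> K" by (intro ideal_add ideal_mult K j gK)
    finally show ?thesis .
  qed
  ultimately show ?thesis by blast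
qed

text \<open>Starts from \<open>s = 0\<close> with all generators of \<open>I\<close> adjoined to
  \<open>N\<close> and drops them one at a time by \<open>nakayama_step\<close>, in place of the
  determinant argument.\<close>

lemma nakayama:
  fixes I :: "'b::comm_ring_1 set"
  assumes noeth: "noetherian TYPE('b)" and I: "is_ideal I" and N: "is_ideal N"
    and I2: "\<And>a. a \<in> I \<Longrightarrow> \<exists>n\<in>N. a - n \<in> ideal_prod I I"
  shows "\<exists>s\<in>I. \<forall>x\<in>I. (1 - s) * x \<in> N"
proof -
  obtain F where F: "finite F" "I = ideal_gen F" using noeth I unfolding noetherian_def by meson
  have FI: "F \<subseteq> I" using F(2) ideal_gen_superset by simp
  have "\<exists>s\<in>I. \<forall>x\<in>I. (1 - s) * x \<in> N" if "\<exists>s\<in>I. \<forall>x\<in>I. (1 - s) * x \<in> ideal_gen (N \<union> F)"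
    using F(1) FI that
  proof (induction F rule: finite_induct)
    case empty
    then show ?case using ideal_gen_least[OF N, of N] by auto
  next
    case (insert g G)
    let ?K = "ideal_gen (N \<union> G)"
    obtain s where s: "s \<in> I" "\<And>x. x \<in> I \<Longrightarrow> (1 - s) * x \<in> ideal_gen (N \<union> insert g G)"
      using insert.prems by blast
    have "N \<union> G \<subseteq> ?K" by (rule ideal_gen_superset)
    then have "N \<union> insert g G \<subseteq> adjoin ?K g"
      using adjoin_superset[of ?K g] adjoin_mem[OF is_ideal_gen, of g "N \<union> G"] by blast
    then have "ideal_gen (N \<union> insert g G) \<subseteq> adjoin ?K g"
      by (rule ideal_gen_least[OF is_ideal_adjoin[OF is_ideal_gen]])
    then have "\<exists>s\<in>I. \<forall>x\<in>I. (1 - s) * x \<in> ?K"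
      using s \<open>N \<union> G \<subseteq> ?K\<close> insert.prems(1)
      by (intro nakayama_step[OF I is_ideal_gen _ _ I2 s(1), of "N \<union> G" g]) auto
    then show ?case using insert by simp
  qed
  moreover have "I \<subseteq> ideal_gen (N \<union> F)" unfolding F(2) by (rule ideal_gen_mono) simp
  then have "\<exists>s\<in>I. \<forall>x\<in>I. (1 - s) * x \<in> ideal_gen (N \<union> F)"
    using ideal_zero[OF I] by (intro bexI[of _ 0]) auto
  ultimately show ?thesis by simp
qed

lemma is_ideal_dot_range: "is_ideal (dot m f ` Pmod m e)"
  unfolding is_ideal_def
proof (intro conjI allI ballI)
  show "0 \<in> dot m f ` Pmod m e"
    by (rule image_eqI[OF _ Pmod_zero]) (simp add: dot_simps)
next
  fix x y assume "x \<in> dot m f ` Pmod m e" "y \<in> dot m f ` Pmod m e"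
  then obtain v w where "x = dot m f v" "y = dot m f w" "v \<in> Pmod m e" "w \<in> Pmod m e" by auto
  then show "x + y \<in> dot m f ` Pmod m e"
    by (intro image_eqI[OF _ Pmod_add[of v m e w]]) (auto simp: dot_simps)
next
  fix c x assume "x \<in> dot m f ` Pmod m e"
  then obtain v where "x = dot m f v" "v \<in> Pmod m e" by auto
  then show "c * x \<in> dot m f ` Pmod m e"
    by (intro image_eqI[OF _ Pmod_smult[of v m e c]]) (auto simp: dot_simps)
qed

text \<open>The element \<open>s\<close> of Nakayama's lemma becomes the third coordinate:
  \<open>(1 - s) * s\<close> lies in \<open>f(P)\<close>, which supplies \<open>p\<close>, and
  \<open>x = (1 - s) * x + x * s\<close> shows that \<open>f(P)\<close> and \<open>s\<close>
  generate \<open>I\<close>.\<close>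

lemma triple_of_orientation:
  fixes I :: "'b::comm_ring_1 set"
  assumes noeth: "noetherian TYPE('b)" and I: "is_ideal I"
    and fI: "\<And>v. v \<in> Pmod m e \<Longrightarrow> dot m f v \<in> I"
    and surj: "\<And>a. a \<in> I \<Longrightarrow> \<exists>v\<in>Pmod m e. a - dot m f v \<in> ideal_prod I I"
  obtains p s where "(f, p, s) \<in> QC m e" "idl m e (f, p, s) = I"
proof -
  obtain s where s: "s \<in> I" "\<forall>x\<in>I. (1 - s) * x \<in> dot m f ` Pmod m e"
    using nakayama[OF noeth I is_ideal_dot_range, of m f e] surj by auto
  then obtain p where p: "p \<in> Pmod m e" "(1 - s) * s = dot m f p" by auto
  have "(f, p, s) \<in> QC m e" using p by (simp add: QC_def flip: p(2)) (simp add: algebra_simps)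
  moreover have "idl m e (f, p, s) = I"
  proof
    show "idl m e (f, p, s) \<subseteq> I" by (rule idl_least[OF I fI s(1)])
    show "I \<subseteq> idl m e (f, p, s)"
    proof
      fix x assume "x \<in> I"
      then obtain q where q: "q \<in> Pmod m e" "(1 - s) * x = dot m f q" using s(2) by auto
      have "x = (1 - s) * x + x * s" by (simp add: algebra_simps)
      then have "x = dot m f q + x * s" using q(2) by simp
      then show "x \<in> idl m e (f, p, s)" unfolding idl_def prod.case using q(1) by blast
    qed
  qed
  ultimately show ?thesis using that by blast
qed

text \<open>On the quadric \<open>s - f(p) = s * s\<close>, so modulo the square of the ideal the
  extra generator \<open>s\<close> is already a value of \<open>f\<close>.\<close>

lemma idl_surj:
  assumes u: "(f, p, s) \<in> QC m e" and a: "a \<in> idl m e (f, p, s)"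
  shows "\<exists>v\<in>Pmod m e. a - dot m f v \<in> ideal_prod (idl m e (f, p, s)) (idl m e (f, p, s))"
proof -
  obtain q c where q: "q \<in> Pmod m e" "a = dot m f q + c * s" using a unfolding idl_def by auto
  have p: "p \<in> Pmod m e" "dot m f p + s * (s - 1) = 0" using u by (auto simp: QC_def)
  have dp: "dot m f p = s - s * s" using p(2) by (simp add: algebra_simps eq_neg_iff_add_eq_0)
  have "a - dot m f (\<lambda>i. q i + c * p i) = c * (s * s)"
    unfolding q(2) dot_simps dp by (simp add: algebra_simps)
  moreover have "c * (s * s) \<in> ideal_prod (idl m e (f, p, s)) (idl m e (f, p, s))"
    by (intro ideal_mult is_ideal_prod ideal_prodI idl_scalar)
  ultimately show ?thesis using q(1) p(1) by (metis Pmod_add Pmod_smult)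
qed

text \<open>Modulo \<open>f(P)\<close> both \<open>s\<close> and \<open>s'\<close> are idempotents
  generating the same ideal, so they agree there and \<open>s' - s = f(q)\<close>. The straight path
  from \<open>s\<close> to \<open>s'\<close> is then lifted with \<open>f\<close> held
  fixed.\<close>

lemma homotopic_same_functional:
  assumes u: "(f, p, s) \<in> QC m e" and u': "(f, p', s') \<in> QC m e"
    and idl: "idl m e (f, p, s) = idl m e (f, p', s')"
  shows "(tr m e (f, p, s), tr m e (f, p', s')) \<in> htp_rel m e"
proof -
  have p: "p \<in> Pmod m e" "dot m f p = s * (1 - s)" and p': "p' \<in> Pmod m e" "dot m f p' = s' * (1 - s')"
    using u u' by (auto simp: QC_def algebra_simps eq_neg_iff_add_eq_0)
  obtain q1 a1 where 1: "q1 \<in> Pmod m e" "s' = dot m f q1 + a1 * s"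
    using idl_scalar[of s' m e f p', folded idl] unfolding idl_def by auto
  obtain q2 a2 where 2: "q2 \<in> Pmod m e" "s = dot m f q2 + a2 * s'"
    using idl_scalar[of s m e f p, unfolded idl] unfolding idl_def by auto
  define q where "q = (\<lambda>i. (1 - s) * q1 i + a1 * p i - ((1 - s') * q2 i + a2 * p' i))"
  have q: "q \<in> Pmod m e" unfolding q_def by (intro Pmod_diff Pmod_add Pmod_smult 1 2 p p')
  have "dot m f q = (1 - s) * (dot m f q1 + a1 * s) - (1 - s') * (dot m f q2 + a2 * s')"
    unfolding q_def by (simp add: dot_simps p p' algebra_simps)
  also have "\<dots> = (1 - s) * s' - (1 - s') * s"
    by (simp only: 1(2)[symmetric] 2(2)[symmetric])
  finally have dq: "dot m f q = s' - s" by (simp add: algebra_simps)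
  define r where "r = dot m f q"
  define F where "F = cst f"
  define S where "S = [:s, r:]"
  \<comment> \<open>For \<open>S = s + rT\<close> the required value is
    \<open>S(1 - S) = s(1 - s) + ((1 - 2s)T - rT^2)r\<close>, attained at
    \<open>p + ((1 - 2s)T - rT^2)q\<close>. At T = 1 this vector differs from \<open>p'\<close> by
    an element of the kernel of \<open>f\<close>, which the last summand corrects linearly.\<close>
  define P where "P = (\<lambda>i. [:p i:] + ([:0, 1:] * [:1 - 2 * s:] - [:0, 0, r:]) * [:q i:]
    + [:0, 1:] * ([:p' i:] - ([:p i:] + ([:1 - 2 * s:] - [:r:]) * [:q i:])))"
  have P: "P = (\<lambda>i. cst p i + ([:0, 1:] * [:1 - 2 * s:] - [:0, 0, r:]) * cst q i
    + [:0, 1:] * (cst p' i - (cst p i + ([:1 - 2 * s:] - [:r:]) * cst q i)))"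
    unfolding P_def cst_def ..
  have PM: "P \<in> Pmod m (polymat e)"
    unfolding P by (intro Pmod_add Pmod_diff Pmod_smult) (simp_all add: Pmod_cst_iff p p' q)
  have s': "s' = s + r" unfolding r_def dq by simp
  have dotP: "dot m F P = [:s * (1 - s):] + ([:0, 1:] * [:1 - 2 * s:] - [:0, 0, r:]) * [:r:]
    + [:0, 1:] * ([:s' * (1 - s'):] - ([:s * (1 - s):] + ([:1 - 2 * s:] - [:r:]) * [:r:]))"
    unfolding P F_def dot_simps dot_cst p p' r_def[symmetric] ..
  have "dot m F P + S * (S - 1) = 0"
    unfolding dotP S_def s' by (simp add: one_pCons algebra_simps)
  then have "(F, P, S) \<in> QC m (polymat e)" using PM by (simp add: QC_def)
  moreover have "evt 0 (F, P, S) = (f, p, s)"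
    by (simp add: evt_def F_def S_def P_def ev_def cst_def)
  moreover have "evt 1 (F, P, S) = (f, p', s')"
    by (simp add: evt_def F_def S_def P_def ev_def cst_def s' algebra_simps)
  ultimately show ?thesis using htp_rel_evt by metis
qed

text \<open>The coordinate form of \<open>eta u = eta u'\<close>.\<close>
definition eta_eq :: "nat \<Rightarrow> 'b::comm_ring_1 mat \<Rightarrow> 'b coords \<Rightarrow> 'b coords \<Rightarrow> bool" where
  "eta_eq m e u u' \<longleftrightarrow> idl m e u = idl m e u' \<and>
     (\<forall>v\<in>Pmod m e. dot m (fst u) v - dot m (fst u') v \<in> ideal_prod (idl m e u) (idl m e u))"

lemma eta_eq_refl: "eta_eq m e u u"
  by (simp add: eta_eq_def ideal_zero[OF is_ideal_prod])

lemma ideal_prod_const_poly: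
  assumes I: "\<And>c. c \<in> I \<Longrightarrow> [:c:] \<in> I'" and c: "c \<in> ideal_prod I I"
  shows "[:c:] \<in> ideal_prod I' I'"
proof -
  have const: "is_ideal {c. [:c:] \<in> J}" if J: "is_ideal J" for J :: "'a poly set"
    unfolding is_ideal_def
  proof (intro conjI allI ballI)
    show "0 \<in> {c. [:c:] \<in> J}" using ideal_zero[OF J] by simp
  next
    fix x y assume "x \<in> {c. [:c:] \<in> J}" "y \<in> {c. [:c:] \<in> J}"
    then show "x + y \<in> {c. [:c:] \<in> J}" using ideal_add[OF J, of "[:x:]" "[:y:]"] by simp
  next
    fix a x assume "x \<in> {c. [:c:] \<in> J}"
    then show "a * x \<in> {c. [:c:] \<in> J}"
      using ideal_mult[OF J, of "[:x:]" "[:a:]"] by (simp add: mult.commute)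
  qed
  have "ideal_prod I I \<subseteq> {c. [:c:] \<in> ideal_prod I' I'}"
  proof (rule ideal_prod_least[OF const[OF is_ideal_prod]])
    fix a b assume "a \<in> I" "b \<in> I"
    then have "[:a:] * [:b:] \<in> ideal_prod I' I'" using I ideal_prodI by blast
    then show "a * b \<in> {c. [:c:] \<in> ideal_prod I' I'}" by (simp add: mult.commute)
  qed
  then show ?thesis using c by auto
qed

text \<open>The linear homotopy between two lifts of the same orientation is again a lift over \<open>A[T]\<close>,
  so Nakayama's lemma completes it to a point of the quadric.\<close>
lemma homotopic_if_eta_eq:
  fixes e :: "'b::comm_ring_1 mat"
  assumes noeth: "noetherian TYPE('b)" and u: "u \<in> QC m e" and u': "u' \<in> QC m e" and eq: "eta_eq m e u u'"
  shows "(tr m e u, tr m e u') \<in> htp_rel m e"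
proof -
  obtain f p s f' p' s' where U: "u = (f, p, s)" "u' = (f', p', s')" by (metis prod_cases3)
  define I where "I = idl m (polymat e) (cstt u)"
  have I: "is_ideal I" unfolding I_def by (rule is_ideal_idl)
  define F where "F = (\<lambda>i. cst f i + [:0, 1:] * (cst f' i - cst f i))"
  have F: "dot m F v = dot m (cst f) v + [:0, 1:] * (dot m (cst f') v - dot m (cst f) v)" for v
    unfolding F_def dot_simps ..
  \<comment> \<open>On \<open>P\<close> the values of \<open>f' - f\<close> lie in the square of the
    ideal of \<open>u\<close>; on P[T] this is checked coefficient by coefficient.\<close>
  have sq: "[:0, 1:] * (dot m (cst f') v - dot m (cst f) v) \<in> ideal_prod I I"
    if v: "v \<in> Pmod m (polymat e)" for v
  proof (rule ideal_mult[OF is_ideal_prod], rule poly_mem_if_coeffs[OF is_ideal_prod],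
      rule ideal_prod_const_poly[where I = "idl m e u"])
    show "[:c:] \<in> I" if "c \<in> idl m e u" for c unfolding I_def by (rule idl_cstt[OF that])
    fix k
    have "dot m f (\<lambda>i. coeff (v i) k) - dot m f' (\<lambda>i. coeff (v i) k) \<in> ideal_prod (idl m e u) (idl m e u)"
      using eq Pmod_coeff[OF v, of k] unfolding eta_eq_def U by auto
    from ideal_uminus[OF is_ideal_prod this]
    show "coeff (dot m (cst f') v - dot m (cst f) v) k \<in> ideal_prod (idl m e u) (idl m e u)"
      by (simp add: coeff_dot_cst)
  qed
  have cu: "(cst f, cst p, [:s:]) \<in> QC m (polymat e)" using cstt_QC[OF u] unfolding U cstt_def by simp
  have I': "I = idl m (polymat e) (cst f, cst p, [:s:])" unfolding I_def U cstt_def by simp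
  obtain P S where W: "(F, P, S) \<in> QC m (polymat e)" "idl m (polymat e) (F, P, S) = I"
  proof (rule triple_of_orientation[OF hilbert_basis[OF noeth] I])
    fix v assume v: "v \<in> Pmod m (polymat e)"
    have "dot m (cst f) v \<in> I" unfolding I' by (rule idl_dot[OF v])
    moreover have "[:0, 1:] * (dot m (cst f') v - dot m (cst f) v) \<in> I"
      using sq[OF v] ideal_prod_subset_left[OF I] by blast
    ultimately show "dot m F v \<in> I" unfolding F by (rule ideal_add[OF I])
  next
    fix a assume "a \<in> I"
    then obtain v where v: "v \<in> Pmod m (polymat e)" "a - dot m (cst f) v \<in> ideal_prod I I"
      using idl_surj[OF cu, of a] unfolding I' by auto
    have *: "a - dot m F v = (a - dot m (cst f) v) - [:0, 1:] * (dot m (cst f') v - dot m (cst f) v)"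
      unfolding F by simp
    have "a - dot m F v \<in> ideal_prod I I"
      unfolding * by (rule ideal_diff[OF is_ideal_prod v(2) sq[OF v(1)]])
    then show "\<exists>v\<in>Pmod m (polymat e). a - dot m F v \<in> ideal_prod I I" using v(1) by blast
  qed blast
  \<comment> \<open>The ends have the functionals \<open>f\<close> and \<open>f'\<close>, but their
    other coordinates come from Nakayama's lemma; \<open>homotopic_same_functional\<close> joins
    them to \<open>u\<close> and \<open>u'\<close>.\<close>
  have ev01: "evt 0 (F, P, S) = (f, ev 0 P, poly S 0)" "evt 1 (F, P, S) = (f', ev 1 P, poly S 1)"
    by (auto simp: evt_def F_def ev_def cst_def)
  have "idl m e (evt t (F, P, S)) = idl m e u" for t
    using idl_evt[of m e t "(F, P, S)"] idl_evt[of m e t "cstt u"] unfolding W I_def by simp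
  then have idl: "idl m e (f, p, s) = idl m e (f, ev 0 P, poly S 0)"
    "idl m e (f', ev 1 P, poly S 1) = idl m e (f', p', s')"
    using ev01 eq unfolding eta_eq_def U by metis+
  have Q: "(f, ev 0 P, poly S 0) \<in> QC m e" "(f', ev 1 P, poly S 1) \<in> QC m e"
    using evt_QC[OF W(1), of 0] evt_QC[OF W(1), of 1] unfolding ev01 by auto
  have "(tr m e u, tr m e (f, ev 0 P, poly S 0)) \<in> htp_rel m e"
    using homotopic_same_functional[OF _ Q(1) idl(1)] u unfolding U by simp
  moreover have "(tr m e (f, ev 0 P, poly S 0), tr m e (f', ev 1 P, poly S 1)) \<in> htp_rel m e"
    using htp_rel_evt[OF W(1)] unfolding ev01 .
  moreover have "(tr m e (f', ev 1 P, poly S 1), tr m e u') \<in> htp_rel m e"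
    using homotopic_same_functional[OF Q(2) _ idl(2)] u' unfolding U by simp
  ultimately show ?thesis by (meson htp_rel_trans)
qed

section \<open>Star products of points with comaximal ideals\<close>

definition star_rel :: "nat \<Rightarrow> 'b::comm_ring_1 mat \<Rightarrow> 'b coords \<Rightarrow> 'b coords \<Rightarrow> 'b coords \<Rightarrow> bool" where
  "star_rel m e u v w \<longleftrightarrow> w \<in> QC m e \<and> idl m e w = ideal_prod (idl m e u) (idl m e v) \<and>
     (\<forall>x\<in>Pmod m e. dot m (fst w) x - dot m (fst u) x \<in> ideal_prod (idl m e u) (idl m e u) \<and>
                   dot m (fst w) x - dot m (fst v) x \<in> ideal_prod (idl m e v) (idl m e v))"

lemma star_rel_commute: "star_rel m e u v w \<Longrightarrow> star_rel m e v u w"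
  unfolding star_rel_def by (simp add: ideal_prod_commute)

text \<open>With \<open>b\<close> in the square of \<open>I\<close>, \<open>a\<close> in the square
  of \<open>J\<close> and \<open>a + b = 1\<close>, the functional \<open>g = a f + b f'\<close> is
  congruent to \<open>f\<close> modulo the first square and to \<open>f'\<close> modulo the second.
  Surjectivity is likewise tested modulo each square, on \<open>z = a x + b y\<close>.\<close>

lemma star_exists:
  fixes e :: "'b::comm_ring_1 mat"
  assumes noeth: "noetherian TYPE('b)" and u: "u \<in> QC m e" and v: "v \<in> QC m e"
    and co: "comax (idl m e u) (idl m e v)"
  shows "\<exists>w. star_rel m e u v w"
proof -
  obtain f p s f' p' s' where U: "u = (f, p, s)" "v = (f', p', s')" by (metis prod_cases3)
  define I where "I = idl m e u"
  define J where "J = idl m e v"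
  have I: "is_ideal I" and J: "is_ideal J" unfolding I_def J_def by (rule is_ideal_idl)+
  obtain b a where ab: "b \<in> ideal_prod I I" "a \<in> ideal_prod J J" "b + a = 1"
    using comax_squares[OF I J] co unfolding I_def J_def comax_def by auto
  define g where "g = (\<lambda>i. a * f i + b * f' i)"
  have g: "dot m g x = a * dot m f x + b * dot m f' x" for x unfolding g_def dot_simps ..
  have a1: "a = 1 - b" and b1: "b = 1 - a" using ab(3) by (auto simp: algebra_simps)
  have gI: "dot m g x - dot m f x \<in> ideal_prod I I" for x
  proof -
    have "dot m g x - dot m f x = (dot m f' x - dot m f x) * b" unfolding g a1 by (simp add: algebra_simps)
    then show ?thesis using ab(1) ideal_mult[OF is_ideal_prod] by simp
  qed
  have gJ: "dot m g x - dot m f' x \<in> ideal_prod J J" for x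
  proof -
    have "dot m g x - dot m f' x = (dot m f x - dot m f' x) * a" unfolding g b1 by (simp add: algebra_simps)
    then show ?thesis using ab(2) ideal_mult[OF is_ideal_prod] by simp
  qed
  have "\<exists>p s. (g, p, s) \<in> QC m e \<and> idl m e (g, p, s) = ideal_prod I J"
  proof (rule triple_of_orientation[OF noeth is_ideal_prod])
    fix x assume x: "x \<in> Pmod m e"
    have "dot m f x \<in> I" "dot m f' x \<in> J" unfolding I_def J_def U by (rule idl_dot[OF x])+
    then have "(dot m g x - dot m f x) + dot m f x \<in> I" "(dot m g x - dot m f' x) + dot m f' x \<in> J"
      using gI gJ ideal_prod_subset_left[OF I] ideal_prod_subset_left[OF J]
      by (meson ideal_add[OF I] ideal_add[OF J] subsetD)+
    then show "dot m g x \<in> ideal_prod I J"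
      using inter_subset_prod[OF I J co[folded I_def J_def]] by simp
  next
    fix c assume "c \<in> ideal_prod I J"
    then have c: "c \<in> I" "c \<in> J" using ideal_prod_subset_left[OF I] ideal_prod_subset_right[OF J] by auto
    obtain x where x: "x \<in> Pmod m e" "c - dot m f x \<in> ideal_prod I I"
      using idl_surj[of f p s m e c] u c(1) unfolding U I_def by auto
    obtain y where y: "y \<in> Pmod m e" "c - dot m f' y \<in> ideal_prod J J"
      using idl_surj[of f' p' s' m e c] v c(2) unfolding U J_def by auto
    define z where "z = (\<lambda>i. a * x i + b * y i)"
    have z: "z \<in> Pmod m e" unfolding z_def by (intro Pmod_add Pmod_smult x y)
    have *: "c - dot m g z = ((c - dot m f x) + b * (dot m f x - dot m f y)) - (dot m g z - dot m f z)"
      unfolding z_def dot_simps a1 by (simp add: algebra_simps)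
    have "c - dot m g z \<in> ideal_prod I I"
      unfolding * by (intro ideal_diff ideal_add is_ideal_prod x(2) gI ideal_mult_right ab(1))
    have **: "c - dot m g z = ((c - dot m f' y) + a * (dot m f' y - dot m f' x)) - (dot m g z - dot m f' z)"
      unfolding z_def dot_simps b1 by (simp add: algebra_simps)
    have "c - dot m g z \<in> ideal_prod J J"
      unfolding ** by (intro ideal_diff ideal_add is_ideal_prod y(2) gJ ideal_mult_right ab(2))
    then show "\<exists>z\<in>Pmod m e. c - dot m g z \<in> ideal_prod (ideal_prod I J) (ideal_prod I J)"
      using inter_squares[OF I J co[folded I_def J_def] \<open>c - dot m g z \<in> ideal_prod I I\<close>] z by blast
  qed blast
  then obtain p'' s'' where "(g, p'', s'') \<in> QC m e" "idl m e (g, p'', s'') = ideal_prod I J" by blast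
  then have "star_rel m e u v (g, p'', s'')"
    unfolding star_rel_def using gI gJ unfolding I_def J_def U by simp
  then show ?thesis ..
qed

text \<open>\<open>star_rel\<close> leaves many choices of the point, but all induce one
  orientation: the functionals agree modulo both squares, hence modulo the square of the
  product.\<close>

lemma star_eta_eq:
  assumes w: "star_rel m e u v w" and w': "star_rel m e u' v' w'" and uu: "eta_eq m e u u'"
    and vv: "eta_eq m e v v'" and co: "comax (idl m e u) (idl m e v)"
  shows "eta_eq m e w w'"
proof -
  let ?I = "idl m e u" and ?J = "idl m e v"
  have idl: "idl m e u' = ?I" "idl m e v' = ?J" using uu vv unfolding eta_eq_def by auto
  have "dot m (fst w) x - dot m (fst w') x \<in> ideal_prod (ideal_prod ?I ?J) (ideal_prod ?I ?J)"
    if x: "x \<in> Pmod m e" for x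
  proof (rule inter_squares[OF is_ideal_idl is_ideal_idl co])
    have "dot m (fst w) x - dot m (fst u) x \<in> ideal_prod ?I ?I"
      "dot m (fst u) x - dot m (fst u') x \<in> ideal_prod ?I ?I"
      "dot m (fst w') x - dot m (fst u') x \<in> ideal_prod ?I ?I"
      using w[unfolded star_rel_def] uu[unfolded eta_eq_def] w'[unfolded star_rel_def idl] x by blast+
    then have "(dot m (fst w) x - dot m (fst u) x) + (dot m (fst u) x - dot m (fst u') x)
        - (dot m (fst w') x - dot m (fst u') x) \<in> ideal_prod ?I ?I"
      by (meson ideal_add ideal_diff is_ideal_prod)
    then show "dot m (fst w) x - dot m (fst w') x \<in> ideal_prod ?I ?I" by simp
  next
    have "dot m (fst w) x - dot m (fst v) x \<in> ideal_prod ?J ?J"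
      "dot m (fst v) x - dot m (fst v') x \<in> ideal_prod ?J ?J"
      "dot m (fst w') x - dot m (fst v') x \<in> ideal_prod ?J ?J"
      using w[unfolded star_rel_def] vv[unfolded eta_eq_def] w'[unfolded star_rel_def idl] x by blast+
    then have "(dot m (fst w) x - dot m (fst v) x) + (dot m (fst v) x - dot m (fst v') x)
        - (dot m (fst w') x - dot m (fst v') x) \<in> ideal_prod ?J ?J"
      by (meson ideal_add ideal_diff is_ideal_prod)
    then show "dot m (fst w) x - dot m (fst w') x \<in> ideal_prod ?J ?J" by simp
  qed
  then show ?thesis using w w' idl unfolding eta_eq_def star_rel_def by simp
qed

lemma poly_image_ideal_prod:
  fixes I J :: "'b::comm_ring_1 poly set"
  shows "(\<lambda>h. poly h t) ` ideal_prod I J = ideal_prod ((\<lambda>h. poly h t) ` I) ((\<lambda>h. poly h t) ` J)"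
    (is "?ev ` _ = ?R")
proof
  have R: "is_ideal {h. ?ev h \<in> ?R}"
    unfolding is_ideal_def
    using ideal_zero[OF is_ideal_prod] ideal_add[OF is_ideal_prod] ideal_mult[OF is_ideal_prod] by auto
  have "ideal_prod I J \<subseteq> {h. ?ev h \<in> ?R}"
    by (rule ideal_prod_least[OF R]) (auto intro!: ideal_prodI)
  then show "?ev ` ideal_prod I J \<subseteq> ?R" by auto
next
  have "is_ideal (?ev ` ideal_prod I J)"
    unfolding is_ideal_def
  proof (intro conjI allI ballI)
    show "0 \<in> ?ev ` ideal_prod I J"
      by (rule image_eqI[OF _ ideal_zero[OF is_ideal_prod]]) simp
  next
    fix x y assume "x \<in> ?ev ` ideal_prod I J" "y \<in> ?ev ` ideal_prod I J"
    then obtain h k where "x = ?ev h" "y = ?ev k" "h \<in> ideal_prod I J" "k \<in> ideal_prod I J" by auto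
    then show "x + y \<in> ?ev ` ideal_prod I J"
      by (intro image_eqI[of _ _ "h + k"]) (auto intro: ideal_add is_ideal_prod)
  next
    fix c x assume "x \<in> ?ev ` ideal_prod I J"
    then obtain h where "x = ?ev h" "h \<in> ideal_prod I J" by auto
    then show "c * x \<in> ?ev ` ideal_prod I J"
      by (intro image_eqI[of _ _ "[:c:] * h"]) (auto intro: ideal_mult is_ideal_prod simp del: mult_pCons_left)
  qed
  then show "?R \<subseteq> ?ev ` ideal_prod I J"
  proof (rule ideal_prod_least)
    fix a b assume "a \<in> ?ev ` I" "b \<in> ?ev ` J"
    then obtain h k where "a = ?ev h" "b = ?ev k" "h \<in> I" "k \<in> J" by auto
    then show "a * b \<in> ?ev ` ideal_prod I J"
      by (intro image_eqI[of _ _ "h * k"]) (auto intro: ideal_prodI)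
  qed
qed

lemma fst_evt: "fst (evt t W) = ev t (fst W)"
  by (cases W) (simp add: evt_def)

text \<open>Evaluation respects products of ideals and congruences, so a star product formed over
  A[T] restricts to star products at both ends of a homotopy.\<close>

lemma star_evt:
  assumes "star_rel m (polymat e) U V W"
  shows "star_rel m e (evt t U) (evt t V) (evt t W)"
proof -
  have cong: "dot m (fst (evt t W)) x - dot m (fst (evt t X)) x
      \<in> ideal_prod (idl m e (evt t X)) (idl m e (evt t X))"
    if "dot m (fst W) (cst x) - dot m (fst X) (cst x) \<in> ideal_prod (idl m (polymat e) X) (idl m (polymat e) X)"
    for X x
  proof -
    have *: "dot m (fst (evt t W)) x - dot m (fst (evt t X)) x
        = poly (dot m (fst W) (cst x) - dot m (fst X) (cst x)) t"
      using dot_ev[of m t "fst W" "cst x"] dot_ev[of m t "fst X" "cst x"] by (simp add: fst_evt)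
    show ?thesis
      unfolding idl_evt poly_image_ideal_prod[symmetric] by (rule image_eqI[where f = "\<lambda>h. poly h t", OF * that])
  qed
  have "idl m e (evt t W) = ideal_prod (idl m e (evt t U)) (idl m e (evt t V))"
    using assms unfolding star_rel_def idl_evt by (simp add: poly_image_ideal_prod)
  moreover have "evt t W \<in> QC m e" using assms evt_QC unfolding star_rel_def by blast
  ultimately show ?thesis
    using assms cong unfolding star_rel_def by (simp add: Pmod_cst_iff)
qed

section \<open>Transvections and moving\<close>

text \<open>The Eichler transvection of the quadratic form \<open>f(p) + s(s - 1)\<close> along \<open>h \<in> P\<^sup>*\<close>.\<close>
definition transvect :: "nat \<Rightarrow> 'b::comm_ring_1 vec \<Rightarrow> 'b coords \<Rightarrow> 'b coords" where
  "transvect m h u = (case u of (f, p, s) \<Rightarrow>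
     (\<lambda>i. f i + (1 - 2 * s - dot m h p) * h i, p, s + dot m h p))"

lemma transvect_QC: "u \<in> QC m e \<Longrightarrow> transvect m h u \<in> QC m e"
proof (cases u)
  case (fields f p s)
  assume "u \<in> QC m e"
  then have p: "p \<in> Pmod m e" "dot m f p + s * (s - 1) = 0" unfolding fields QC_def by auto
  have "dot m (\<lambda>i. f i + (1 - 2 * s - dot m h p) * h i) p + (s + dot m h p) * (s + dot m h p - 1)
      = dot m f p + s * (s - 1)"
    unfolding dot_simps by (simp add: algebra_simps)
  then show ?thesis using p unfolding fields transvect_def QC_def by simp
qed

lemma transvect_zero [simp]: "transvect m (\<lambda>i. 0) u = u"
  by (cases u) (simp add: transvect_def dot_simps)

text \<open>Here \<open>h\<close> may depend on T; if it vanishes at \<open>t\<close>, that end of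
  the homotopy stays fixed.\<close>

lemma evt_transvect: "evt t (transvect m h W) = transvect m (ev t h) (evt t W)"
proof (cases W)
  case (fields f p s)
  show ?thesis
    unfolding fields transvect_def evt_def prod.case dot_ev by (simp add: ev_def)
qed

lemma tr_transvect:
  assumes "u \<in> QC m e" "tr m e u = tr m e u'"
  shows "tr m e (transvect m h u) = tr m e (transvect m h u')"
proof -
  obtain f p s f' p' s' where U: "u = (f, p, s)" "u' = (f', p', s')" by (metis prod_cases3)
  have *: "lin m e f = lin m e f'" "p' = p" "s' = s" using assms(2) by (auto simp: U tr_def)
  have d: "dot m f v = dot m f' v" if "v \<in> Pmod m e" for v
    using fun_cong[OF *(1), of v] that by (simp add: lin_def)
  have "lin m e (\<lambda>i. f i + c * h i) = lin m e (\<lambda>i. f' i + c * h i)" for c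
    by (rule ext) (simp add: lin_def dot_simps d)
  then show ?thesis unfolding U transvect_def tr_def * by simp
qed

lemma eta_eq_tr:
  assumes "tr m e u = tr m e u'" shows "eta_eq m e u u'"
proof -
  obtain f p s f' p' s' where U: "u = (f, p, s)" "u' = (f', p', s')" by (metis prod_cases3)
  have *: "lin m e f = lin m e f'" "p' = p" "s' = s" using assms by (auto simp: U tr_def)
  have d: "dot m f v = dot m f' v" if "v \<in> Pmod m e" for v
    using fun_cong[OF *(1), of v] that by (simp add: lin_def)
  have "idl m e u = idl m e u'" unfolding idl_def U * prod.case
    by (intro Collect_cong ex_cong1) (auto simp: d)
  then show ?thesis unfolding eta_eq_def U by (simp add: d ideal_zero[OF is_ideal_prod])
qed

lemma transvect_homotopic:
  assumes "u \<in> QC m e" shows "(tr m e u, tr m e (transvect m h u)) \<in> htp_rel m e"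
proof -
  let ?W = "transvect m (\<lambda>i. [:0, 1:] * cst h i) (cstt u)"
  have "ev 0 (\<lambda>i. [:0, 1:] * cst h i) = (\<lambda>i. 0)" "ev 1 (\<lambda>i. [:0, 1:] * cst h i) = h"
    by (auto simp: ev_def cst_def)
  then have "evt 0 ?W = u" "evt 1 ?W = transvect m h u"
    unfolding evt_transvect evt_cstt by simp_all
  then show ?thesis
    using htp_rel_evt[OF transvect_QC[OF cstt_QC[OF assms]], of "\<lambda>i. [:0, 1:] * cst h i"] by simp
qed

text \<open>Scaling by \<open>1 - s\<close> keeps the zeros of the moved point away from the residual
  ideal \<open>f(P) + A(1 - s)\<close>.\<close>
lemma transvect_prime:
  assumes P: "prime_ideal P" and p: "p \<in> Pmod m e"
    and sub: "idl m e (transvect m (\<lambda>i. (1 - s) * g i) (f, p, s)) \<subseteq> P"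
  shows "1 - s \<notin> P" and "v \<in> Pmod m e \<Longrightarrow> dot m f v + (1 - s) * (1 - s) * dot m g v \<in> P"
proof -
  note I = prime_ideal_is_ideal[OF P]
  define c where "c = (1 - s) * dot m g p"
  have u': "transvect m (\<lambda>i. (1 - s) * g i) (f, p, s)
      = (\<lambda>i. f i + (1 - 2 * s - c) * ((1 - s) * g i), p, s + c)"
    unfolding transvect_def c_def prod.case dot_smult_left ..
  have s': "s + c \<in> P" using sub idl_scalar unfolding u' by blast
  show "1 - s \<notin> P"
  proof
    assume 1: "1 - s \<in> P"
    then have "c \<in> P" unfolding c_def by (rule ideal_mult_right[OF I])
    then have "(s + c) - c \<in> P" using s' ideal_diff[OF I] by blast
    then have "(1 - s) + s \<in> P" using ideal_add[OF I 1, of s] by simp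
    then show False using prime_ideal_one[OF P] by simp
  qed
  assume v: "v \<in> Pmod m e"
  have "dot m (\<lambda>i. f i + (1 - 2 * s - c) * ((1 - s) * g i)) v \<in> P"
    using sub idl_dot[OF v] unfolding u' by blast
  \<comment> \<open>Adding a multiple of \<open>s + c\<close>, which lies in \<open>P\<close>, turns
    the coefficient \<open>1 - 2 * s - c\<close> into \<open>1 - s\<close>. This removes
    \<open>c\<close>, which depends on \<open>g\<close>, and leaves a condition affine in
    \<open>g\<close>.\<close>
  then have "dot m (\<lambda>i. f i + (1 - 2 * s - c) * ((1 - s) * g i)) v + (s + c) * ((1 - s) * dot m g v) \<in> P"
    using ideal_mult_right[OF I s'] ideal_add[OF I] by blast
  then show "dot m f v + (1 - s) * (1 - s) * dot m g v \<in> P"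
    unfolding dot_simps by (simp add: algebra_simps)
qed

lemma height_ge_iff:
  "height_ge K n \<longleftrightarrow> (\<forall>p. prime_ideal p \<and> K \<subseteq> p \<longrightarrow> chain_height_ge n p)"
  unfolding height_ge_def chain_height_ge_def ..

lemma comax_mono: "comax I J \<Longrightarrow> I \<subseteq> I' \<Longrightarrow> J \<subseteq> J' \<Longrightarrow> comax I' J'"
  unfolding comax_def by blast

lemma height_ge_prod:
  assumes "height_ge I n" "height_ge J n" shows "height_ge (ideal_prod I J) n"
  unfolding height_ge_iff
proof (intro allI impI, elim conjE)
  fix p assume p: "prime_ideal p" "ideal_prod I J \<subseteq> p"
  then have "I \<subseteq> p \<or> J \<subseteq> p" by (rule prime_ideal_prod_subset)
  then show "chain_height_ge n p" using assms p(1) unfolding height_ge_iff by metis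
qed

lemma height_ge_UNIV: "height_ge UNIV n"
  unfolding height_ge_iff using prime_ideal_one by auto

text \<open>\<open>N\<close> bounds the number of primes in a chain, one more than the
  dimension.\<close>

locale homotopy_range =
  fixes m n N :: nat and e :: "'a::comm_ring_1 mat"
  assumes noeth: "noetherian TYPE('a)"
    and idem: "idempotent_mat m e"
    and bound: "chain_bound TYPE('a) N"
    and cover: "charts_cover m e n"
    and range: "N + 1 \<le> 2 * n"
begin

text \<open>Combines \<open>coht p + n \<le> N\<close> with \<open>range\<close>. The one to spare
  is what \<open>plumstead\<close> uses up at extended primes.\<close>

lemma coht_bound: "prime_ideal (p :: 'a set) \<Longrightarrow> height_ge J n \<Longrightarrow> J \<subseteq> p \<Longrightarrow> coht p + 1 \<le> n"
  using coht_height_bound[OF bound, of p n] range unfolding height_ge_iff by fastforce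

text \<open>The basic element argument is run with the multiplier \<open>(1 - s) * (1 - s)\<close>
  that \<open>transvect_prime\<close> produces, and its outcome is read both as a height and as a
  bound on \<open>coht\<close>.\<close>

lemma move:
  assumes u: "u \<in> QC m e" and J: "is_ideal J" "height_ge J n"
  shows "\<exists>h. height_ge (idl m e (transvect m h u)) n \<and> comax (idl m e (transvect m h u)) J"
proof -
  obtain f p s where U: "u = (f, p, s)" by (metis prod_cases3)
  have p: "p \<in> Pmod m e" using u unfolding U QC_def by simp
  define R where "R i p \<longleftrightarrow> chain_height_ge i p \<and> (J \<subseteq> p \<longrightarrow> coht p + i \<le> n)" for i p
  have "fin_exc R"
    using fin_exc_conj[OF fin_exc_height[OF noeth] fin_exc_coht[OF noeth bound J(1)]]
    unfolding R_def .
  moreover have "R 0 p" if "prime_ideal p" for p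
    using chain_height_ge_0[OF that] coht_bound[OF that J(2)] unfolding R_def by auto
  ultimately obtain g where g: "\<forall>P. prime_ideal P \<and> (1 - s) * (1 - s) \<notin> P \<and>
      (\<forall>v\<in>Pmod m e. dot m f v + (1 - s) * (1 - s) * dot m g v \<in> P) \<longrightarrow> R n P"
    using basic_element[OF cover, of R "(1 - s) * (1 - s)" f] by auto
  define h where "h = (\<lambda>i. (1 - s) * g i)"
  let ?I = "idl m e (transvect m h u)"
  have R: "R n P" if P: "prime_ideal P" "?I \<subseteq> P" for P
  proof -
    note tp = transvect_prime[OF P(1) p P(2)[unfolded h_def U]]
    have "(1 - s) * (1 - s) \<notin> P" using tp(1) by (simp add: prime_ideal_mult_iff[OF P(1)])
    then show ?thesis using g[rule_format, of P] tp(2) P(1) by blast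
  qed
  have "height_ge ?I n" unfolding height_ge_iff using R unfolding R_def by blast
  moreover have "comax ?I J"
  proof (rule comax_if_no_prime[OF noeth is_ideal_idl J(1)])
    fix P assume P: "prime_ideal P" "?I \<subseteq> P" "J \<subseteq> P"
    \<comment> \<open>\<open>R n P\<close> forces \<open>coht P + n \<le> n\<close>, but
      \<open>coht\<close> counts \<open>P\<close> itself and is positive.\<close>
    show False using R[OF P(1,2)] P(3) coht_pos[OF bound P(1)] unfolding R_def by simp
  qed
  ultimately show ?thesis by blast
qed

text \<open>The factor T(T - 1) fixes both ends but puts the primes containing T or T - 1 beyond the
  reach of the general choice. Those are excluded by the comaximality assumed at the two
  ends.\<close>

lemma move_homotopy:
  assumes H: "H \<in> QC m (polymat e)" and J: "height_ge (idl m e v) n"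
    and co: "comax (idl m e (evt 0 H)) (idl m e v)" "comax (idl m e (evt 1 H)) (idl m e v)"
  shows "\<exists>H'\<in>QC m (polymat e). evt 0 H' = evt 0 H \<and> evt 1 H' = evt 1 H \<and>
    comax (idl m (polymat e) H') (idl m (polymat e) (cstt v))"
proof -
  obtain F p S where U: "H = (F, p, S)" by (metis prod_cases3)
  have p: "p \<in> Pmod m (polymat e)" using H unfolding U QC_def by simp
  define J' where "J' = idl m (polymat e) (cstt v)"
  have J': "is_ideal J'" unfolding J'_def by (rule is_ideal_idl)
  define c :: "'a poly" where "c = [:0, 1:] * [:-1, 1:]"
  define a where "a = (1 - S) * (1 - S) * c"
  define R where "R i p \<longleftrightarrow> (J' \<subseteq> p \<longrightarrow> plumstead p + i \<le> n)" for i p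
  have "fin_exc R"
    using fin_exc_plumstead[OF noeth bound J'] unfolding R_def .
  moreover have "R 0 P" if P: "prime_ideal P" for P
  proof -
    have "plumstead P \<le> n" if "J' \<subseteq> P"
    proof -
      have "idl m e v \<subseteq> contr P"
        using idl_cstt[of _ m e v] that unfolding contr_def J'_def by blast
      then have "coht (contr P) + 1 \<le> n" by (rule coht_bound[OF prime_contr[OF P] J])
      then show ?thesis unfolding plumstead_def by simp
    qed
    then show ?thesis unfolding R_def by simp
  qed
  ultimately obtain g where g: "\<forall>P. prime_ideal P \<and> a \<notin> P \<and>
      (\<forall>v\<in>Pmod m (polymat e). dot m F v + a * dot m g v \<in> P) \<longrightarrow> R n P"
    using basic_element[OF charts_cover_polymat[OF cover], of R a F] by auto
  define h where "h = (\<lambda>i. (1 - S) * (c * g i))"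
  define H' where "H' = transvect m h H"
  have "ev t h = (\<lambda>i. 0)" if "t = 0 \<or> t = 1" for t
    using that by (auto simp: ev_def h_def c_def)
  then have ev01: "evt t H' = evt t H" if "t = 0 \<or> t = 1" for t
    unfolding H'_def evt_transvect using that by simp
  have "comax (idl m (polymat e) H') J'"
  proof (rule comax_if_no_prime[OF hilbert_basis[OF noeth] is_ideal_idl J'])
    fix P assume P: "prime_ideal P" "idl m (polymat e) H' \<subseteq> P" "J' \<subseteq> P"
    note I = prime_ideal_is_ideal[OF P(1)]
    \<comment> \<open>Modulo T - t a polynomial equals its value at \<open>t\<close>, so a prime
      containing T - t and both ideals would contain \<open>x + j = 1\<close>.\<close>
    have root: "[:- t, 1:] \<notin> P" if t: "t = 0 \<or> t = 1" for t
    proof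
      assume T: "[:- t, 1:] \<in> P"
      have "comax (idl m e (evt t H')) (idl m e v)" unfolding ev01[OF t] using t co by auto
      then obtain x j where xj: "x \<in> idl m e (evt t H')" "j \<in> idl m e v" "x + j = 1"
        unfolding comax_def by auto
      obtain y where y: "y \<in> idl m (polymat e) H'" "x = poly y t" using xj(1) unfolding idl_evt by auto
      have "[:- t, 1:] dvd y - [:x:]" using y(2) by (simp add: poly_eq_0_iff_dvd[symmetric])
      then obtain z where "y - [:x:] = [:- t, 1:] * z" ..
      then have "y - [:x:] \<in> P" using ideal_mult_right[OF I T] by simp
      then have "y - (y - [:x:]) \<in> P" using y(1) P(2) ideal_diff[OF I] by blast
      moreover have "[:j:] \<in> P" using idl_cstt[OF xj(2)] P(3) unfolding J'_def by blast
      ultimately have "[:x:] + [:j:] \<in> P" using ideal_add[OF I, of "[:x:]" "[:j:]"] by simp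
      then show False using xj(3) prime_ideal_one[OF P(1)] by (simp add: one_pCons)
    qed
    have "c \<notin> P" unfolding c_def prime_ideal_mult_iff[OF P(1)] using root[of 0] root[of 1] by simp
    note tp = transvect_prime[OF P(1) p P(2)[unfolded H'_def U h_def]]
    have "a \<notin> P" unfolding a_def using tp(1) \<open>c \<notin> P\<close> by (simp add: prime_ideal_mult_iff[OF P(1)])
    moreover have "dot m F x + a * dot m g x \<in> P" if "x \<in> Pmod m (polymat e)" for x
      using tp(2)[OF that] unfolding a_def dot_smult_left by (simp add: mult.assoc)
    ultimately have "R n P" using g[rule_format, of P] P(1) by blast
    moreover have "0 < plumstead P"
      unfolding plumstead_def using coht_pos[OF bound prime_contr[OF P(1)]] by simp
    ultimately show False using P(3) unfolding R_def by simp
  qed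
  moreover have "H' \<in> QC m (polymat e)" unfolding H'_def by (rule transvect_QC[OF H])
  ultimately show ?thesis using ev01 unfolding J'_def by blast
qed

text \<open>Once the homotopy is comaximal with the constant one at \<open>v\<close>, their star
  product exists over A[T]. Its ends need not be \<open>w0\<close> and \<open>w1\<close> but induce
  the same orientations.\<close>

lemma star_homotopy:
  assumes H: "H \<in> QC m (polymat e)" and v: "v \<in> QC m e" "height_ge (idl m e v) n"
    and co: "comax (idl m e (evt 0 H)) (idl m e v)" "comax (idl m e (evt 1 H)) (idl m e v)"
    and w0: "star_rel m e (evt 0 H) v w0" and w1: "star_rel m e (evt 1 H) v w1"
  shows "(tr m e w0, tr m e w1) \<in> htp_rel m e"
proof -
  obtain H' where H': "H' \<in> QC m (polymat e)" "evt 0 H' = evt 0 H" "evt 1 H' = evt 1 H"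
    "comax (idl m (polymat e) H') (idl m (polymat e) (cstt v))"
    using move_homotopy[OF H v(2) co] by blast
  obtain W where W: "star_rel m (polymat e) H' (cstt v) W"
    using star_exists[OF hilbert_basis[OF noeth] H'(1) cstt_QC[OF v(1)] H'(4)] by blast
  have st: "star_rel m e (evt 0 H) v (evt 0 W)" "star_rel m e (evt 1 H) v (evt 1 W)"
    using star_evt[OF W, of 0] star_evt[OF W, of 1] H'(2,3) by simp_all
  have QC: "w \<in> QC m e" if "star_rel m e u v w" for u w using that unfolding star_rel_def by simp
  have "(tr m e w0, tr m e (evt 0 W)) \<in> htp_rel m e"
    by (rule homotopic_if_eta_eq[OF noeth QC[OF w0] QC[OF st(1)]
      star_eta_eq[OF w0 st(1) eta_eq_refl eta_eq_refl co(1)]])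
  moreover have "(tr m e (evt 0 W), tr m e (evt 1 W)) \<in> htp_rel m e"
    by (rule htp_rel_evt) (use W in \<open>simp add: star_rel_def\<close>)
  moreover have "(tr m e (evt 1 W), tr m e w1) \<in> htp_rel m e"
    by (rule homotopic_if_eta_eq[OF noeth QC[OF st(2)] QC[OF w1]
      star_eta_eq[OF st(2) w1 eta_eq_refl eta_eq_refl co(2)]])
  ultimately show ?thesis by (meson htp_rel_trans)
qed

text \<open>Moving both ends of a homotopy by transvections that are the identity at the opposite end:
  this lets a chain of homotopies be moved link by link, without concatenating them.\<close>
lemma star_link:
  assumes W: "W \<in> QC m (polymat e)" and v: "v \<in> QC m e" "height_ge (idl m e v) n"
    and co: "comax (idl m e (transvect m h0 (evt 0 W))) (idl m e v)"
      "comax (idl m e (transvect m h1 (evt 1 W))) (idl m e v)"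
    and w: "star_rel m e (transvect m h0 (evt 0 W)) v w0" "star_rel m e (transvect m h1 (evt 1 W)) v w1"
  shows "(tr m e w0, tr m e w1) \<in> htp_rel m e"
proof -
  define k0 where "k0 = (\<lambda>i. [:1, -1:] * cst h0 i)"
  define k1 where "k1 = (\<lambda>i. [:0, 1:] * cst h1 i)"
  define H where "H = transvect m k1 (transvect m k0 W)"
  have k: "ev 0 k0 = h0" "ev 1 k0 = (\<lambda>i. 0)" "ev 0 k1 = (\<lambda>i. 0)" "ev 1 k1 = h1"
    by (auto simp: k0_def k1_def ev_def cst_def)
  have H01: "evt 0 H = transvect m h0 (evt 0 W)" "evt 1 H = transvect m h1 (evt 1 W)"
    unfolding H_def evt_transvect k by simp_all
  have "H \<in> QC m (polymat e)" unfolding H_def by (intro transvect_QC W)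
  then show ?thesis using star_homotopy[of H v w0 w1] v co w unfolding H01 by blast
qed

text \<open>Inner points of the chain may fail to be comaximal with \<open>v\<close>, so the claim
  is made for every transvected copy of the endpoint that is comaximal with \<open>v\<close>. It
  ranges over all \<open>u'\<close> with the given triple because the induction sees only
  triples.\<close>

lemma star_chain:
  assumes chain: "(tr m e u, y) \<in> htp_rel m e" and u: "u \<in> QC m e"
    and v: "v \<in> QC m e" "height_ge (idl m e v) n"
    and co: "comax (idl m e u) (idl m e v)" and w: "star_rel m e u v w"
  shows "\<forall>u'\<in>QC m e. tr m e u' = y \<longrightarrow> (\<forall>h w'. comax (idl m e (transvect m h u')) (idl m e v) \<and>
    star_rel m e (transvect m h u') v w' \<longrightarrow> (tr m e w, tr m e w') \<in> htp_rel m e)"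
  using chain unfolding htp_rel_def
proof (induction rule: rtrancl_induct)
  case base
  show ?case
    unfolding htp_rel_def[symmetric]
  proof (intro ballI impI allI, elim conjE)
    fix u' h w'
    assume u': "u' \<in> QC m e" "tr m e u' = tr m e u"
      and co': "comax (idl m e (transvect m h u')) (idl m e v)"
      and w': "star_rel m e (transvect m h u') v w'"
    have tu: "tr m e (transvect m h u') = tr m e (transvect m h u)"
      using tr_transvect[OF u'] .
    have eq: "eta_eq m e (transvect m h u') (transvect m h u)" by (rule eta_eq_tr[OF tu])
    have co'': "comax (idl m e (transvect m h u)) (idl m e v)"
      using co' eq unfolding eta_eq_def by simp
    obtain w'' where w'': "star_rel m e (transvect m h u) v w''"
      using star_exists[OF noeth transvect_QC[OF u] v(1) co''] by blast
    \<comment> \<open>The constant homotopy at \<open>u\<close>, moved at its end T = 1 only, joins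
      \<open>u\<close> to its transvected copy.\<close>
    have "(tr m e w, tr m e w'') \<in> htp_rel m e"
      using star_link[OF cstt_QC[OF u] v, of "\<lambda>i. 0" h w w''] co co'' w w'' by simp
    moreover have "eta_eq m e w' w''" by (rule star_eta_eq[OF w' w'' eq eta_eq_refl co'])
    then have "(tr m e w', tr m e w'') \<in> htp_rel m e"
      using homotopic_if_eta_eq[OF noeth] w' w'' unfolding star_rel_def by blast
    ultimately show "(tr m e w, tr m e w') \<in> htp_rel m e" using htp_rel_sym htp_rel_trans by blast
  qed
next
  case (step y z)
  note IH = step.IH[folded htp_rel_def, rule_format]
  obtain H where H: "H \<in> Qt m (polymat e)"
    "y = ev_triple m e 0 H \<and> z = ev_triple m e 1 H \<or> y = ev_triple m e 1 H \<and> z = ev_triple m e 0 H"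
    using step.hyps(2) unfolding htp_step_def by blast
  obtain W where W: "W \<in> QC m (polymat e)" "H = tr m (polymat e) W"
    using Qt_tr[OF idempotent_polymat[OF idem] H(1)] by blast
  have yz: "y = tr m e (evt 0 W) \<and> z = tr m e (evt 1 W) \<or> y = tr m e (evt 1 W) \<and> z = tr m e (evt 0 W)"
    using H(2) unfolding W(2) ev_triple_tr .
  \<comment> \<open>\<open>a\<close> and \<open>b\<close> are the ends of the link in either order,
    since steps of the chain may run backwards.\<close>
  have *: "(tr m e w, tr m e w') \<in> htp_rel m e"
    if y: "y = tr m e a" and z: "z = tr m e b" and ab: "a \<in> QC m e" "b \<in> QC m e"
      and link: "\<And>h0 h1 w0 w1. comax (idl m e (transvect m h0 a)) (idl m e v) \<Longrightarrow>
        comax (idl m e (transvect m h1 b)) (idl m e v) \<Longrightarrow>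
        star_rel m e (transvect m h0 a) v w0 \<Longrightarrow> star_rel m e (transvect m h1 b) v w1 \<Longrightarrow>
        (tr m e w0, tr m e w1) \<in> htp_rel m e"
      and u': "u' \<in> QC m e" "tr m e u' = z"
      and co': "comax (idl m e (transvect m h u')) (idl m e v)"
      and w': "star_rel m e (transvect m h u') v w'" for a b u' h w'
  proof -
    have eq: "eta_eq m e (transvect m h u') (transvect m h b)"
      by (rule eta_eq_tr[OF tr_transvect[OF u'(1)]]) (simp add: u'(2) z)
    have cob: "comax (idl m e (transvect m h b)) (idl m e v)"
      using co' eq unfolding eta_eq_def by simp
    obtain wb where wb: "star_rel m e (transvect m h b) v wb"
      using star_exists[OF noeth transvect_QC[OF ab(2)] v(1) cob] by blast
    \<comment> \<open>Puts the inner point \<open>a\<close> into a position to which the induction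
      hypothesis applies.\<close>
    obtain g where coa: "comax (idl m e (transvect m g a)) (idl m e v)"
      using move[OF ab(1) is_ideal_idl v(2)] by blast
    obtain wa where wa: "star_rel m e (transvect m g a) v wa"
      using star_exists[OF noeth transvect_QC[OF ab(1)] v(1) coa] by blast
    have "(tr m e w, tr m e wa) \<in> htp_rel m e" by (rule IH[OF ab(1) y[symmetric] conjI[OF coa wa]])
    moreover have "(tr m e wa, tr m e wb) \<in> htp_rel m e" by (rule link[OF coa cob wa wb])
    moreover have "eta_eq m e w' wb" by (rule star_eta_eq[OF w' wb eq eta_eq_refl co'])
    then have "(tr m e w', tr m e wb) \<in> htp_rel m e"
      using homotopic_if_eta_eq[OF noeth] w' wb unfolding star_rel_def by blast
    ultimately show ?thesis by (meson htp_rel_sym htp_rel_trans)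
  qed
  show ?case
    unfolding htp_rel_def[symmetric]
  proof (intro ballI impI allI, elim conjE)
    fix u' h w'
    assume u': "u' \<in> QC m e" "tr m e u' = z"
      and co': "comax (idl m e (transvect m h u')) (idl m e v)"
      and w': "star_rel m e (transvect m h u') v w'"
    from yz show "(tr m e w, tr m e w') \<in> htp_rel m e"
    proof (elim disjE conjE)
      assume "y = tr m e (evt 0 W)" "z = tr m e (evt 1 W)"
      then show ?thesis
        by (rule *[OF _ _ evt_QC[OF W(1)] evt_QC[OF W(1)] star_link[OF W(1) v] u' co' w'])
    next
      assume "y = tr m e (evt 1 W)" "z = tr m e (evt 0 W)"
      then show ?thesis
        by (rule *[OF _ _ evt_QC[OF W(1)] evt_QC[OF W(1)]
          htp_rel_sym[OF star_link[OF W(1) v]] u' co' w'])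
    qed
  qed
qed

lemma star_cong_left:
  assumes "(tr m e u, tr m e u') \<in> htp_rel m e" and "u \<in> QC m e" "u' \<in> QC m e"
    and "v \<in> QC m e" "height_ge (idl m e v) n"
    and "comax (idl m e u) (idl m e v)" "comax (idl m e u') (idl m e v)"
    and "star_rel m e u v w" "star_rel m e u' v w'"
  shows "(tr m e w, tr m e w') \<in> htp_rel m e"
  using star_chain[OF assms(1,2,4,5,6,8), rule_format, OF assms(3) refl, of "\<lambda>i. 0" w'] assms(7,9)
  by simp

text \<open>Both factors are replaced one at a time, through a representative of the second factor that is
  comaximal with both choices of the first and whose ideal has large height.\<close>
lemma star_cong:
  assumes uu: "(tr m e u, tr m e u') \<in> htp_rel m e" and vv: "(tr m e v, tr m e v') \<in> htp_rel m e"
    and QC: "u \<in> QC m e" "u' \<in> QC m e" "v \<in> QC m e" "v' \<in> QC m e"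
    and ht: "height_ge (idl m e u) n" "height_ge (idl m e u') n"
    and co: "comax (idl m e u) (idl m e v)" "comax (idl m e u') (idl m e v')"
    and w: "star_rel m e u v w" "star_rel m e u' v' w'"
  shows "(tr m e w, tr m e w') \<in> htp_rel m e"
proof -
  obtain h where h: "height_ge (idl m e (transvect m h v)) n"
    "comax (idl m e (transvect m h v)) (ideal_prod (idl m e u) (idl m e u'))"
    using move[OF QC(3) is_ideal_prod height_ge_prod[OF ht]] by blast
  define x where "x = transvect m h v"
  have x: "x \<in> QC m e" "height_ge (idl m e x) n" unfolding x_def using transvect_QC[OF QC(3)] h(1) by auto
  have vx: "(tr m e v, tr m e x) \<in> htp_rel m e" unfolding x_def by (rule transvect_homotopic[OF QC(3)])
  have xv': "(tr m e x, tr m e v') \<in> htp_rel m e" using vx vv by (meson htp_rel_sym htp_rel_trans)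
  have cox: "comax (idl m e x) (idl m e u)" "comax (idl m e x) (idl m e u')"
    unfolding x_def
    by (rule comax_mono[OF h(2) subset_refl ideal_prod_subset_left[OF is_ideal_idl]],
        rule comax_mono[OF h(2) subset_refl ideal_prod_subset_right[OF is_ideal_idl]])
  obtain y where y: "star_rel m e x u y" using star_exists[OF noeth x(1) QC(1) cox(1)] by blast
  obtain y' where y': "star_rel m e x u' y'" using star_exists[OF noeth x(1) QC(2) cox(2)] by blast
  have "(tr m e w, tr m e y) \<in> htp_rel m e"
    by (rule star_cong_left[OF vx QC(3) x(1) QC(1) ht(1) co(1)[unfolded comax_commute[of "idl m e u"]] cox(1)
      star_rel_commute[OF w(1)] y])
  moreover have "(tr m e y, tr m e y') \<in> htp_rel m e"
    by (rule star_cong_left[OF uu QC(1,2) x cox[unfolded comax_commute[of "idl m e x"]]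
      star_rel_commute[OF y] star_rel_commute[OF y']])
  moreover have "(tr m e y', tr m e w') \<in> htp_rel m e"
    by (rule star_cong_left[OF xv' x(1) QC(4) QC(2) ht(2) cox(2) co(2)[unfolded comax_commute[of "idl m e u'"]]
      y' star_rel_commute[OF w(2)]])
  ultimately show ?thesis by (meson htp_rel_trans)
qed

end

section \<open>Orientations and the sum\<close>

lemma zeta0_eq_iff: "zeta0 m e x = zeta0 m e y \<longleftrightarrow> (x, y) \<in> htp_rel m e"
  unfolding zeta0_def using htp_rel_refl htp_rel_sym htp_rel_trans by (smt (verit) Image_singleton_iff subsetI subset_antisym)

lemma mem_coset2: "y \<in> coset2 I x \<longleftrightarrow> y - x \<in> ideal_prod I I"
  unfolding coset2_def by (auto intro!: exI[of _ "y - x"])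

lemma coset2_eq_iff: "coset2 I x = coset2 I y \<longleftrightarrow> x - y \<in> ideal_prod I I"
proof
  assume "coset2 I x = coset2 I y"
  moreover have "x \<in> coset2 I x" unfolding mem_coset2 by (simp add: ideal_zero[OF is_ideal_prod])
  ultimately show "x - y \<in> ideal_prod I I" using mem_coset2 by blast
next
  assume xy: "x - y \<in> ideal_prod I I"
  have "z - x \<in> ideal_prod I I \<longleftrightarrow> z - y \<in> ideal_prod I I" for z
  proof
    assume "z - x \<in> ideal_prod I I"
    from ideal_add[OF is_ideal_prod this xy] show "z - y \<in> ideal_prod I I" by simp
  next
    assume "z - y \<in> ideal_prod I I"
    from ideal_diff[OF is_ideal_prod this xy] show "z - x \<in> ideal_prod I I" by simp
  qed
  then show "coset2 I x = coset2 I y" by (intro set_eqI) (simp add: mem_coset2)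
qed

definition orient :: "nat \<Rightarrow> 'b::comm_ring_1 mat \<Rightarrow> 'b coords \<Rightarrow> 'b vec \<Rightarrow> 'b set" where
  "orient m e u = (\<lambda>v. if v \<in> Pmod m e then coset2 (idl m e u) (dot m (fst u) v) else {})"

lemma eta_tr: "eta m e (tr m e u) = (idl m e u, orient m e u)"
proof (cases u)
  case (fields f p s)
  have 1: "{lin m e f q + a * s | q a. q \<in> Pmod m e} = idl m e u"
    unfolding idl_def fields prod.case
    by (intro Collect_cong ex_cong1) (auto simp: lin_def)
  have 2: "(\<lambda>v. if v \<in> Pmod m e then coset2 (idl m e u) (lin m e f v) else {}) = orient m e u"
    by (rule ext) (simp add: orient_def fields lin_def)
  show ?thesis
    unfolding eta_def tr_def fields prod.case Let_def 1[unfolded fields] 2[unfolded fields] ..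
qed

lemma eta_tr_eq_iff: "eta m e (tr m e u) = eta m e (tr m e u') \<longleftrightarrow> eta_eq m e u u'"
proof -
  have *: "orient m e u = orient m e u' \<longleftrightarrow>
      (\<forall>v\<in>Pmod m e. coset2 (idl m e u) (dot m (fst u) v) = coset2 (idl m e u') (dot m (fst u') v))"
    unfolding orient_def fun_eq_iff by auto
  show ?thesis unfolding eta_tr eta_eq_def prod.inject
    by (rule conj_cong[OF refl]) (simp add: * coset2_eq_iff)
qed

lemma eta_tr_LO: assumes "u \<in> QC m e" shows "(idl m e u, orient m e u) \<in> LO m e"
proof -
  obtain f p s where U: "u = (f, p, s)" by (metis prod_cases3)
  have "\<exists>v\<in>Pmod m e. a - dot m f v \<in> ideal_prod (idl m e u) (idl m e u)" if "a \<in> idl m e u" for a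
    using idl_surj[of f p s m e a] assms that unfolding U by blast
  moreover have "dot m f v \<in> idl m e u" if "v \<in> Pmod m e" for v unfolding U by (rule idl_dot[OF that])
  moreover have "dot m f (vadd v v') - dot m f v - dot m f v' = 0"
    "dot m f (vsmult c v) - c * dot m f v = 0" for v v' c
    unfolding vadd_def vsmult_def by (simp_all add: dot_simps)
  ultimately show ?thesis
    unfolding LO_def orient_def
    by (auto simp: is_ideal_idl U ideal_zero[OF is_ideal_prod] intro!: exI[of _ "dot m f"])
qed

text \<open>In \<open>LO\<close> the function \<open>w\<close> picks representatives of cosets, so
  it is linear only modulo the square of \<open>I\<close>.\<close>

lemma quasi_linear_sum:
  assumes add: "\<And>v v'. v \<in> Pmod m e \<Longrightarrow> v' \<in> Pmod m e \<Longrightarrow> w (vadd v v') - w v - w v' \<in> ideal_prod I I"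
    and smult: "\<And>c v. v \<in> Pmod m e \<Longrightarrow> w (vsmult c v) - c * w v \<in> ideal_prod I I"
    and "finite S" "\<And>k. k \<in> S \<Longrightarrow> x k \<in> Pmod m e"
  shows "w (\<lambda>i. \<Sum>k\<in>S. c k * x k i) - (\<Sum>k\<in>S. c k * w (x k)) \<in> ideal_prod I I"
  using assms(3,4)
proof (induction S rule: finite_induct)
  case empty
  show ?case using smult[OF Pmod_zero, of 0] by (simp add: vsmult_def)
next
  case (insert k S)
  let ?v = "vsmult (c k) (x k)" and ?w = "\<lambda>i. \<Sum>k\<in>S. c k * x k i"
  have P: "?v \<in> Pmod m e" "?w \<in> Pmod m e" "x k \<in> Pmod m e"
    unfolding vsmult_def using insert.prems by (auto intro!: Pmod_smult Pmod_sum)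
  have IH: "w ?w - (\<Sum>k\<in>S. c k * w (x k)) \<in> ideal_prod I I"
    using insert by simp
  have "(w (vadd ?v ?w) - w ?v - w ?w) + (w ?v - c k * w (x k)) + (w ?w - (\<Sum>k\<in>S. c k * w (x k))) \<in> ideal_prod I I"
    by (rule ideal_add[OF is_ideal_prod ideal_add[OF is_ideal_prod add[OF P(1,2)] smult[OF P(3)]] IH])
  then show ?case using insert.hyps by (simp add: vadd_def vsmult_def algebra_simps)
qed

text \<open>The values of \<open>w\<close> on the columns of \<open>e\<close> define a genuine
  functional with the same cosets, and \<open>triple_of_orientation\<close> completes it to a
  point.\<close>

lemma LO_obtain:
  fixes e :: "'b::comm_ring_1 mat"
  assumes noeth: "noetherian TYPE('b)" and idem: "idempotent_mat m e" and L: "(I, om) \<in> LO m e"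
  obtains u where "u \<in> QC m e" "idl m e u = I" "orient m e u = om"
proof -
  have I: "is_ideal I" and out: "\<forall>v. v \<notin> Pmod m e \<longrightarrow> om v = {}"
    and ex: "\<exists>w. (\<forall>v\<in>Pmod m e. w v \<in> I \<and> om v = coset2 I (w v)) \<and>
          (\<forall>v\<in>Pmod m e. \<forall>v'\<in>Pmod m e. w (vadd v v') - w v - w v' \<in> ideal_prod I I) \<and>
          (\<forall>c. \<forall>v\<in>Pmod m e. w (vsmult c v) - c * w v \<in> ideal_prod I I) \<and>
          (\<forall>a\<in>I. \<exists>v\<in>Pmod m e. a - w v \<in> ideal_prod I I)"
    using L unfolding LO_def by auto
  obtain w where w: "\<And>v. v \<in> Pmod m e \<Longrightarrow> w v \<in> I" "\<And>v. v \<in> Pmod m e \<Longrightarrow> om v = coset2 I (w v)"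
    "\<And>v v'. v \<in> Pmod m e \<Longrightarrow> v' \<in> Pmod m e \<Longrightarrow> w (vadd v v') - w v - w v' \<in> ideal_prod I I"
    "\<And>c v. v \<in> Pmod m e \<Longrightarrow> w (vsmult c v) - c * w v \<in> ideal_prod I I"
    "\<And>a. a \<in> I \<Longrightarrow> \<exists>v\<in>Pmod m e. a - w v \<in> ideal_prod I I"
    using ex by blast
  define f where "f = (\<lambda>k. w (col m e k))"
  have fw: "w v - dot m f v \<in> ideal_prod I I" if v: "v \<in> Pmod m e" for v
  proof -
    have "w (\<lambda>i. \<Sum>k<m. v k * col m e k i) - (\<Sum>k<m. v k * w (col m e k)) \<in> ideal_prod I I"
      by (rule quasi_linear_sum[OF w(3,4)]) (auto simp: col_in_Pmod[OF idem])
    then show ?thesis using Pmod_expand[OF v] by (simp add: dot_def f_def mult.commute)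
  qed
  have fI: "dot m f v \<in> I" if "v \<in> Pmod m e" for v
    using ideal_diff[OF I w(1)[OF that], of "w v - dot m f v"] fw[OF that]
      ideal_prod_subset_left[OF I] by auto
  have "\<exists>v\<in>Pmod m e. a - dot m f v \<in> ideal_prod I I" if aI: "a \<in> I" for a
  proof -
    obtain v where v: "v \<in> Pmod m e" "a - w v \<in> ideal_prod I I" using w(5)[OF aI] by blast
    from ideal_add[OF is_ideal_prod v(2) fw[OF v(1)]] show ?thesis using v(1) by auto
  qed
  then obtain p s where u: "(f, p, s) \<in> QC m e" "idl m e (f, p, s) = I"
    using triple_of_orientation[OF noeth I fI] by blast
  have "orient m e (f, p, s) v = om v" for v
  proof (cases "v \<in> Pmod m e")
    case True
    have "coset2 I (w v) = coset2 I (dot m f v)" unfolding coset2_eq_iff by (rule fw[OF True])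
    then show ?thesis unfolding orient_def u using True w(2) by simp
  qed (use out in \<open>simp add: orient_def\<close>)
  then have "orient m e (f, p, s) = om" by (rule ext)
  then show ?thesis using that u by blast
qed

section \<open>The involution and the two base points\<close>

lemma Gam_Qt: "x \<in> Qt m e \<Longrightarrow> Gam x \<in> Qt m e"
  unfolding Qt_def Gam_def by (auto simp: algebra_simps)

lemma ev_triple_Gam: "ev_triple m e t (Gam H) = Gam (ev_triple m e t H)"
  by (cases H) (simp add: ev_triple_def Gam_def)

lemma Gam_htp_rel:
  assumes "(x, y) \<in> htp_rel m e" shows "(Gam x, Gam y) \<in> htp_rel m e"
  using assms unfolding htp_rel_def
proof (induction rule: rtrancl_induct)
  case (step y z)
  have step': "(Gam a, Gam b) \<in> htp_step m e" if ab: "(a, b) \<in> htp_step m e" for a b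
  proof -
    obtain H where H: "H \<in> Qt m (polymat e)" "a = ev_triple m e 0 H" "b = ev_triple m e 1 H"
      using ab unfolding htp_step_def by blast
    show ?thesis
      unfolding htp_step_def H(2,3) using Gam_Qt[OF H(1)]
      by (intro CollectI exI[of _ "Gam H"]) (simp add: ev_triple_Gam)
  qed
  have "(Gam y, Gam z) \<in> htp_step m e \<union> (htp_step m e)\<inverse>" using step.hyps(2) step' by blast
  then show ?case using step.IH by (rule rtrancl_into_rtrancl[rotated])
qed simp

text \<open>The representative picked in \<open>Gam_t\<close> is immaterial, since
  \<open>Gam\<close> takes homotopies to homotopies.\<close>

lemma Gam_t_zeta0: "Gam_t m e (zeta0 m e x) = zeta0 m e (Gam x)"
proof -
  have "(SOME u. u \<in> zeta0 m e x) \<in> zeta0 m e x"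
    by (rule someI[of _ x]) (simp add: zeta0_def htp_rel_refl)
  then have "(x, SOME u. u \<in> zeta0 m e x) \<in> htp_rel m e" unfolding zeta0_def by simp
  then have "(Gam x, Gam (SOME u. u \<in> zeta0 m e x)) \<in> htp_rel m e" by (rule Gam_htp_rel)
  then show ?thesis unfolding Gam_t_def zeta0_eq_iff by (rule htp_rel_sym)
qed

lemma e0_eq: "e0 m e = zeta0 m e (tr m e ((\<lambda>i. 0), (\<lambda>i. 0), 0))"
    and e1_eq: "e1 m e = zeta0 m e (tr m e ((\<lambda>i. 0), (\<lambda>i. 0), 1))"
proof -
  have "lin m e (\<lambda>i. 0) = (\<lambda>v. 0)" by (rule ext) (simp add: lin_def dot_simps)
  then show "e0 m e = zeta0 m e (tr m e ((\<lambda>i. 0), (\<lambda>i. 0), 0))"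
    "e1 m e = zeta0 m e (tr m e ((\<lambda>i. 0), (\<lambda>i. 0), 1))"
    unfolding e0_def e1_def tr_def by simp_all
qed

lemma zero_QC: "((\<lambda>i. 0), (\<lambda>i. 0), 0) \<in> QC m e" "((\<lambda>i. 0), (\<lambda>i. 0), 1) \<in> QC m e"
  by (simp_all add: QC_def Pmod_zero dot_simps)

lemma idl_one: "idl m e (f, p, 1) = UNIV"
proof -
  have "x \<in> idl m e (f, p, 1)" for x
    using ideal_mult[OF is_ideal_idl idl_scalar[of 1 m e f p], of x] by simp
  then show ?thesis by blast
qed

text \<open>The path runs from (0,0,0) through (0,p,0) and (0,p,1) to (0,0,1). For zero functional
  and s equal to 0 or 1 the vector moves freely, and on the middle piece the functional (T - T^2)f
  balances s = T.\<close>

lemma e0_eq_e1_if_split: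
  fixes e :: "'a::comm_ring_1 mat"
  assumes p: "p \<in> Pmod m e" and fp: "dot m f p = 1"
  shows "e0 m e = e1 m e"
proof -
  let ?Z = "\<lambda>i::nat. 0 :: 'a poly"
  let ?scale = "(?Z, (\<lambda>i. [:0, 1:] * cst p i), 0)" and ?scale' = "(?Z, (\<lambda>i. [:0, 1:] * cst p i), 1)"
  let ?W = "((\<lambda>i. [:0, 1, -1:] * cst f i), cst p, [:0, 1:])"
  have "?scale \<in> QC m (polymat e)" "?scale' \<in> QC m (polymat e)" "?W \<in> QC m (polymat e)"
    unfolding QC_def by (auto simp: Pmod_smult Pmod_cst_iff p dot_simps dot_cst fp one_pCons
      simp del: mult_pCons_left mult_pCons_right) (simp add: one_pCons)
  note W = this[THEN htp_rel_evt]
  have "evt 0 ?scale = ((\<lambda>i. 0), (\<lambda>i. 0), 0)" "evt 1 ?scale = ((\<lambda>i. 0), p, 0)"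
    "evt 0 ?scale' = ((\<lambda>i. 0), (\<lambda>i. 0), 1)" "evt 1 ?scale' = ((\<lambda>i. 0), p, 1)"
    "evt 0 ?W = ((\<lambda>i. 0), p, 0)" "evt 1 ?W = ((\<lambda>i. 0), p, 1)"
    by (simp_all add: evt_def ev_def cst_def)
  note W' = W[unfolded this]
  show ?thesis
    unfolding e0_eq e1_eq zeta0_eq_iff
    using W' htp_rel_sym htp_rel_trans by meson
qed

lemma split_if_free_summand:
  fixes e :: "'b::comm_ring_1 mat"
  assumes idem: "idempotent_mat m e" and free: "has_free_summand m e"
  shows "\<exists>f. \<exists>p\<in>Pmod m e. dot m f p = 1"
proof -
  obtain m' and e' :: "'b mat" and \<phi> where
    bij: "bij_betw \<phi> (Pmod m e) (Pmod (Suc m') (diag_one m' e'))"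
    and add: "\<And>v w. v \<in> Pmod m e \<Longrightarrow> w \<in> Pmod m e \<Longrightarrow> \<phi> (vadd v w) = vadd (\<phi> v) (\<phi> w)"
    and smult: "\<And>c v. v \<in> Pmod m e \<Longrightarrow> \<phi> (vsmult c v) = vsmult c (\<phi> v)"
    using free unfolding has_free_summand_def by blast
  define d :: "'b vec" where "d = (\<lambda>i. if i = m' then 1 else 0)"
  have "d \<in> Pmod (Suc m') (diag_one m' e')"
    unfolding Pmod_iff dot_def d_def diag_one_def by auto
  then have "d \<in> \<phi> ` Pmod m e" using bij by (simp add: bij_betw_def)
  then obtain p where p: "p \<in> Pmod m e" "\<phi> p = d" by (metis imageE)
  \<comment> \<open>The coordinate of the free summand, extended by zero off \<open>P\<close> as
    \<open>dual\<close> demands.\<close>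
  define g where "g v = (if v \<in> Pmod m e then \<phi> v m' else 0)" for v
  have "vadd v w \<in> Pmod m e" "vsmult c v \<in> Pmod m e" if "v \<in> Pmod m e" "w \<in> Pmod m e" for v w c
    unfolding vadd_def vsmult_def using that by (simp_all add: Pmod_add Pmod_smult)
  then have "g \<in> dual m e"
    unfolding dual_def g_def by (auto simp: add smult) (simp_all add: vadd_def vsmult_def)
  then have "g = lin m e (\<lambda>k. g (col m e k))" by (rule dual_eq_lin[OF idem])
  from fun_cong[OF this, of p] have "dot m (\<lambda>k. g (col m e k)) p = 1"
    using p by (simp add: lin_def) (simp add: g_def d_def)
  then show ?thesis using p by blast
qed

context homotopy_range
begin

text \<open>Points with the same \<open>eta\<close> are homotopic, so the choice made in
  \<open>zeta\<close> does not matter.\<close>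

lemma zeta_eta:
  assumes u: "u \<in> QC m e" shows "zeta m e (idl m e u, orient m e u) = zeta0 m e (tr m e u)"
proof -
  define x where "x = (SOME x. x \<in> Qt m e \<and> eta m e x = (idl m e u, orient m e u))"
  have x: "x \<in> Qt m e \<and> eta m e x = eta m e (tr m e u)"
    unfolding x_def eta_tr by (rule someI[of _ "tr m e u"]) (simp add: tr_in_Qt[OF u] eta_tr)
  obtain u' where u': "u' \<in> QC m e" "x = tr m e u'" using Qt_tr[OF idem conjunct1[OF x]] .
  have "eta_eq m e u' u" using x unfolding u'(2) eta_tr_eq_iff by (rule conjunct2)
  then have "(tr m e u', tr m e u) \<in> htp_rel m e" by (rule homotopic_if_eta_eq[OF noeth u'(1) u])
  then show ?thesis unfolding zeta_def x_def[symmetric] u'(2) zeta0_eq_iff .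
qed

text \<open>A competing orientation is induced by some point \<open>w'\<close>, which then satisfies
  \<open>star_rel\<close> too, and \<open>star_eta_eq\<close> identifies the two
  orientations.\<close>

lemma star_orient:
  assumes w: "star_rel m e u v w" and co: "comax (idl m e u) (idl m e v)"
  shows "star m e (idl m e u) (orient m e u) (idl m e v) (orient m e v) = orient m e w"
  unfolding star_def
proof (rule the_equality)
  let ?I = "idl m e u" and ?J = "idl m e v"
  have idl: "idl m e w = ideal_prod ?I ?J" and QC: "w \<in> QC m e" using w unfolding star_rel_def by auto
  \<comment> \<open>\<open>star\<close> expresses that one orientation induces another by inclusion
    of cosets.\<close>
  have sub: "coset2 (ideal_prod ?I ?J) a \<subseteq> coset2 K b"
    if "is_ideal K" "ideal_prod ?I ?J \<subseteq> K" "a - b \<in> ideal_prod K K" for K a b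
  proof
    fix y assume "y \<in> coset2 (ideal_prod ?I ?J) a"
    then have "y - a \<in> ideal_prod K K" using ideal_prod_mono[OF that(2) that(2)] unfolding mem_coset2 by blast
    from ideal_add[OF is_ideal_prod this that(3)] show "y \<in> coset2 K b" unfolding mem_coset2 by simp
  qed
  have "orient m e w x \<subseteq> orient m e u x \<and> orient m e w x \<subseteq> orient m e v x" if x: "x \<in> Pmod m e" for x
    unfolding orient_def idl using x w unfolding star_rel_def
    by (auto intro!: sub is_ideal_idl ideal_prod_subset_left ideal_prod_subset_right
      simp del: subset_iff intro: subsetD[OF sub])
  then show "(ideal_prod ?I ?J, orient m e w) \<in> LO m e \<and>
      (\<forall>x\<in>Pmod m e. orient m e w x \<subseteq> orient m e u x \<and> orient m e w x \<subseteq> orient m e v x)"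
    using eta_tr_LO[OF QC] unfolding idl by blast
next
  let ?I = "idl m e u" and ?J = "idl m e v"
  fix om assume om: "(ideal_prod ?I ?J, om) \<in> LO m e \<and>
      (\<forall>x\<in>Pmod m e. om x \<subseteq> orient m e u x \<and> om x \<subseteq> orient m e v x)"
  obtain w' where w': "w' \<in> QC m e" "idl m e w' = ideal_prod ?I ?J" "orient m e w' = om"
    using LO_obtain[OF noeth idem conjunct1[OF om]] by blast
  have "dot m (fst w') x - dot m (fst u) x \<in> ideal_prod ?I ?I \<and>
      dot m (fst w') x - dot m (fst v) x \<in> ideal_prod ?J ?J" if x: "x \<in> Pmod m e" for x
  proof -
    have "dot m (fst w') x \<in> om x"
      unfolding w'(3)[symmetric] orient_def using x by (simp add: mem_coset2 ideal_zero[OF is_ideal_prod])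
    then have "dot m (fst w') x \<in> orient m e u x" "dot m (fst w') x \<in> orient m e v x"
      using om x by blast+
    then show ?thesis unfolding orient_def using x by (simp add: mem_coset2)
  qed
  then have "star_rel m e u v w'" unfolding star_rel_def using w' by blast
  then have "eta_eq m e w' w" using star_eta_eq[OF _ w eta_eq_refl eta_eq_refl co] by blast
  then show "om = orient m e w" using eta_tr_eq_iff[of m e w' w] w'(3) unfolding eta_tr by simp
qed

text \<open>\<open>LO_obtain\<close> realises every admissible choice in \<open>pplus\<close> by
  points, and \<open>star_cong\<close> shows that all of them give the same class.\<close>

lemma pplus_eq:
  assumes u: "u \<in> QC m e" and v: "v \<in> QC m e" and ht: "height_ge (idl m e u) n"
    and co: "comax (idl m e u) (idl m e v)" and w: "star_rel m e u v w"
  shows "pplus m e n (zeta0 m e (tr m e u)) (zeta0 m e (tr m e v)) = zeta0 m e (tr m e w)"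
  unfolding pplus_def
proof (rule some_equality)
  have w': "w \<in> QC m e" "idl m e w = ideal_prod (idl m e u) (idl m e v)"
    using w unfolding star_rel_def by auto
  have "{a + b | a b. a \<in> idl m e v \<and> b \<in> idl m e u} = UNIV"
    using comax_iff_sum[OF is_ideal_idl is_ideal_idl, of m e v m e u] co comax_commute by metis
  moreover have "zeta0 m e (tr m e w) = zeta m e (ideal_prod (idl m e u) (idl m e v),
      star m e (idl m e u) (orient m e u) (idl m e v) (orient m e v))"
    unfolding star_orient[OF w co] w'(2)[symmetric] zeta_eta[OF w'(1)] ..
  ultimately show "\<exists>K \<omega>K I \<omega>I. (K, \<omega>K) \<in> LO m e \<and> (I, \<omega>I) \<in> LO m e \<and>
      zeta0 m e (tr m e u) = zeta m e (K, \<omega>K) \<and> zeta0 m e (tr m e v) = zeta m e (I, \<omega>I) \<and>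
      {a + b | a b. a \<in> I \<and> b \<in> K} = UNIV \<and> height_ge K n \<and>
      zeta0 m e (tr m e w) = zeta m e (ideal_prod K I, star m e K \<omega>K I \<omega>I)"
    using eta_tr_LO[OF u] eta_tr_LO[OF v] zeta_eta[OF u] zeta_eta[OF v] ht
    by (intro exI[of _ "idl m e u"] exI[of _ "orient m e u"] exI[of _ "idl m e v"] exI[of _ "orient m e v"]) simp
next
  fix z
  assume "\<exists>K \<omega>K I \<omega>I. (K, \<omega>K) \<in> LO m e \<and> (I, \<omega>I) \<in> LO m e \<and>
      zeta0 m e (tr m e u) = zeta m e (K, \<omega>K) \<and> zeta0 m e (tr m e v) = zeta m e (I, \<omega>I) \<and>
      {a + b | a b. a \<in> I \<and> b \<in> K} = UNIV \<and> height_ge K n \<and>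
      z = zeta m e (ideal_prod K I, star m e K \<omega>K I \<omega>I)"
  then obtain K \<omega>K I \<omega>I where z: "(K, \<omega>K) \<in> LO m e" "(I, \<omega>I) \<in> LO m e"
      "zeta0 m e (tr m e u) = zeta m e (K, \<omega>K)" "zeta0 m e (tr m e v) = zeta m e (I, \<omega>I)"
      "{a + b | a b. a \<in> I \<and> b \<in> K} = UNIV" "height_ge K n"
      "z = zeta m e (ideal_prod K I, star m e K \<omega>K I \<omega>I)"
    by (elim exE conjE)
  obtain k where k: "k \<in> QC m e" "idl m e k = K" "orient m e k = \<omega>K"
    using LO_obtain[OF noeth idem z(1)] by blast
  obtain i where i: "i \<in> QC m e" "idl m e i = I" "orient m e i = \<omega>I"
    using LO_obtain[OF noeth idem z(2)] by blast
  have co': "comax (idl m e k) (idl m e i)"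
    using z(5) comax_iff_sum[OF is_ideal_idl is_ideal_idl, of m e i m e k] comax_commute
    unfolding k(2) i(2) by metis
  obtain w' where w': "star_rel m e k i w'" using star_exists[OF noeth k(1) i(1) co'] by blast
  have wQ: "w' \<in> QC m e" "idl m e w' = ideal_prod K I" using w' k i unfolding star_rel_def by auto
  have "z = zeta0 m e (tr m e w')"
    using star_orient[OF w' co'] zeta_eta[OF wQ(1)] unfolding z(7) k i wQ(2) by simp
  moreover have "(tr m e k, tr m e u) \<in> htp_rel m e" "(tr m e i, tr m e v) \<in> htp_rel m e"
    using z(3,4) zeta_eta[OF k(1)] zeta_eta[OF i(1)] unfolding k i by (simp_all flip: zeta0_eq_iff)
  then have "(tr m e w', tr m e w) \<in> htp_rel m e"
    using star_cong[OF _ _ k(1) u i(1) v _ ht co' co w' w] z(6) k(2) by simp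
  ultimately show "z = zeta0 m e (tr m e w)" by (simp add: zeta0_eq_iff)
qed

section \<open>The laws of the sum\<close>

lemma zeta0_in_pi0: "u \<in> QC m e \<Longrightarrow> zeta0 m e (tr m e u) \<in> pi0 m e"
  unfolding pi0_def zeta0_def by (intro quotientI tr_in_Qt)

lemma pi0_moved:
  assumes "x \<in> pi0 m e" "is_ideal J" "height_ge J n"
  obtains u where "u \<in> QC m e" "x = zeta0 m e (tr m e u)" "height_ge (idl m e u) n" "comax (idl m e u) J"
proof -
  obtain y where "y \<in> Qt m e" "x = zeta0 m e y"
    using assms(1) unfolding pi0_def zeta0_def by (auto elim: quotientE)
  then obtain v where v: "v \<in> QC m e" "x = zeta0 m e (tr m e v)" using Qt_tr[OF idem] by metis
  obtain h where h: "height_ge (idl m e (transvect m h v)) n" "comax (idl m e (transvect m h v)) J"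
    using move[OF v(1) assms(2,3)] by blast
  have "x = zeta0 m e (tr m e (transvect m h v))"
    unfolding v(2) zeta0_eq_iff by (rule transvect_homotopic[OF v(1)])
  then show ?thesis using that[OF transvect_QC[OF v(1)]] h by blast
qed

lemma pi0_moved2:
  assumes "x \<in> pi0 m e" "y \<in> pi0 m e"
  obtains u v w where "u \<in> QC m e" "v \<in> QC m e" "x = zeta0 m e (tr m e u)" "y = zeta0 m e (tr m e v)"
    "height_ge (idl m e u) n" "height_ge (idl m e v) n" "comax (idl m e u) (idl m e v)" "star_rel m e u v w"
proof -
  \<comment> \<open>With the unit ideal in the role of \<open>J\<close>, only the height is
    imposed.\<close>
  obtain v where v: "v \<in> QC m e" "y = zeta0 m e (tr m e v)" "height_ge (idl m e v) n"
    using pi0_moved[OF assms(2) is_ideal_UNIV height_ge_UNIV] by blast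
  obtain u where u: "u \<in> QC m e" "x = zeta0 m e (tr m e u)" "height_ge (idl m e u) n"
    "comax (idl m e u) (idl m e v)"
    using pi0_moved[OF assms(1) is_ideal_idl v(3)] by blast
  show ?thesis using star_exists[OF noeth u(1) v(1) u(4)] that[OF u(1) v(1) u(2) v(2) u(3) v(3) u(4)] by blast
qed

lemma pplus_commute:
  assumes "x \<in> pi0 m e" "y \<in> pi0 m e"
  shows "pplus m e n x y \<in> pi0 m e \<and> pplus m e n x y = pplus m e n y x"
proof -
  obtain u v w where uv: "u \<in> QC m e" "v \<in> QC m e" "x = zeta0 m e (tr m e u)" "y = zeta0 m e (tr m e v)"
    "height_ge (idl m e u) n" "height_ge (idl m e v) n" "comax (idl m e u) (idl m e v)" "star_rel m e u v w"
    using pi0_moved2[OF assms] .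
  have "w \<in> QC m e" using uv(8) unfolding star_rel_def by simp
  moreover have "pplus m e n x y = zeta0 m e (tr m e w)"
    unfolding uv(3,4) by (rule pplus_eq[OF uv(1,2,5,7,8)])
  moreover have "pplus m e n y x = zeta0 m e (tr m e w)"
    unfolding uv(3,4) using uv(7) comax_commute
    by (intro pplus_eq[OF uv(2,1,6) _ star_rel_commute[OF uv(8)]]) blast
  ultimately show ?thesis using zeta0_in_pi0 by simp
qed

text \<open>\<open>b\<close> and \<open>c\<close> agree modulo the square of \<open>?J\<close> by
  way of \<open>a\<close> and \<open>v\<close>, and modulo the square of \<open>?K\<close> by way of
  \<open>w\<close>; comaximality of \<open>?J\<close> and \<open>?K\<close> combines the
  two.\<close>

lemma star_rel_assoc:
  assumes QC: "u \<in> QC m e" "v \<in> QC m e" "w \<in> QC m e"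
    and co: "comax (idl m e u) (idl m e v)" "comax (idl m e u) (idl m e w)" "comax (idl m e v) (idl m e w)"
    and a: "star_rel m e u v a" and b: "star_rel m e a w b" and c: "star_rel m e v w c"
  shows "star_rel m e u c b"
proof -
  let ?I = "idl m e u" and ?J = "idl m e v" and ?K = "idl m e w"
  have idl: "idl m e a = ideal_prod ?I ?J" "idl m e b = ideal_prod (idl m e a) ?K" "idl m e c = ideal_prod ?J ?K"
    using a b c unfolding star_rel_def by auto
  have mono: "ideal_prod (idl m e a) (idl m e a) \<subseteq> ideal_prod ?I ?I"
    "ideal_prod (idl m e a) (idl m e a) \<subseteq> ideal_prod ?J ?J"
    unfolding idl(1) by (intro ideal_prod_mono ideal_prod_subset_left ideal_prod_subset_right is_ideal_idl)+
  have "dot m (fst b) x - dot m (fst u) x \<in> ideal_prod ?I ?I"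
    "dot m (fst b) x - dot m (fst c) x \<in> ideal_prod (idl m e c) (idl m e c)" if x: "x \<in> Pmod m e" for x
  proof -
    let ?d = "\<lambda>s t. dot m (fst s) x - dot m (fst t) x"
    have ba: "?d b a \<in> ideal_prod (idl m e a) (idl m e a)" and bw: "?d b w \<in> ideal_prod ?K ?K"
      using b[unfolded star_rel_def] x by blast+
    have au: "?d a u \<in> ideal_prod ?I ?I" and av: "?d a v \<in> ideal_prod ?J ?J"
      using a[unfolded star_rel_def] x by blast+
    have cv: "?d c v \<in> ideal_prod ?J ?J" and cw: "?d c w \<in> ideal_prod ?K ?K"
      using c[unfolded star_rel_def] x by blast+
    from ideal_add[OF is_ideal_prod subsetD[OF mono(1) ba] au]
    show "?d b u \<in> ideal_prod ?I ?I" by simp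
    have "?d b c \<in> ideal_prod ?J ?J"
      using ideal_diff[OF is_ideal_prod ideal_add[OF is_ideal_prod subsetD[OF mono(2) ba] av] cv] by simp
    moreover have "?d b c \<in> ideal_prod ?K ?K" using ideal_diff[OF is_ideal_prod bw cw] by simp
    ultimately show "?d b c \<in> ideal_prod (idl m e c) (idl m e c)"
      unfolding idl(3) by (rule inter_squares[OF is_ideal_idl is_ideal_idl co(3)])
  qed
  moreover have "b \<in> QC m e" using b unfolding star_rel_def by simp
  ultimately show ?thesis
    unfolding star_rel_def using idl by (simp add: ideal_prod_assoc)
qed

lemma pplus_assoc:
  assumes "x \<in> pi0 m e" "y \<in> pi0 m e" "z \<in> pi0 m e"
  shows "pplus m e n (pplus m e n x y) z = pplus m e n x (pplus m e n y z)"
proof -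
  obtain v w c where vw: "v \<in> QC m e" "w \<in> QC m e" "y = zeta0 m e (tr m e v)" "z = zeta0 m e (tr m e w)"
    "height_ge (idl m e v) n" "height_ge (idl m e w) n" "comax (idl m e v) (idl m e w)" "star_rel m e v w c"
    using pi0_moved2[OF assms(2,3)] .
  have ht: "height_ge (ideal_prod (idl m e v) (idl m e w)) n" by (rule height_ge_prod[OF vw(5,6)])
  obtain u where u: "u \<in> QC m e" "x = zeta0 m e (tr m e u)" "height_ge (idl m e u) n"
    "comax (idl m e u) (ideal_prod (idl m e v) (idl m e w))"
    using pi0_moved[OF assms(1) is_ideal_prod ht] .
  have co: "comax (idl m e u) (idl m e v)" "comax (idl m e u) (idl m e w)"
    by (rule comax_mono[OF u(4) subset_refl ideal_prod_subset_left[OF is_ideal_idl]],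
        rule comax_mono[OF u(4) subset_refl ideal_prod_subset_right[OF is_ideal_idl]])
  obtain a where a: "star_rel m e u v a" using star_exists[OF noeth u(1) vw(1) co(1)] by blast
  have aQ: "a \<in> QC m e" "idl m e a = ideal_prod (idl m e u) (idl m e v)" using a unfolding star_rel_def by auto
  have cQ: "c \<in> QC m e" "idl m e c = ideal_prod (idl m e v) (idl m e w)" using vw(8) unfolding star_rel_def by auto
  have hta: "height_ge (idl m e a) n" unfolding aQ(2) by (rule height_ge_prod[OF u(3) vw(5)])
  have "comax (idl m e w) (ideal_prod (idl m e u) (idl m e v))"
    using comax_prod[OF is_ideal_idl] co(2) vw(7) comax_commute by metis
  then have coaw: "comax (idl m e a) (idl m e w)" unfolding aQ(2) using comax_commute by blast
  obtain b where b: "star_rel m e a w b" using star_exists[OF noeth aQ(1) vw(2) coaw] by blast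
  have b': "star_rel m e u c b" by (rule star_rel_assoc[OF u(1) vw(1,2) co vw(7) a b vw(8)])
  have "pplus m e n (pplus m e n x y) z = zeta0 m e (tr m e b)"
    unfolding u(2) vw(3,4) pplus_eq[OF u(1) vw(1) u(3) co(1) a] by (rule pplus_eq[OF aQ(1) vw(2) hta coaw b])
  moreover have "pplus m e n x (pplus m e n y z) = zeta0 m e (tr m e b)"
    unfolding u(2) vw(3,4) pplus_eq[OF vw(1,2,5,7,8)]
    by (rule pplus_eq[OF u(1) cQ(1) u(3) u(4)[folded cQ(2)] b'])
  ultimately show ?thesis by simp
qed

lemma pplus_e1:
  assumes "x \<in> pi0 m e"
  shows "pplus m e n x (e1 m e) = x" and "e1 m e \<in> pi0 m e"
proof -
  let ?o = "((\<lambda>i. 0), (\<lambda>i. 0), 1) :: 'a coords"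
  obtain u where u: "u \<in> QC m e" "x = zeta0 m e (tr m e u)" "height_ge (idl m e u) n"
    "comax (idl m e u) UNIV"
    using pi0_moved[OF assms is_ideal_UNIV height_ge_UNIV] .
  \<comment> \<open>The ideal of \<open>?o\<close> is the unit ideal, modulo which every congruence
    holds, so \<open>u\<close> itself is a star product.\<close>
  have "star_rel m e u ?o u"
    unfolding star_rel_def idl_one
    by (simp add: u(1) ideal_prod_UNIV[OF is_ideal_idl] ideal_prod_UNIV[OF is_ideal_UNIV] ideal_zero[OF is_ideal_prod])
  then show "pplus m e n x (e1 m e) = x"
    unfolding u(2) e1_eq using u(4) by (intro pplus_eq[OF u(1) zero_QC(2) u(3)]) (simp_all add: idl_one)
  show "e1 m e \<in> pi0 m e" unfolding e1_eq by (rule zeta0_in_pi0[OF zero_QC(2)])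
qed

text \<open>The ideal \<open>f(P)\<close> is the product of \<open>f(P) + As\<close> and its residual \<open>f(P) + A(1 - s)\<close>, and
  \<open>(f,0,0)\<close> is contracted to \<open>(0,0,0)\<close> by scaling \<open>f\<close>.\<close>
lemma pplus_Gam:
  assumes "x \<in> pi0 m e" shows "pplus m e n x (Gam_t m e x) = e0 m e" and "Gam_t m e x \<in> pi0 m e"
proof -
  obtain u where u: "u \<in> QC m e" "x = zeta0 m e (tr m e u)" "height_ge (idl m e u) n"
    using pi0_moved[OF assms is_ideal_UNIV height_ge_UNIV] by blast
  obtain f p s where U: "u = (f, p, s)" by (metis prod_cases3)
  define v where "v = (f, p, 1 - s)"
  have p: "p \<in> Pmod m e" "dot m f p + s * (s - 1) = 0" using u(1) unfolding U QC_def by auto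
  then have v: "v \<in> QC m e" unfolding v_def QC_def by (auto simp: algebra_simps)
  have Gx: "Gam_t m e x = zeta0 m e (tr m e v)"
    unfolding u(2) Gam_t_zeta0 U v_def tr_def Gam_def by simp
  show "Gam_t m e x \<in> pi0 m e" unfolding Gx by (rule zeta0_in_pi0[OF v])
  define w where "w = (f, (\<lambda>i::nat. 0 :: 'a), 0 :: 'a)"
  have wQ: "w \<in> QC m e" unfolding w_def QC_def by (simp add: Pmod_zero dot_simps)
  have s: "s \<in> idl m e u" "1 - s \<in> idl m e v" unfolding U v_def by (rule idl_scalar)+
  have co: "comax (idl m e u) (idl m e v)" unfolding comax_def using s by (metis add.commute diff_add_cancel)
  have f: "dot m f q \<in> idl m e u" "dot m f q \<in> idl m e v" "dot m f q \<in> idl m e w" if "q \<in> Pmod m e" for q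
    unfolding U v_def w_def by (rule idl_dot[OF that])+
  have "idl m e w = ideal_prod (idl m e u) (idl m e v)"
  proof
    show "idl m e w \<subseteq> ideal_prod (idl m e u) (idl m e v)"
      unfolding w_def
      by (rule idl_least[OF is_ideal_prod])
        (auto intro: inter_subset_prod[OF is_ideal_idl is_ideal_idl co] f ideal_zero is_ideal_prod)
    show "ideal_prod (idl m e u) (idl m e v) \<subseteq> idl m e w"
    proof (rule ideal_prod_least[OF is_ideal_idl])
      fix a b assume "a \<in> idl m e u" "b \<in> idl m e v"
      then obtain q c q' c' where q: "q \<in> Pmod m e" "q' \<in> Pmod m e" "a = dot m f q + c * s"
        "b = dot m f q' + c' * (1 - s)"
        unfolding U v_def idl_def by auto
      have dp: "s * (1 - s) = dot m f p" using p(2) by (simp add: algebra_simps eq_neg_iff_add_eq_0)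
      \<comment> \<open>Every term is a multiple of a value of \<open>f\<close>, the last one
        because \<open>s * (1 - s) = f(p)\<close>.\<close>
      have "a * b = b * dot m f q + (c * s) * dot m f q' + (c * c') * (s * (1 - s))"
        unfolding q(3,4) by (simp add: algebra_simps)
      also have "\<dots> \<in> idl m e w"
        unfolding dp by (intro ideal_add ideal_mult is_ideal_idl f q p)
      finally show "a * b \<in> idl m e w" .
    qed
  qed
  \<comment> \<open>The three points share the functional \<open>f\<close>, so the congruences are
    trivial.\<close>
  then have "star_rel m e u v w"
    unfolding star_rel_def using wQ by (simp add: U v_def w_def ideal_zero[OF is_ideal_prod])
  then have "pplus m e n x (Gam_t m e x) = zeta0 m e (tr m e w)"
    unfolding Gx unfolding u(2) by (rule pplus_eq[OF u(1) v u(3) co])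
  moreover have "zeta0 m e (tr m e w) = e0 m e"
  proof -
    let ?W = "((\<lambda>i. [:0, 1:] * cst f i), (\<lambda>i::nat. 0 :: 'a poly), 0 :: 'a poly)"
    have "?W \<in> QC m (polymat e)" unfolding QC_def by (simp add: Pmod_zero dot_zero_right)
    note H = htp_rel_evt[OF this]
    have "evt 0 ?W = ((\<lambda>i. 0), (\<lambda>i. 0), 0)" "evt 1 ?W = w"
      by (simp_all add: evt_def ev_def cst_def w_def)
    note H' = H[unfolded this]
    show ?thesis unfolding e0_eq zeta0_eq_iff by (rule htp_rel_sym[OF H'])
  qed
  ultimately show "pplus m e n x (Gam_t m e x) = e0 m e" by simp
qed

end

theorem theorem5p11:
  fixes m n d :: nat and e :: "'a::comm_ring_1 mat"
  assumes "regular_ring TYPE('a)"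
    and "contains_field_half TYPE('a)"
    and "krull_dim_eq TYPE('a) d"
    and "idempotent_mat m e"
    and "proj_rank m e n"
    and "2 * n \<ge> d + 2"
  shows "(\<forall>x\<in>pi0 m e. \<forall>y\<in>pi0 m e. pplus m e n x y \<in> pi0 m e \<and> pplus m e n x y = pplus m e n y x)
       \<and> (\<forall>x\<in>pi0 m e. \<forall>y\<in>pi0 m e. \<forall>z\<in>pi0 m e.
            pplus m e n (pplus m e n x y) z = pplus m e n x (pplus m e n y z))
       \<and> e1 m e \<in> pi0 m e
       \<and> (\<forall>x\<in>pi0 m e. pplus m e n x (e1 m e) = x \<and> pplus m e n (e1 m e) x = x)
       \<and> (\<forall>x\<in>pi0 m e. pplus m e n x (Gam_t m e x) = e0 m e)
       \<and> (e0 m e = e1 m e \<longrightarrow> (\<forall>x\<in>pi0 m e. \<exists>y\<in>pi0 m e. pplus m e n x y = e1 m e))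
       \<and> (has_free_summand m e \<longrightarrow> (\<forall>x\<in>pi0 m e. \<exists>y\<in>pi0 m e. pplus m e n x y = e1 m e))"
proof -
  have noeth: "noetherian TYPE('a)" using assms(1) by (simp add: regular_ring_def)
  have bound: "chain_bound TYPE('a) (d + 1)"
    using assms(3) unfolding krull_dim_eq_def chain_bound_def by simp
  \<comment> \<open>With \<open>N = d + 1\<close> the assumption \<open>range\<close> becomes
    \<open>d + 2 \<le> 2 * n\<close>.\<close>
  interpret homotopy_range m n "d + 1" e
    using noeth assms(4) bound charts_cover_proj_rank[OF noeth assms(4,5)] assms(6)
    by unfold_locales simp_all
  have e1: "e1 m e \<in> pi0 m e" using zeta0_in_pi0[OF zero_QC(2)] by (simp add: e1_eq)
  have inv: "\<exists>y\<in>pi0 m e. pplus m e n x y = e1 m e" if "e0 m e = e1 m e" "x \<in> pi0 m e" for x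
    using pplus_Gam[OF that(2)] that(1) by (intro bexI[of _ "Gam_t m e x"]) simp_all
  have free: "e0 m e = e1 m e" if "has_free_summand m e"
    using split_if_free_summand[OF assms(4) that] e0_eq_e1_if_split by blast
  have unit: "pplus m e n x (e1 m e) = x \<and> pplus m e n (e1 m e) x = x" if "x \<in> pi0 m e" for x
    using pplus_e1(1)[OF that] pplus_commute[OF that e1] by simp
  show ?thesis
    using pplus_commute pplus_assoc e1 unit pplus_Gam(1) inv free by (intro conjI ballI impI) simp_all
qed

end
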